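(* Let $\widetilde{H} \subset L$ be a light-cone regular domain and suppose that the equation $f_h = \Phi(f_{h+v_1},\ldots,f_{h+v_N})$ ($h \in L$) has the Laurent property, the irreducibility and the coprimeness on $\widetilde{H}$. Then for every light-cone regular domain $H \subset L$, the equation has the Laurent property, the irreducibility and the coprimeness on $H$.
   Context: Let $R$ be a unique factorization domain with field of fractions $K$. Let $L$ be a finitely generated $\mathbb{Z}$-module (possibly with torsion). Fix distinct $v_1,\dots,v_N\in L$ which generate $L$ as a $\mathbb{Z}$-module and are linearly independent over $\mathbb{Z}_{\ge 0}$ (i.e. $\sum_i a_i v_i=0$ with all $a_i\in\mathbb{Z}_{\ge0}$ forces $a_1=\dots=a_N=0$), and an irreducible Laurent polynomial $\Phi\in R[Y_1^{\pm1},\dots,Y_N^{\pm1}]$ which is not a Laurent monomial and depends on every variable $Y_1,\dots,Y_N$. Consider the equation $f_h=\Phi(f_{h+v_1},\dots,f_{h+v_N})$ ($h\in L$). Let $S=\{\sum_i a_iv_i : a_i\in\mathbb{Z}_{\ge0}\}$ and define the partial order $h_1\le h_2$ iff $h_1-h_2\in S$. Assume further that $v_N$ is the minimum of $\{0,v_1,\dots,v_N\}$ with respect to $\le$ and that the equation can be solved as $f_{h+v_N}=\Psi(f_{h+v_1},\dots,f_{h+v_{N-1}},f_h)$ with $\Psi$ an irreducible Laurent polynomial with coefficients in $R$. A nonempty subset $H\subset L$ is light-cone regular if for every $h\in H$ the set $\{h'\in H: h'\le h\}$ is finite and $\{h'\in L: h'\ge h\}\subset H$. Its initial boundary is $H_0=\{h\in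 H:\ h+v_i\notin H\text{ for some }i\}$. For such $H$, the $f_{h}$ ($h\in H_0$) are algebraically independent indeterminates over $K$ (the initial variables), and for $h\in H\setminus H_0$ (where all $h+v_i\in H$) the value $f_h$ is defined recursively by the equation as an element of the rational function field $K(f_{h_0}: h_0\in H_0)$. For $T\subset L$ write $R_T=R[f_h^{\pm1}: h\in T]$ and $K_T=K[f_h^{\pm1}: h\in T]$. The equation has the Laurent property on $H$ if $f_h\in R_{H_0}$ for all $h\in H$; assuming the Laurent property, it has the irreducibility on $H$ if every $f_h$ ($h\in H$) is irreducible in $R_{H_0}$ (by convention, units are counted as irreducible), and the coprimeness on $H$ if $f_{h_1}$ and $f_{h_2}$ are coprime in $R_{H_0}$ for all $h_1\neq h_2$ in $H$. *)

theory Defs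
  imports "HOL-Library.Poly_Mapping" "HOL-Computational_Algebra.Fraction_Field"
    "HOL-Computational_Algebra.Factorial_Ring"
begin

definition nsc :: "nat \<Rightarrow> 'a::ab_group_add \<Rightarrow> 'a" where
  "nsc n x = (((+) x) ^^ n) 0"

definition zsc :: "int \<Rightarrow> 'a::ab_group_add \<Rightarrow> 'a" where
  "zsc k x = (if 0 \<le> k then nsc (nat k) x else - nsc (nat (- k)) x)"

text \<open>vectors v 0, ..., v (N-1) play the role of v_1, ..., v_N\<close>
definition cone :: "(nat \<Rightarrow> 'a::ab_group_add) \<Rightarrow> nat \<Rightarrow> 'a set" where
  "cone v N = {x. \<exists>a::nat \<Rightarrow> nat. x = (\<Sum>i<N. nsc (a i) (v i))}"

definition cle :: "(nat \<Rightarrow> 'a::ab_group_add) \<Rightarrow> nat \<Rightarrow> 'a \<Rightarrow> 'a \<Rightarrow> bool" where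
  "cle v N h1 h2 \<longleftrightarrow> h1 - h2 \<in> cone v N"

definition light_cone_regular :: "(nat \<Rightarrow> 'a::ab_group_add) \<Rightarrow> nat \<Rightarrow> 'a set \<Rightarrow> bool" where
  "light_cone_regular v N H \<longleftrightarrow> H \<noteq> {} \<and>
     (\<forall>h\<in>H. finite {h'\<in>H. cle v N h' h} \<and> {h'. cle v N h h'} \<subseteq> H)"

definition init_bd :: "(nat \<Rightarrow> 'a::ab_group_add) \<Rightarrow> nat \<Rightarrow> 'a set \<Rightarrow> 'a set" where
  "init_bd v N H = {h\<in>H. \<exists>i<N. h + v i \<notin> H}"

text \<open>Laurent polynomials over 'r in variables indexed by 'x:
  finitely supported maps from exponent vectors ('x =>0 int) to coefficients.\<close>

definition laurent_in :: "'x set \<Rightarrow> (('x \<Rightarrow>\<^sub>0 int) \<Rightarrow>\<^sub>0 'r::zero) set" where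
  "laurent_in T = {P :: ((_ \<Rightarrow>\<^sub>0 int) \<Rightarrow>\<^sub>0 _). \<forall>m\<in>Poly_Mapping.keys P. Poly_Mapping.keys m \<subseteq> T}"

definition laur_eval :: "('r::zero \<Rightarrow> 'f::field) \<Rightarrow> (('x \<Rightarrow>\<^sub>0 int) \<Rightarrow>\<^sub>0 'r) \<Rightarrow> ('x \<Rightarrow> 'f) \<Rightarrow> 'f" where
  "laur_eval emb P y = (\<Sum>m\<in>Poly_Mapping.keys P. emb (Poly_Mapping.lookup P m) * (\<Prod>i\<in>Poly_Mapping.keys m. y i powi Poly_Mapping.lookup m i))"

definition laur_const :: "'r::zero \<Rightarrow> ('x \<Rightarrow>\<^sub>0 int) \<Rightarrow>\<^sub>0 'r" where
  "laur_const c = Poly_Mapping.single 0 c"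

definition laur_var :: "'x \<Rightarrow> ('x \<Rightarrow>\<^sub>0 int) \<Rightarrow>\<^sub>0 'r::{zero,one}" where
  "laur_var x = Poly_Mapping.single (Poly_Mapping.single x 1) 1"

definition to_frac :: "(('x::linorder \<Rightarrow>\<^sub>0 int) \<Rightarrow>\<^sub>0 'r::idom) \<Rightarrow> (('x \<Rightarrow>\<^sub>0 int) \<Rightarrow>\<^sub>0 'r) fract" where
  "to_frac P = Fract P 1"

definition coef_emb :: "'r::idom \<Rightarrow> (('x::linorder \<Rightarrow>\<^sub>0 int) \<Rightarrow>\<^sub>0 'r) fract" where
  "coef_emb c = to_frac (laur_const c)"

definition rel_unit :: "'a::comm_ring_1 set \<Rightarrow> 'a \<Rightarrow> bool" where
  "rel_unit S x \<longleftrightarrow> x \<in> S \<and> (\<exists>y\<in>S. x * y = 1)"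

text \<open>irreducible in S, units counted as irreducible\<close>
definition rel_irred :: "'a::comm_ring_1 set \<Rightarrow> 'a \<Rightarrow> bool" where
  "rel_irred S x \<longleftrightarrow> x \<in> S \<and> x \<noteq> 0 \<and>
     (\<forall>a\<in>S. \<forall>b\<in>S. x = a * b \<longrightarrow> rel_unit S a \<or> rel_unit S b)"

definition rel_coprime :: "'a::comm_ring_1 set \<Rightarrow> 'a \<Rightarrow> 'a \<Rightarrow> bool" where
  "rel_coprime S x y \<longleftrightarrow> x \<in> S \<and> y \<in> S \<and>
     (\<forall>d\<in>S. (\<exists>a\<in>S. x = d * a) \<and> (\<exists>b\<in>S. y = d * b) \<longrightarrow> rel_unit S d)"

definition step_rel :: "(nat \<Rightarrow> 'a::ab_group_add) \<Rightarrow> nat \<Rightarrow> 'a set \<Rightarrow> ('a \<times> 'a) set" where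
  "step_rel v N H = {(h + v i, h) | h i. h \<in> H \<and> h \<notin> init_bd v N H \<and> i < N}"

definition sol :: "(nat \<Rightarrow> 'a::{ab_group_add,linorder}) \<Rightarrow> nat \<Rightarrow> ((nat \<Rightarrow>\<^sub>0 int) \<Rightarrow>\<^sub>0 'r::idom)
     \<Rightarrow> 'a set \<Rightarrow> 'a \<Rightarrow> (('a \<Rightarrow>\<^sub>0 int) \<Rightarrow>\<^sub>0 'r) fract" where
  "sol v N Phi H = wfrec (step_rel v N H)
     (\<lambda>g h. if h \<in> init_bd v N H then to_frac (laur_var h)
            else if h \<in> H then laur_eval coef_emb Phi (\<lambda>i. g (h + v i)) else 0)"

definition RH0 :: "(nat \<Rightarrow> 'a::{ab_group_add,linorder}) \<Rightarrow> nat \<Rightarrow> 'a set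
     \<Rightarrow> (('a \<Rightarrow>\<^sub>0 int) \<Rightarrow>\<^sub>0 'r::idom) fract set" where
  "RH0 v N H = to_frac ` laurent_in (init_bd v N H)"

definition laurent_property where
  "laurent_property v N (Phi :: (nat \<Rightarrow>\<^sub>0 int) \<Rightarrow>\<^sub>0 'r::idom) H \<longleftrightarrow>
     (\<forall>h\<in>H. (sol v N Phi H h :: (('a::{ab_group_add,linorder} \<Rightarrow>\<^sub>0 int) \<Rightarrow>\<^sub>0 'r) fract) \<in> RH0 v N H)"

definition irreducibility where
  "irreducibility v N (Phi :: (nat \<Rightarrow>\<^sub>0 int) \<Rightarrow>\<^sub>0 'r::idom) H \<longleftrightarrow>
     (\<forall>h\<in>H. rel_irred (RH0 v N H)
        (sol v N Phi H h :: (('a::{ab_group_add,linorder} \<Rightarrow>\<^sub>0 int) \<Rightarrow>\<^sub>0 'r) fract))"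

definition coprimeness where
  "coprimeness v N (Phi :: (nat \<Rightarrow>\<^sub>0 int) \<Rightarrow>\<^sub>0 'r::idom) H \<longleftrightarrow>
     (\<forall>h1\<in>H. \<forall>h2\<in>H. h1 \<noteq> h2 \<longrightarrow> rel_coprime (RH0 v N H)
        (sol v N Phi H h1 :: (('a::{ab_group_add,linorder} \<Rightarrow>\<^sub>0 int) \<Rightarrow>\<^sub>0 'r) fract) (sol v N Phi H h2))"

definition gen_eval :: "((nat \<Rightarrow>\<^sub>0 int) \<Rightarrow>\<^sub>0 'r::idom) \<Rightarrow> (nat \<Rightarrow> ((nat \<Rightarrow>\<^sub>0 int) \<Rightarrow>\<^sub>0 'r) fract)
     \<Rightarrow> ((nat \<Rightarrow>\<^sub>0 int) \<Rightarrow>\<^sub>0 'r) fract" where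
  "gen_eval P y = laur_eval coef_emb P y"

definition Yv :: "nat \<Rightarrow> ((nat \<Rightarrow>\<^sub>0 int) \<Rightarrow>\<^sub>0 'r::idom) fract" where
  "Yv i = to_frac (laur_var i)"

end

theory Submission
  imports Defs "HOL-Computational_Algebra.Polynomial"
begin

text \<open>
  Two light-cone regular domains that differ by a minimal point \<open>p\<close> have initial variables differing
  only by the exchange of \<open>f p\<close> and \<open>f q\<close>, \<open>q = p - v (N - 1)\<close>; this exchange is an involution
  of the function field, and the two Laurent polynomial rings agree after inverting \<open>f q\<close>,
  respectively \<open>f p\<close>. Hence an \<open>f h\<close> that is irreducible in the old ring is, in the new one,
  irreducible up to a power of the prime \<open>f p\<close>. The power is not negative, because in the smaller
  domain \<open>f h\<close> is computed from values that are not divisible by \<open>f p\<close>; it is not positive, because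
  divisibility of \<open>f h\<close> by \<open>f p\<close> could be transported to a deep translate of the given good domain,
  in which \<open>f p\<close> is a nonunit coprime to \<open>f h\<close>. Around finitely many points, every domain arises
  from a translate of the given one by removing finitely many minimal points.

  The rings of Laurent polynomials are treated as subsets of one ring, so that the number of
  variables may vary, and divisibility is taken relative to a subset.
\<close>

section \<open>Divisibility in subrings\<close>

text \<open>Initial boundaries may be infinite, and irreducibility is fragile under a change of
  ring, whereas primality survives new variables and localisation. Unique factorisation is therefore
  established for finitely many variables only, by Gauss's argument, and serves to turn irreducible
  values into primes; from then on primes are what travels between rings.

  The obstacle is to exclude \<open>f p\<close> as a factor of \<open>f h\<close>. In the ring of
  the larger domain \<open>f p\<close> is an initial variable, hence a unit, and coprimeness there
  says nothing about it. Substituting the values of a deep translate for the initial variables makes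
  \<open>f p\<close> a nonunit, but this substitution need not be injective and is only a partial
  map on fractions. Moreover it inverts values that are not units in the ring of the translate, so
  images lie in the local ring at \<open>f p\<close> and no smaller; coprimeness to
  \<open>f p\<close> is what puts them there. A translate with \<open>f p\<close> a nonunit exists
  because otherwise all values above some point would be monomials, which would force
  \<open>Phi\<close> to be a monomial.\<close>

definition is_subring :: "'a::comm_ring_1 set \<Rightarrow> bool" where
  "is_subring S \<longleftrightarrow> 1 \<in> S \<and> (\<forall>a\<in>S. \<forall>b\<in>S. a + b \<in> S \<and> a * b \<in> S) \<and> (\<forall>a\<in>S. - a \<in> S)"

definition rel_dvd :: "'a::comm_ring_1 set \<Rightarrow> 'a \<Rightarrow> 'a \<Rightarrow> bool" where
  "rel_dvd S a b \<longleftrightarrow> (\<exists>c\<in>S. b = a * c)"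

text \<open>Units count as prime, in line with the convention for \<^const>\<open>rel_irred\<close>.\<close>
definition rel_prime :: "'a::comm_ring_1 set \<Rightarrow> 'a \<Rightarrow> bool" where
  "rel_prime S x \<longleftrightarrow> x \<in> S \<and> x \<noteq> 0 \<and>
     (\<forall>a\<in>S. \<forall>b\<in>S. rel_dvd S x (a * b) \<longrightarrow> rel_dvd S x a \<or> rel_dvd S x b)"

text \<open>Factorisation into primes encodes uniqueness without stating it, and this form passes
  directly to polynomial rings and localisations. Since units count as prime, no separate unit
  factor occurs.\<close>

definition rel_factorial :: "'a::comm_ring_1 set \<Rightarrow> bool" where
  "rel_factorial S \<longleftrightarrow> is_subring S \<and>
     (\<forall>x\<in>S. x \<noteq> 0 \<longrightarrow> (\<exists>ps. (\<forall>p\<in>set ps. rel_prime S p) \<and> x = prod_list ps))"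

lemma
  assumes "is_subring S"
  shows subring_1: "1 \<in> S"
    and subring_add: "a \<in> S \<Longrightarrow> b \<in> S \<Longrightarrow> a + b \<in> S"
    and subring_mult: "a \<in> S \<Longrightarrow> b \<in> S \<Longrightarrow> a * b \<in> S"
    and subring_uminus: "a \<in> S \<Longrightarrow> - a \<in> S"
  using assms by (auto simp: is_subring_def)

lemma subring_0: "is_subring S \<Longrightarrow> 0 \<in> S"
  by (metis add.right_inverse subring_1 subring_add subring_uminus)

lemma subring_diff: "is_subring S \<Longrightarrow> a \<in> S \<Longrightarrow> b \<in> S \<Longrightarrow> a - b \<in> S"
  by (metis add_uminus_conv_diff subring_add subring_uminus)

lemma subring_sum: "is_subring S \<Longrightarrow> (\<And>i. i \<in> I \<Longrightarrow> f i \<in> S) \<Longrightarrow> sum f I \<in> S"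
  by (induction I rule: infinite_finite_induct) (auto simp: subring_0 subring_add)

lemma subring_prod: "is_subring S \<Longrightarrow> (\<And>i. i \<in> I \<Longrightarrow> f i \<in> S) \<Longrightarrow> prod f I \<in> S"
  by (induction I rule: infinite_finite_induct) (auto simp: subring_1 subring_mult)

lemma subring_power: "is_subring S \<Longrightarrow> a \<in> S \<Longrightarrow> a ^ n \<in> S"
  by (induction n) (auto simp: subring_1 subring_mult)

lemma subring_prod_list: "is_subring S \<Longrightarrow> set xs \<subseteq> S \<Longrightarrow> prod_list xs \<in> S"
  by (induction xs) (auto simp: subring_1 subring_mult)

lemmas subring_intros =
  subring_0 subring_1 subring_add subring_mult subring_uminus subring_diff subring_power

lemma is_subring_UNIV: "is_subring UNIV"
  by (simp add: is_subring_def)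

lemma rel_unit_in: "rel_unit S x \<Longrightarrow> x \<in> S"
  by (simp add: rel_unit_def)

lemma rel_unit_1: "is_subring S \<Longrightarrow> rel_unit S 1"
  by (auto simp: rel_unit_def subring_1)

lemma rel_unit_mult:
  assumes "is_subring S" "rel_unit S a" "rel_unit S b"
  shows "rel_unit S (a * b)"
proof -
  obtain a' b' where "a' \<in> S" "b' \<in> S" "a * a' = 1" "b * b' = 1"
    using assms by (auto simp: rel_unit_def)
  moreover have "(a * b) * (a' * b') = (a * a') * (b * b')" by (simp add: ac_simps)
  ultimately have "a' * b' \<in> S" "(a * b) * (a' * b') = 1"
    using assms(1) by (auto simp: subring_mult)
  thus ?thesis using assms by (auto simp: rel_unit_def subring_mult)
qed

lemma rel_unit_multD:
  assumes "is_subring S" "rel_unit S (a * b)" "a \<in> S" "b \<in> S"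
  shows "rel_unit S a" "rel_unit S b"
proof -
  obtain c where c: "c \<in> S" "a * b * c = 1"
    using assms by (auto simp: rel_unit_def)
  have "a * (b * c) = 1" "b * (a * c) = 1" using c(2) by (simp_all add: ac_simps)
  thus "rel_unit S a" "rel_unit S b"
    using assms c(1) unfolding rel_unit_def by (meson subring_mult)+
qed

lemma rel_unit_nonzero: "rel_unit S x \<Longrightarrow> x \<noteq> (0::'a::comm_ring_1)"
  by (auto simp: rel_unit_def)

lemma rel_unit_dvd: "is_subring S \<Longrightarrow> rel_unit S u \<Longrightarrow> a \<in> S \<Longrightarrow> rel_dvd S u a"
  unfolding rel_unit_def rel_dvd_def
  by (metis mult.assoc mult.left_neutral subring_mult)

lemma rel_dvd_refl: "is_subring S \<Longrightarrow> rel_dvd S a a"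
  by (metis mult.right_neutral rel_dvd_def subring_1)

lemma rel_dvd_mult: "is_subring S \<Longrightarrow> rel_dvd S a b \<Longrightarrow> c \<in> S \<Longrightarrow> rel_dvd S a (b * c)"
  unfolding rel_dvd_def by (metis mult.assoc subring_mult)

lemma rel_dvd_mult2: "is_subring S \<Longrightarrow> rel_dvd S a b \<Longrightarrow> c \<in> S \<Longrightarrow> rel_dvd S a (c * b)"
  by (metis mult.commute rel_dvd_mult)

lemma rel_dvd_trans: "is_subring S \<Longrightarrow> rel_dvd S a b \<Longrightarrow> rel_dvd S b c \<Longrightarrow> rel_dvd S a c"
  unfolding rel_dvd_def by (metis mult.assoc subring_mult)

lemma rel_dvd_add: "is_subring S \<Longrightarrow> rel_dvd S a b \<Longrightarrow> rel_dvd S a c \<Longrightarrow> rel_dvd S a (b + c)"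
  unfolding rel_dvd_def by (metis distrib_left subring_add)

lemma rel_dvd_diff: "is_subring S \<Longrightarrow> rel_dvd S a b \<Longrightarrow> rel_dvd S a c \<Longrightarrow> rel_dvd S a (b - c)"
  unfolding rel_dvd_def by (metis right_diff_distrib subring_diff)

lemma rel_dvd_0: "is_subring S \<Longrightarrow> rel_dvd S a 0"
  unfolding rel_dvd_def by (metis mult_zero_right subring_0)

lemma rel_dvd_sum:
  "is_subring S \<Longrightarrow> (\<And>i. i \<in> I \<Longrightarrow> rel_dvd S a (f i)) \<Longrightarrow> rel_dvd S a (sum f I)"
  by (induction I rule: infinite_finite_induct) (auto simp: rel_dvd_0 rel_dvd_add)

lemma rel_dvd_unit: "is_subring S \<Longrightarrow> rel_dvd S a 1 \<Longrightarrow> a \<in> S \<Longrightarrow> rel_unit S a"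
  unfolding rel_unit_def rel_dvd_def by auto

lemma rel_prime_in: "rel_prime S x \<Longrightarrow> x \<in> S"
  by (simp add: rel_prime_def)

lemma rel_prime_nonzero: "rel_prime S x \<Longrightarrow> x \<noteq> 0"
  by (simp add: rel_prime_def)

lemma rel_prime_dvd_multD:
  "rel_prime S x \<Longrightarrow> rel_dvd S x (a * b) \<Longrightarrow> a \<in> S \<Longrightarrow> b \<in> S \<Longrightarrow> rel_dvd S x a \<or> rel_dvd S x b"
  by (auto simp: rel_prime_def)

lemma rel_prime_imp_irred:
  fixes x :: "'a::idom"
  assumes S: "is_subring S" and x: "rel_prime S x"
  shows "rel_irred S x"
  unfolding rel_irred_def
proof (intro conjI ballI impI)
  fix a b assume ab: "a \<in> S" "b \<in> S" "x = a * b"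
  have "rel_dvd S x (a * b)" using rel_dvd_refl[OF S, of x] ab by simp
  then consider "rel_dvd S x a" | "rel_dvd S x b"
    using rel_prime_dvd_multD[OF x _ ab(1,2)] by blast
  thus "rel_unit S a \<or> rel_unit S b"
  proof cases
    case 1
    then obtain c where c: "c \<in> S" "a = x * c" by (auto simp: rel_dvd_def)
    have "x * (b * c) = (x * c) * b" by (simp only: ac_simps)
    also have "\<dots> = x * 1" using ab(3) c(2) by simp
    finally have "x * (b * c) = x * 1" .
    hence "b * c = 1" using x by (simp add: rel_prime_def)
    thus ?thesis using c ab by (auto simp: rel_unit_def)
  next
    case 2
    then obtain c where c: "c \<in> S" "b = x * c" by (auto simp: rel_dvd_def)
    have "x * (a * c) = a * (x * c)" by (simp only: ac_simps)
    also have "\<dots> = x * 1" using ab(3) c(2) by simp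
    finally have "x * (a * c) = x * 1" .
    hence "a * c = 1" using x by (simp add: rel_prime_def)
    thus ?thesis using c ab by (auto simp: rel_unit_def)
  qed
qed (use x in \<open>auto simp: rel_prime_def\<close>)

lemma rel_unit_imp_prime: "is_subring S \<Longrightarrow> rel_unit S u \<Longrightarrow> rel_prime S u"
  unfolding rel_prime_def by (simp add: rel_unit_in rel_unit_nonzero rel_unit_dvd)

lemma rel_prime_mult_unit:
  fixes x :: "'a::idom"
  assumes S: "is_subring S" and x: "rel_prime S x" and u: "rel_unit S u"
  shows "rel_prime S (x * u)"
proof -
  obtain u' where u': "u' \<in> S" "u * u' = 1" using u by (auto simp: rel_unit_def)
  have *: "rel_dvd S (x * u) a \<longleftrightarrow> rel_dvd S x a" for a
  proof
    assume "rel_dvd S (x * u) a" thus "rel_dvd S x a"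
      unfolding rel_dvd_def by (metis S mult.assoc rel_unit_in subring_mult u)
  next
    assume "rel_dvd S x a"
    then obtain c where c: "c \<in> S" "a = x * c" by (auto simp: rel_dvd_def)
    have "a = (x * u) * (u' * c)" using c u' by (metis mult.assoc mult.right_neutral)
    thus "rel_dvd S (x * u) a" using S c u' unfolding rel_dvd_def by (metis subring_mult)
  qed
  show ?thesis
    using x u rel_unit_nonzero[OF u] S unfolding rel_prime_def *
    by (auto simp: subring_mult rel_unit_in)
qed

text \<open>Irreducibility forces the first prime or the product of the others to be a unit. In the
  first case the remaining product is again irreducible, in the second the whole product is an
  associate of the first prime.\<close>

lemma prod_list_irred_imp_prime:
  fixes ps :: "'a::idom list"
  assumes S: "is_subring S"
  shows "(\<forall>p\<in>set ps. rel_prime S p) \<Longrightarrow> rel_irred S (prod_list ps) \<Longrightarrow> rel_prime S (prod_list ps)"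
proof (induction ps)
  case Nil
  thus ?case using S by (simp add: rel_unit_1 rel_unit_imp_prime)
next
  case (Cons p ps)
  have in_S: "p \<in> S" "prod_list ps \<in> S"
    using Cons.prems(1) by (auto simp: rel_prime_in subset_iff intro!: subring_prod_list[OF S])
  have "rel_unit S p \<or> rel_unit S (prod_list ps)"
    using Cons.prems(2) in_S unfolding rel_irred_def by simp
  thus ?case
  proof
    assume p: "rel_unit S p"
    have "rel_irred S (prod_list ps)"
      unfolding rel_irred_def
    proof (intro conjI ballI impI)
      fix a b assume ab: "a \<in> S" "b \<in> S" "prod_list ps = a * b"
      have "prod_list (p # ps) = (p * a) * b" using ab by (simp add: ac_simps)
      hence "rel_unit S (p * a) \<or> rel_unit S b"
        using Cons.prems(2) ab in_S S unfolding rel_irred_def by (meson subring_mult)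
      thus "rel_unit S a \<or> rel_unit S b"
        using rel_unit_multD(2)[OF S] in_S ab by blast
    qed (use in_S Cons.prems in \<open>auto simp: rel_irred_def\<close>)
    hence "rel_prime S (prod_list ps)" using Cons by simp
    thus ?thesis using rel_prime_mult_unit[OF S _ p, of "prod_list ps"] by (simp add: mult.commute)
  next
    assume "rel_unit S (prod_list ps)"
    thus ?thesis using rel_prime_mult_unit[OF S, of p "prod_list ps"] Cons.prems by simp
  qed
qed

lemma rel_factorial_irred_imp_prime:
  fixes x :: "'a::idom"
  assumes "rel_factorial S" "rel_irred S x"
  shows "rel_prime S x"
  using assms prod_list_irred_imp_prime unfolding rel_factorial_def
  by (metis rel_irred_def)

lemma rel_prime_dvd_prod_list:
  assumes S: "is_subring S" and x: "rel_prime S x"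
  shows "rel_dvd S x (prod_list ps) \<Longrightarrow> set ps \<subseteq> S \<Longrightarrow> rel_unit S x \<or> (\<exists>p\<in>set ps. rel_dvd S x p)"
proof (induction ps)
  case Nil
  thus ?case using rel_dvd_unit[OF S] x by (auto simp: rel_prime_in)
next
  case (Cons p ps)
  have "rel_dvd S x p \<or> rel_dvd S x (prod_list ps)"
    using Cons.prems rel_prime_dvd_multD[OF x, of p "prod_list ps"] subring_prod_list[OF S, of ps]
    by simp
  thus ?case using Cons by auto
qed

section \<open>Gauss's lemma: polynomials with coefficients in a factorial subring\<close>

definition polys_over :: "'a::comm_ring_1 set \<Rightarrow> 'a poly set" where
  "polys_over D = {f. \<forall>i. coeff f i \<in> D}"

lemma polys_over_coeff: "f \<in> polys_over D \<Longrightarrow> coeff f i \<in> D"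
  by (simp add: polys_over_def)

lemma is_subring_polys_over: "is_subring D \<Longrightarrow> is_subring (polys_over D)"
  unfolding is_subring_def[of "polys_over D"]
  by (auto simp: polys_over_def coeff_mult coeff_1 subring_intros intro!: subring_sum)

lemma const_in_polys_over: "is_subring D \<Longrightarrow> [:c:] \<in> polys_over D \<longleftrightarrow> c \<in> D"
  by (auto simp: polys_over_def subring_0 coeff_pCons split: nat.splits dest: spec[of _ 0])

lemma pCons_in_polys_over: "pCons c f \<in> polys_over D \<longleftrightarrow> c \<in> D \<and> f \<in> polys_over D"
  by (auto simp: polys_over_def coeff_pCons split: nat.splits dest: spec[of _ 0] spec[of _ "Suc _"])

lemma monom_in_polys_over: "is_subring D \<Longrightarrow> c \<in> D \<Longrightarrow> monom c n \<in> polys_over D"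
  by (auto simp: polys_over_def subring_0)

lemma rel_dvd_const_poly:
  assumes D: "is_subring D" and f: "f \<in> polys_over D"
  shows "rel_dvd (polys_over D) [:c:] f \<longleftrightarrow> (\<forall>i. rel_dvd D c (coeff f i))"
proof
  assume "rel_dvd (polys_over D) [:c:] f"
  thus "\<forall>i. rel_dvd D c (coeff f i)"
    unfolding rel_dvd_def by (auto simp: polys_over_coeff)
next
  assume "\<forall>i. rel_dvd D c (coeff f i)"
  thus "rel_dvd (polys_over D) [:c:] f"
    using f
  proof (induction f)
    case 0
    thus ?case using rel_dvd_0 is_subring_polys_over[OF D] by blast
  next
    case (pCons a f)
    have "rel_dvd D c a" using pCons.prems by (auto dest: spec[of _ 0])
    then obtain b where b: "b \<in> D" "a = c * b" by (auto simp: rel_dvd_def)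
    have "\<forall>i. rel_dvd D c (coeff f i)"
      using pCons.prems(1) by (metis coeff_pCons_Suc)
    then obtain g where g: "g \<in> polys_over D" "f = [:c:] * g"
      using pCons by (auto simp: rel_dvd_def pCons_in_polys_over)
    have "pCons a f = [:c:] * pCons b g" using b g by simp
    thus ?case using b g unfolding rel_dvd_def by (metis pCons_in_polys_over)
  qed
qed

text \<open>Gauss's lemma: let \<open>i\<close> and \<open>j\<close> be the least indices at which
  \<open>p\<close> does not divide the coefficient of \<open>f\<close> and of \<open>g\<close>.
  Coefficient \<open>i + j\<close> of \<open>f * g\<close> is the product of these two coefficients
  up to multiples of \<open>p\<close>.\<close>

lemma rel_prime_const_poly:
  fixes p :: "'a::idom"
  assumes D: "is_subring D" and p: "rel_prime D p"
  shows "rel_prime (polys_over D) [:p:]"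
  unfolding rel_prime_def
proof (intro conjI ballI impI)
  show "[:p:] \<in> polys_over D" using p D by (simp add: const_in_polys_over rel_prime_in)
  show "[:p:] \<noteq> 0" using p by (simp add: rel_prime_nonzero)
next
  fix f g assume f: "f \<in> polys_over D" and g: "g \<in> polys_over D"
    and dvd: "rel_dvd (polys_over D) [:p:] (f * g)"
  note PD = is_subring_polys_over[OF D]
  show "rel_dvd (polys_over D) [:p:] f \<or> rel_dvd (polys_over D) [:p:] g"
  proof (rule ccontr)
    assume neg: "\<not> ?thesis"
    let ?P = "\<lambda>i. \<not> rel_dvd D p (coeff f i)"
    let ?Q = "\<lambda>i. \<not> rel_dvd D p (coeff g i)"
    have exP: "\<exists>i. ?P i" and exQ: "\<exists>i. ?Q i"
      using neg rel_dvd_const_poly[OF D f] rel_dvd_const_poly[OF D g] by auto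
    define i where "i = (LEAST i. ?P i)"
    define j where "j = (LEAST j. ?Q j)"
    have i: "?P i" "\<And>k. k < i \<Longrightarrow> \<not> ?P k"
      unfolding i_def using LeastI_ex[OF exP] not_less_Least[of _ ?P] by blast+
    have j: "?Q j" "\<And>k. k < j \<Longrightarrow> \<not> ?Q k"
      unfolding j_def using LeastI_ex[OF exQ] not_less_Least[of _ ?Q] by blast+
    have "coeff (f * g) (i + j) = (\<Sum>k\<le>i + j. coeff f k * coeff g (i + j - k))"
      by (simp add: coeff_mult)
    also have "\<dots> = coeff f i * coeff g j
        + (\<Sum>k\<in>{..i + j} - {i}. coeff f k * coeff g (i + j - k))"
      by (subst sum.remove[of _ i]) auto
    finally have eq: "coeff f i * coeff g j = coeff (f * g) (i + j)
        - (\<Sum>k\<in>{..i + j} - {i}. coeff f k * coeff g (i + j - k))" by simp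
    have "rel_dvd D p (\<Sum>k\<in>{..i + j} - {i}. coeff f k * coeff g (i + j - k))"
    proof (rule rel_dvd_sum[OF D])
      fix k assume k: "k \<in> {..i + j} - {i}"
      show "rel_dvd D p (coeff f k * coeff g (i + j - k))"
      proof (cases "k < i")
        case True
        thus ?thesis using i(2) rel_dvd_mult[OF D] polys_over_coeff[OF g] by blast
      next
        case False
        hence "i + j - k < j" using k by auto
        thus ?thesis using j(2) rel_dvd_mult2[OF D] polys_over_coeff[OF f] by blast
      qed
    qed
    moreover have "rel_dvd D p (coeff (f * g) (i + j))"
      using dvd rel_dvd_const_poly[OF D subring_mult[OF PD f g]] by blast
    ultimately have "rel_dvd D p (coeff f i * coeff g j)"
      unfolding eq using rel_dvd_diff[OF D] by blast
    thus False
      using rel_prime_dvd_multD[OF p] i(1) j(1) f g polys_over_coeff by blast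
  qed
qed

text \<open>A prime of \<open>D\<close> stays prime as a constant polynomial, so each factor of the
  constant divides \<open>r\<close> or \<open>s\<close> and is cancelled there. The constants
  \<open>c1\<close> and \<open>c2\<close> collect what was removed; this replaces contents and
  primitive parts.\<close>

lemma cancel_const_poly:
  fixes ps :: "'a::idom list"
  assumes D: "is_subring D" and ps: "\<forall>p\<in>set ps. rel_prime D p"
    and "k \<in> polys_over D" "r \<in> polys_over D" "s \<in> polys_over D"
    and "[:prod_list ps:] * k = r * s"
  shows "\<exists>c1 c2 r' s'. c1 \<in> D \<and> c2 \<in> D \<and> r' \<in> polys_over D \<and> s' \<in> polys_over D \<and>
     c1 \<noteq> 0 \<and> k = r' * s' \<and> r = [:c1:] * r' \<and> s = [:c2:] * s'"
  using ps assms(3-)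
proof (induction ps arbitrary: r s)
  case Nil
  thus ?case using D by (intro exI[of _ 1] exI[of _ r] exI[of _ s]) (simp add: subring_1)
next
  case (Cons p ps)
  note PD = is_subring_polys_over[OF D]
  have "rel_prime D p" using Cons.prems(1) by simp
  hence p: "rel_prime (polys_over D) [:p:]" "p \<noteq> 0" "p \<in> D"
    using D by (simp_all add: rel_prime_const_poly rel_prime_in) (simp add: rel_prime_def)
  have "set ps \<subseteq> D" using Cons.prems(1) by (auto simp: rel_prime_in)
  hence c: "[:prod_list ps:] * k \<in> polys_over D"
    using Cons.prems(2) by (intro subring_mult[OF PD]) (simp_all add: const_in_polys_over D subring_prod_list)
  have eq: "[:p:] * ([:prod_list ps:] * k) = r * s" using Cons.prems(5) by (simp add: mult.commute)
  hence "rel_dvd (polys_over D) [:p:] (r * s)" using c unfolding rel_dvd_def by metis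
  then consider "rel_dvd (polys_over D) [:p:] r" | "rel_dvd (polys_over D) [:p:] s"
    using rel_prime_dvd_multD[OF p(1)] Cons.prems by blast
  thus ?case
  proof cases
    case 1
    then obtain r0 where r0: "r0 \<in> polys_over D" "r = [:p:] * r0" by (auto simp: rel_dvd_def)
    have "[:p:] * ([:prod_list ps:] * k) = [:p:] * (r0 * s)"
      unfolding eq r0(2) by (simp only: mult.assoc)
    hence "[:prod_list ps:] * k = r0 * s" using p(2) by (subst (asm) mult_cancel_left) simp
    from Cons.IH[OF _ Cons.prems(2) r0(1) Cons.prems(4) this] Cons.prems(1)
    obtain c1 c2 r' s' where *: "c1 \<in> D" "c2 \<in> D" "r' \<in> polys_over D" "s' \<in> polys_over D"
      "c1 \<noteq> 0" "k = r' * s'" "r0 = [:c1:] * r'" "s = [:c2:] * s'" by auto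
    have "r = [:p * c1:] * r'" "p * c1 \<in> D" "p * c1 \<noteq> 0"
      using r0(2) * p D by (simp_all add: subring_mult mult.commute)
    thus ?thesis using * by blast
  next
    case 2
    then obtain s0 where s0: "s0 \<in> polys_over D" "s = [:p:] * s0" by (auto simp: rel_dvd_def)
    have "[:p:] * ([:prod_list ps:] * k) = [:p:] * (r * s0)"
      unfolding eq s0(2) by (simp only: mult.left_commute)
    hence "[:prod_list ps:] * k = r * s0" using p(2) by (subst (asm) mult_cancel_left) simp
    from Cons.IH[OF _ Cons.prems(2) Cons.prems(3) s0(1) this] Cons.prems(1)
    obtain c1 c2 r' s' where *: "c1 \<in> D" "c2 \<in> D" "r' \<in> polys_over D" "s' \<in> polys_over D"
      "c1 \<noteq> 0" "k = r' * s'" "r = [:c1:] * r'" "s0 = [:c2:] * s'" by auto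
    have "s = [:p * c2:] * s'" "p * c2 \<in> D"
      using s0(2) * p D by (simp_all add: subring_mult mult.commute)
    thus ?thesis using * by blast
  qed
qed

lemma rel_unit_poly_degree:
  fixes f :: "'a::idom poly"
  shows "rel_unit S f \<Longrightarrow> degree f = 0"
  unfolding rel_unit_def by (metis degree_1 degree_mult_eq add_is_0 mult_zero_left mult_zero_right zero_neq_one)

text \<open>Cancelling the primes of \<open>c\<close> splits a constant off \<open>f\<close>. The
  other factor of \<open>f\<close> keeps the positive degree and is no unit, so irreducibility makes
  the constant a unit.\<close>

lemma irred_poly_dvd_const_mult:
  fixes f :: "'a::idom poly"
  assumes D: "rel_factorial D" and f: "rel_irred (polys_over D) f" "degree f > 0"
    and c: "c \<in> D" "c \<noteq> 0" and h: "h \<in> polys_over D"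
    and dvd: "rel_dvd (polys_over D) f ([:c:] * h)"
  shows "rel_dvd (polys_over D) f h"
proof -
  have sD: "is_subring D" using D by (simp add: rel_factorial_def)
  note PD = is_subring_polys_over[OF sD]
  obtain ps where ps: "\<forall>p\<in>set ps. rel_prime D p" "c = prod_list ps"
    using D c by (auto simp: rel_factorial_def)
  obtain e where e: "e \<in> polys_over D" "[:prod_list ps:] * h = f * e"
    using dvd ps by (auto simp: rel_dvd_def)
  have fPD: "f \<in> polys_over D" using f by (simp add: rel_irred_def)
  from cancel_const_poly[OF sD ps(1) h fPD e]
  obtain c1 r' s' where *: "c1 \<in> D" "r' \<in> polys_over D" "s' \<in> polys_over D" "h = r' * s'"
    "f = [:c1:] * r'" by blast
  have "rel_unit (polys_over D) [:c1:] \<or> rel_unit (polys_over D) r'"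
    using f(1) * sD unfolding rel_irred_def by (metis const_in_polys_over)
  moreover have "\<not> rel_unit (polys_over D) r'"
    using f(2) * rel_unit_poly_degree[of _ r'] by (auto split: if_splits)
  ultimately obtain u where u: "u \<in> polys_over D" "[:c1:] * u = 1" by (auto simp: rel_unit_def)
  have "h = f * (u * s')"
  proof -
    have "f * (u * s') = ([:c1:] * u) * (r' * s')" unfolding *(5) by (simp only: ac_simps)
    thus ?thesis unfolding u(2) *(4) by (simp only: mult_1_left)
  qed
  thus ?thesis unfolding rel_dvd_def using u * PD subring_mult by blast
qed

text \<open>Multiplication by the leading coefficient of \<open>r\<close> before each subtraction
  keeps all coefficients in \<open>D\<close>; these multipliers accumulate in
  \<open>c\<close>.\<close>

lemma pseudo_division:
  fixes r :: "'a::idom poly"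
  assumes D: "is_subring D" and r: "r \<in> polys_over D" "r \<noteq> 0" and k: "k \<in> polys_over D"
  shows "\<exists>c s t. c \<in> D \<and> c \<noteq> 0 \<and> s \<in> polys_over D \<and> t \<in> polys_over D \<and>
     [:c:] * k = r * s + t \<and> (t = 0 \<or> degree t < degree r)"
  using k
\<comment> \<open>The measure puts 0 strictly below the nonzero constants, because reducing a
  constant by a constant lowers it to 0 without lowering the degree.\<close>
proof (induction "if k = 0 then 0 else Suc (degree k)" arbitrary: k rule: less_induct)
  case less
  note PD = is_subring_polys_over[OF D]
  show ?case
  proof (cases "k = 0 \<or> degree k < degree r")
    case True
    thus ?thesis using less.prems PD D
      by (intro exI[of _ 1] exI[of _ 0] exI[of _ k]) (simp add: subring_1 subring_0)
  next
    case False
    define a where "a = lead_coeff r"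
    define m where "m = monom (lead_coeff k) (degree k - degree r)"
    define k' where "k' = [:a:] * k - m * r"
    have a: "a \<in> D" "a \<noteq> 0" using r by (auto simp: a_def polys_over_coeff)
    have m: "m \<in> polys_over D" unfolding m_def
      using less.prems D by (intro monom_in_polys_over) (auto simp: polys_over_coeff)
    have k': "k' \<in> polys_over D" unfolding k'_def
      using a m r less.prems D by (intro subring_diff subring_mult PD) (simp_all add: const_in_polys_over)
    have "degree k' \<le> degree k"
      unfolding k'_def
    proof (rule degree_diff_le)
      show "degree ([:a:] * k) \<le> degree k" by simp
      show "degree (m * r) \<le> degree k"
        using False degree_mult_le[of m r] degree_monom_le[of "lead_coeff k" "degree k - degree r"]
        unfolding m_def by linarith
    qed
    moreover have "coeff k' (degree k) = 0"
      using False by (simp add: k'_def m_def a_def coeff_monom_mult)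
    ultimately have "k' = 0 \<or> degree k' < degree k" by (rule eq_zero_or_degree_less)
    hence lt: "(if k' = 0 then 0 else Suc (degree k')) < (if k = 0 then 0 else Suc (degree k))"
      using False by auto
    obtain c s t where *: "c \<in> D" "c \<noteq> 0" "s \<in> polys_over D" "t \<in> polys_over D"
      "[:c:] * k' = r * s + t" "t = 0 \<or> degree t < degree r"
      using less.hyps[OF lt k'] by blast
    have "[:c * a:] * k = [:c:] * k' + [:c:] * (m * r)"
      by (simp add: k'_def smult_diff_right)
    also have "\<dots> = r * (s + [:c:] * m) + t"
      unfolding *(5) by (simp add: algebra_simps)
    finally have "[:c * a:] * k = r * (s + [:c:] * m) + t" .
    moreover have "s + [:c:] * m \<in> polys_over D"
      using * m D by (intro subring_add subring_mult PD) (simp_all add: const_in_polys_over)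
    ultimately show ?thesis using * a D
      by (intro exI[of _ "c * a"] exI[of _ "s + [:c:] * m"] exI[of _ t]) (simp add: subring_mult)
  qed
qed

text \<open>A nonzero element \<open>r\<close> of minimal degree in the ideal generated by \<open>f\<close> and \<open>g\<close> divides both
  generators up to constants, which replaces the division algorithm over the field of fractions.\<close>
lemma irred_poly_imp_prime:
  fixes f :: "'a::idom poly"
  assumes D: "rel_factorial D" and f: "rel_irred (polys_over D) f" "degree f > 0"
  shows "rel_prime (polys_over D) f"
  unfolding rel_prime_def
proof (intro conjI ballI impI)
  show "f \<in> polys_over D" "f \<noteq> 0" using f by (auto simp: rel_irred_def)
next
  fix g h assume g: "g \<in> polys_over D" and h: "h \<in> polys_over D"
    and dvd: "rel_dvd (polys_over D) f (g * h)"
  have sD: "is_subring D" using D by (simp add: rel_factorial_def)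
  note PD = is_subring_polys_over[OF sD]
  have fPD: "f \<in> polys_over D" "f \<noteq> 0" using f by (auto simp: rel_irred_def)
  define I where "I = {a * f + b * g |a b. a \<in> polys_over D \<and> b \<in> polys_over D}"
  have I_diff: "x - r * s \<in> I" if xrs: "x \<in> I" "r \<in> I" "s \<in> polys_over D" for x r s
  proof -
    obtain a b a' b' where *: "x = a * f + b * g" "r = a' * f + b' * g"
      "a \<in> polys_over D" "b \<in> polys_over D" "a' \<in> polys_over D" "b' \<in> polys_over D"
      using xrs unfolding I_def by blast
    have "x - r * s = (a - a' * s) * f + (b - b' * s) * g" using * by (simp add: algebra_simps)
    moreover have "a - a' * s \<in> polys_over D" "b - b' * s \<in> polys_over D"
      using * that PD by (auto intro!: subring_intros)
    ultimately show ?thesis unfolding I_def by blast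
  qed
  have I_mult: "c * x \<in> I" if xc: "x \<in> I" "c \<in> polys_over D" for x c
  proof -
    obtain a b where *: "x = a * f + b * g" "a \<in> polys_over D" "b \<in> polys_over D"
      using xc unfolding I_def by blast
    have "c * x = (c * a) * f + (c * b) * g" using * by (simp add: algebra_simps)
    thus ?thesis unfolding I_def using * that subring_mult[OF PD] by blast
  qed
  have fI: "f \<in> I" unfolding I_def
    using subring_0[OF PD] subring_1[OF PD] by (intro CollectI exI[of _ 1] exI[of _ 0]) simp
  have gI: "g \<in> I" unfolding I_def
    using subring_0[OF PD] subring_1[OF PD] by (intro CollectI exI[of _ 0] exI[of _ 1]) simp
  obtain r where r: "r \<in> I" "r \<noteq> 0" and
    r_min: "\<And>t. t \<in> I \<Longrightarrow> t \<noteq> 0 \<Longrightarrow> degree r \<le> degree t"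
    using ex_has_least_nat[of "\<lambda>r. r \<in> I \<and> r \<noteq> 0" f degree] fI fPD by blast
  have rPD: "r \<in> polys_over D"
    using r fPD g PD unfolding I_def by (auto intro!: subring_intros)
  have div: "\<exists>c s. c \<in> D \<and> c \<noteq> 0 \<and> s \<in> polys_over D \<and> [:c:] * k = r * s"
    if k: "k \<in> I" "k \<in> polys_over D" for k
  proof -
    obtain c s t where *: "c \<in> D" "c \<noteq> 0" "s \<in> polys_over D" "t \<in> polys_over D"
      "[:c:] * k = r * s + t" "t = 0 \<or> degree t < degree r"
      using pseudo_division[OF sD rPD r(2) k(2)] by blast
    have "t = [:c:] * k - r * s" using *(5) by simp
    hence "t \<in> I" using I_diff[OF I_mult r(1)] that * sD by (metis const_in_polys_over)
    hence "t = 0" using r_min *(6) by force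
    thus ?thesis using * by auto
  qed
  \<comment> \<open>If \<open>r\<close> is a constant \<open>d\<close>, it is a combination of
    \<open>f\<close> and \<open>g\<close>, so \<open>f\<close> divides \<open>d * h\<close>.
    Otherwise the nonconstant factor \<open>r'\<close> of \<open>r\<close> also divides
    \<open>f\<close> and is associated with it, so \<open>f\<close> divides \<open>g\<close> up to a
    constant.\<close>
  show "rel_dvd (polys_over D) f g \<or> rel_dvd (polys_over D) f h"
  proof (cases "degree r = 0")
    case True
    then obtain d where d: "r = [:d:]" by (metis degree_eq_zeroE)
    have dD: "d \<in> D" "d \<noteq> 0" using rPD r(2) d sD by (auto simp: const_in_polys_over)
    obtain a b where ab: "r = a * f + b * g" "a \<in> polys_over D" "b \<in> polys_over D"
      using r unfolding I_def by blast
    have "[:d:] * h = f * (a * h) + b * (g * h)" unfolding d[symmetric] ab by (simp add: algebra_simps)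
    moreover have "rel_dvd (polys_over D) f (f * (a * h))"
      using ab h subring_mult[OF PD] unfolding rel_dvd_def by blast
    moreover have "rel_dvd (polys_over D) f (b * (g * h))"
      using dvd ab rel_dvd_mult2[OF PD] by blast
    ultimately have "rel_dvd (polys_over D) f ([:d:] * h)" using rel_dvd_add[OF PD] by simp
    thus ?thesis using irred_poly_dvd_const_mult[OF D f dD h] by blast
  next
    case False
    obtain c s where c: "c \<in> D" "c \<noteq> 0" "s \<in> polys_over D" "[:c:] * f = r * s"
      using div fI fPD by blast
    obtain ps where ps: "\<forall>p\<in>set ps. rel_prime D p" "c = prod_list ps"
      using D c by (auto simp: rel_factorial_def)
    obtain c1 r' s' where *: "c1 \<in> D" "r' \<in> polys_over D" "s' \<in> polys_over D"
      "f = r' * s'" "r = [:c1:] * r'"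
      using cancel_const_poly[OF sD ps(1) fPD(1) rPD c(3)] c ps by blast
    have "rel_unit (polys_over D) r' \<or> rel_unit (polys_over D) s'"
      using f(1) * unfolding rel_irred_def by blast
    moreover have "\<not> rel_unit (polys_over D) r'"
      using False * rel_unit_poly_degree[of _ r'] by (auto split: if_splits)
    ultimately obtain u where u: "u \<in> polys_over D" "s' * u = 1" by (auto simp: rel_unit_def)
    have "r = f * ([:c1:] * u)"
      unfolding *(4,5) using u(2) by (metis mult.assoc mult.commute mult.right_neutral)
    moreover obtain c' s2 where c': "c' \<in> D" "c' \<noteq> 0" "s2 \<in> polys_over D" "[:c':] * g = r * s2"
      using div gI g by blast
    ultimately have "[:c':] * g = f * (([:c1:] * u) * s2)" by (simp only: mult.assoc)
    moreover have "([:c1:] * u) * s2 \<in> polys_over D"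
      using u c' * sD by (intro subring_mult PD) (simp_all add: const_in_polys_over)
    ultimately have "rel_dvd (polys_over D) f ([:c':] * g)" unfolding rel_dvd_def by blast
    thus ?thesis using irred_poly_dvd_const_mult[OF D f c'(1,2) g] by blast
  qed
qed

text \<open>The outer induction on the degree handles proper splittings, the inner one on a prime
  factorisation of the leading coefficient handles constant factors. Once no listed prime divides
  the polynomial, every constant factor is a unit, so a splitting into nonunits lowers both
  degrees.\<close>

lemma rel_factorial_polys_over:
  fixes D :: "'a::idom set"
  assumes D: "rel_factorial D"
  shows "rel_factorial (polys_over D)"
proof -
  have sD: "is_subring D" using D by (simp add: rel_factorial_def)
  note PD = is_subring_polys_over[OF sD]
  let ?fac = "\<lambda>f. \<exists>qs. (\<forall>q\<in>set qs. rel_prime (polys_over D) q) \<and> f = prod_list qs"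
  have fac_mult: "?fac (f * g)" if fg: "?fac f" "?fac g" for f g
  proof -
    obtain qs rs where "\<forall>q\<in>set qs. rel_prime (polys_over D) q" "f = prod_list qs"
      "\<forall>q\<in>set rs. rel_prime (polys_over D) q" "g = prod_list rs" using fg by blast
    thus ?thesis by (intro exI[of _ "qs @ rs"]) auto
  qed
  have fac_prime: "?fac f" if "rel_prime (polys_over D) f" for f
    using that by (intro exI[of _ "[f]"]) simp
  have fac: "f \<in> polys_over D \<Longrightarrow> f \<noteq> 0 \<Longrightarrow> ?fac f" for f
  proof (induction "degree f" arbitrary: f rule: less_induct)
    case outer: less
    obtain ps where ps: "\<forall>p\<in>set ps. rel_prime D p" "lead_coeff f = prod_list ps"
      using D outer.prems polys_over_coeff[OF outer.prems(1)] unfolding rel_factorial_def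
      by (metis leading_coeff_0_iff)
    \<comment> \<open>The list \<open>ps\<close> bounds how often a constant prime can be divided
      out: each such division removes one of its entries.\<close>
    have "\<forall>p\<in>set ps. rel_prime D p \<Longrightarrow> lead_coeff k = prod_list ps \<Longrightarrow> k \<in> polys_over D \<Longrightarrow> k \<noteq> 0
       \<Longrightarrow> degree k = degree f \<Longrightarrow> ?fac k" for k
    proof (induction "length ps" arbitrary: ps k rule: less_induct)
      case less
      have psD: "set ps \<subseteq> D" using less.prems(1) by (auto simp: rel_prime_in)
      show ?case
      proof (cases "\<exists>p\<in>set ps. rel_dvd (polys_over D) [:p:] k")
        case True
        then obtain p g where p: "p \<in> set ps" "g \<in> polys_over D" "k = [:p:] * g"
          by (auto simp: rel_dvd_def)
        have p0: "p \<noteq> 0" "rel_prime D p" using less.prems(1) p rel_prime_nonzero by blast+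
        have "g \<noteq> 0" using less.prems p by auto
        have "p * lead_coeff g = p * prod_list (remove1 p ps)"
          using p less.prems(2) p0 prod_mset.remove[of p "mset ps"]
          by (simp add: prod_mset_prod_list flip: mset_remove1)
        hence "lead_coeff g = prod_list (remove1 p ps)" using p0 by simp
        moreover have "degree g = degree f" using p p0 less.prems by simp
        moreover have "length (remove1 p ps) < length ps"
          using p(1) by (simp add: length_remove1) (metis One_nat_def diff_less length_pos_if_in_set zero_less_one)
        ultimately have "?fac g"
          using less.hyps[of "remove1 p ps" g] less.prems(1) p \<open>g \<noteq> 0\<close> set_remove1_subset by (metis subsetD)
        moreover have "?fac [:p:]" using fac_prime rel_prime_const_poly[OF sD p0(2)] by blast
        ultimately show ?thesis unfolding p(3) by (rule fac_mult[rotated])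
      next
        case False
        show ?thesis
        proof (cases "rel_irred (polys_over D) k")
          case True
          show ?thesis
          proof (cases "degree k = 0")
            case deg: True
            then obtain c where c: "k = [:c:]" by (metis degree_eq_zeroE)
            have "[:prod_list qs:] = prod_list (map (\<lambda>p. [:p:]) qs)" for qs :: "'a list"
            proof (induction qs)
              case (Cons a qs)
              have "[:prod_list (a # qs):] = [:a:] * [:prod_list qs:]" by simp
              thus ?case unfolding Cons.IH by simp
            qed (simp add: one_pCons)
            thus ?thesis
              using less.prems c
              by (intro exI[of _ "map (\<lambda>p. [:p:]) ps"]) (auto simp: rel_prime_const_poly sD)
          next
            case False
            thus ?thesis using fac_prime irred_poly_imp_prime[OF D True] by blast
          qed
        next
          case nirr: False
          then obtain a b where ab: "a \<in> polys_over D" "b \<in> polys_over D" "k = a * b"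
            "\<not> rel_unit (polys_over D) a" "\<not> rel_unit (polys_over D) b"
            using less.prems unfolding rel_irred_def by blast
          have nonzero: "a \<noteq> 0" "b \<noteq> 0" using ab less.prems by auto
          \<comment> \<open>A nonunit prime factor \<open>r\<close> of the constant \<open>x\<close>
            divides the leading coefficient, hence some \<open>p\<close> in \<open>ps\<close>. As
            \<open>p\<close> is irreducible, it is an associate of \<open>r\<close> and would divide
            \<open>k\<close>, which is excluded in this case.\<close>
          have const_unit: "rel_unit (polys_over D) x"
            if x: "x \<in> polys_over D" "y \<in> polys_over D" "k = x * y" "degree x = 0" for x y
          proof -
            obtain c where c: "x = [:c:]" using x by (metis degree_eq_zeroE)
            have cD: "c \<in> D" "c \<noteq> 0" using x c sD less.prems by (auto simp: const_in_polys_over)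
            obtain rs where rs: "\<forall>r\<in>set rs. rel_prime D r" "c = prod_list rs"
              using D cD by (auto simp: rel_factorial_def)
            have rsD: "set rs \<subseteq> D" using rs by (auto simp: rel_prime_in)
            have lc: "prod_list ps = c * lead_coeff y"
              using less.prems(2) x c cD by simp
            have "rel_unit D r" if r: "r \<in> set rs" for r
            proof (rule ccontr)
              assume nu: "\<not> rel_unit D r"
              have rp: "rel_prime D r" using rs r by blast
              have "rel_dvd D r (prod_list rs)"
                using r rsD
              proof (induction rs)
                case (Cons a rs)
                show ?case
                proof (cases "r = a")
                  case True
                  thus ?thesis using Cons.prems by (auto simp: rel_dvd_def intro!: bexI[of _ "prod_list rs"] subring_prod_list[OF sD])
                next
                  case False
                  hence "rel_dvd D r (prod_list rs)" using Cons by auto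
                  thus ?thesis using Cons.prems rel_dvd_mult2[OF sD] by auto
                qed
              qed simp
              hence "rel_dvd D r (prod_list ps)"
                unfolding lc using rel_dvd_mult[OF sD] rs polys_over_coeff[OF x(2)] by simp
              then obtain p where p: "p \<in> set ps" "rel_dvd D r p"
                using rel_prime_dvd_prod_list[OF sD rp _ psD] nu by blast
              then obtain e where e: "e \<in> D" "p = r * e" by (auto simp: rel_dvd_def)
              have "rel_unit D e"
                using rel_prime_imp_irred[OF sD, of p] less.prems(1) p e nu rel_prime_in[OF rp]
                unfolding rel_irred_def by blast
              then obtain e' where e': "e' \<in> D" "e * e' = 1" by (auto simp: rel_unit_def)
              have "r = p * e'" using e e' by (simp add: mult.assoc)
              hence "rel_dvd D p r" using e' by (auto simp: rel_dvd_def)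
              have "rel_dvd D p c"
                using \<open>rel_dvd D p r\<close> \<open>rel_dvd D r (prod_list rs)\<close> rs(2) rel_dvd_trans[OF sD] by blast
              hence "\<forall>i. rel_dvd D p (coeff k i)"
                using x c polys_over_coeff[OF x(2)] rel_dvd_mult[OF sD] by simp
              hence "rel_dvd (polys_over D) [:p:] k"
                using rel_dvd_const_poly[OF sD less.prems(3)] by blast
              thus False using False p by blast
            qed
            hence "rel_unit D c"
              unfolding rs(2)
              by (induction rs) (auto simp: rel_unit_1 sD intro: rel_unit_mult)
            then obtain c' where "c' \<in> D" "c * c' = 1" by (auto simp: rel_unit_def)
            hence "[:c':] \<in> polys_over D" "[:c:] * [:c':] = 1"
              by (simp_all add: const_in_polys_over sD one_pCons mult.commute)
            thus ?thesis using x c unfolding rel_unit_def by blast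
          qed
          have "degree a \<noteq> 0" "degree b \<noteq> 0"
            using const_unit[of a b] const_unit[of b a] ab by (auto simp: mult.commute)
          moreover have "degree f = degree a + degree b"
            using ab nonzero less.prems by (simp add: degree_mult_eq)
          ultimately have "?fac a" "?fac b" using outer.hyps ab nonzero by auto
          thus ?thesis unfolding ab(3) by (rule fac_mult)
        qed
      qed
    qed
    thus ?case using ps outer.prems by blast
  qed
  show ?thesis unfolding rel_factorial_def using PD fac by blast
qed

section \<open>Adjoining a transcendental element together with its inverse\<close>

definition adjoin_inv :: "'a::comm_ring_1 set \<Rightarrow> 'a \<Rightarrow> 'a \<Rightarrow> 'a set" where
  "adjoin_inv D x y = {poly g x * y ^ n |g n. g \<in> polys_over D}"

context
  fixes D :: "'a::idom set" and x y :: 'a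
  assumes D: "is_subring D" and xy: "x * y = 1"
    and transc: "\<And>g. g \<in> polys_over D \<Longrightarrow> poly g x = 0 \<Longrightarrow> g = 0"
begin

lemma poly_in_adjoin_inv: "g \<in> polys_over D \<Longrightarrow> poly g x \<in> adjoin_inv D x y"
  unfolding adjoin_inv_def by (intro CollectI exI[of _ g] exI[of _ 0]) simp

lemma is_subring_adjoin_inv: "is_subring (adjoin_inv D x y)"
proof -
  note PD = is_subring_polys_over[OF D]
  have X: "[:0, 1:] \<in> polys_over D"
    using D by (simp add: pCons_in_polys_over subring_intros PD)
  have xy_power: "x ^ n * y ^ n = 1" for n using xy by (metis power_mult_distrib power_one)
  show ?thesis
    unfolding is_subring_def
  proof (intro conjI ballI)
    show "1 \<in> adjoin_inv D x y" using poly_in_adjoin_inv[OF subring_1[OF PD]] by simp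
  next
    fix a b assume "a \<in> adjoin_inv D x y" "b \<in> adjoin_inv D x y"
    then obtain g m h n where *: "g \<in> polys_over D" "a = poly g x * y ^ m"
      "h \<in> polys_over D" "b = poly h x * y ^ n" unfolding adjoin_inv_def by blast
    have "a + b = poly g x * y ^ m * (x ^ n * y ^ n) + poly h x * y ^ n * (x ^ m * y ^ m)"
      unfolding xy_power using * by simp
    also have "\<dots> = poly (g * [:0, 1:] ^ n + h * [:0, 1:] ^ m) x * y ^ (m + n)"
      by (simp add: algebra_simps power_add)
    finally show "a + b \<in> adjoin_inv D x y"
      unfolding adjoin_inv_def using * X PD by (blast intro: subring_intros)
    have "a * b = poly (g * h) x * y ^ (m + n)" using * by (simp add: algebra_simps power_add)
    thus "a * b \<in> adjoin_inv D x y"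
      unfolding adjoin_inv_def using * PD by (blast intro: subring_intros)
  next
    fix a assume "a \<in> adjoin_inv D x y"
    then obtain g m where *: "g \<in> polys_over D" "a = poly g x * y ^ m"
      unfolding adjoin_inv_def by blast
    have "- a = poly (- g) x * y ^ m" using * by simp
    thus "- a \<in> adjoin_inv D x y"
      unfolding adjoin_inv_def using * PD by (blast intro: subring_intros)
  qed
qed

text \<open>Multiplying by powers of \<open>x\<close> turns a divisibility into an equation between
  polynomial values, and transcendence makes it an equation of polynomials. There \<open>p\<close>
  divides a numerator, or it divides a power of the indeterminate and then becomes a unit.\<close>

lemma rel_prime_poly_adjoin_inv:
  assumes p: "rel_prime (polys_over D) p"
  shows "rel_prime (adjoin_inv D x y) (poly p x)"
  unfolding rel_prime_def
proof (intro conjI ballI impI)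
  note PD = is_subring_polys_over[OF D]
  note E = is_subring_adjoin_inv
  have X: "[:0, 1:] \<in> polys_over D"
    using D by (simp add: pCons_in_polys_over subring_intros PD)
  have xy_power: "x ^ n * y ^ n = 1" for n using xy by (metis power_mult_distrib power_one)
  have y_power: "y ^ n \<in> adjoin_inv D x y" for n
    unfolding adjoin_inv_def using subring_1[OF PD] by (intro CollectI exI[of _ 1] exI[of _ n]) simp
  have dvd_E: "rel_dvd (adjoin_inv D x y) (poly p x) (poly g x * y ^ n)"
    if "rel_dvd (polys_over D) p g" for g n
    using that y_power poly_in_adjoin_inv subring_mult[OF E]
    unfolding rel_dvd_def by (metis mult.assoc poly_mult)
  show "poly p x \<in> adjoin_inv D x y" using poly_in_adjoin_inv p rel_prime_in by blast
  show "poly p x \<noteq> 0" using transc p rel_prime_in rel_prime_nonzero by blast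
  fix a b assume ab: "a \<in> adjoin_inv D x y" "b \<in> adjoin_inv D x y"
    and dvd: "rel_dvd (adjoin_inv D x y) (poly p x) (a * b)"
  from ab obtain g m h n where *: "g \<in> polys_over D" "a = poly g x * y ^ m"
    "h \<in> polys_over D" "b = poly h x * y ^ n" unfolding adjoin_inv_def by blast
  from dvd obtain e k where e: "e \<in> polys_over D" "a * b = poly p x * (poly e x * y ^ k)"
    unfolding rel_dvd_def adjoin_inv_def by blast
  have "poly (g * h * [:0, 1:] ^ k) x = (a * b) * (x ^ m * x ^ n * x ^ k)"
  proof -
    have "(a * b) * (x ^ m * x ^ n * x ^ k)
        = poly g x * poly h x * x ^ k * (x ^ m * y ^ m) * (x ^ n * y ^ n)"
      using * by (simp only: ac_simps)
    moreover have "poly [:0, 1:] x = x" by simp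
    ultimately show ?thesis unfolding xy_power poly_mult poly_power by (simp only: mult_1_right)
  qed
  also have "\<dots> = poly p x * poly e x * x ^ (m + n) * (x ^ k * y ^ k)"
    unfolding e power_add by (simp only: ac_simps)
  also have "\<dots> = poly (p * (e * [:0, 1:] ^ (m + n))) x" unfolding xy_power by simp
  finally have "poly (g * h * [:0, 1:] ^ k - p * (e * [:0, 1:] ^ (m + n))) x = 0" by simp
  moreover have "g * h * [:0, 1:] ^ k - p * (e * [:0, 1:] ^ (m + n)) \<in> polys_over D"
    using * e X p by (intro subring_intros PD) (auto simp: rel_prime_in)
  ultimately have "g * h * [:0, 1:] ^ k = p * (e * [:0, 1:] ^ (m + n))" using transc by fastforce
  hence "rel_dvd (polys_over D) p ((g * h) * [:0, 1:] ^ k)"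
    unfolding rel_dvd_def using e X subring_mult[OF PD] subring_power[OF PD] by blast
  hence "rel_dvd (polys_over D) p (g * h) \<or> rel_dvd (polys_over D) p ([:0, 1:] ^ k)"
    using rel_prime_dvd_multD[OF p] subring_mult[OF PD] subring_power[OF PD X] * by blast
  thus "rel_dvd (adjoin_inv D x y) (poly p x) a \<or> rel_dvd (adjoin_inv D x y) (poly p x) b"
  proof
    assume "rel_dvd (polys_over D) p (g * h)"
    hence "rel_dvd (polys_over D) p g \<or> rel_dvd (polys_over D) p h"
      using rel_prime_dvd_multD[OF p] * by blast
    thus ?thesis using dvd_E * by auto
  next
    assume "rel_dvd (polys_over D) p ([:0, 1:] ^ k)"
    from dvd_E[OF this, of k] have "rel_dvd (adjoin_inv D x y) (poly p x) 1"
      using xy_power by simp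
    thus ?thesis using rel_dvd_mult[OF E _ ab(1), of _ 1] by simp
  qed
qed

lemma rel_factorial_adjoin_inv:
  assumes fac: "rel_factorial D"
  shows "rel_factorial (adjoin_inv D x y)"
  unfolding rel_factorial_def
proof (intro conjI ballI impI is_subring_adjoin_inv)
  fix a assume a: "a \<in> adjoin_inv D x y" "a \<noteq> 0"
  note PD = is_subring_polys_over[OF D]
  have yE: "y ^ n \<in> adjoin_inv D x y" for n
    unfolding adjoin_inv_def using subring_1[OF PD] by (intro CollectI exI[of _ 1] exI[of _ n]) simp
  from a obtain g m where g: "g \<in> polys_over D" "a = poly g x * y ^ m"
    unfolding adjoin_inv_def by blast
  hence "g \<noteq> 0" using a by auto
  then obtain ps where ps: "\<forall>p\<in>set ps. rel_prime (polys_over D) p" "g = prod_list ps"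
    using rel_factorial_polys_over[OF fac] g unfolding rel_factorial_def by blast
  have "poly (prod_list ps) x = prod_list (map (\<lambda>p. poly p x) ps)" by (induction ps) auto
  hence eq: "a = prod_list (map (\<lambda>p. poly p x) ps @ [y ^ m])" using g ps by simp
  have "y ^ m * x ^ m = 1" using xy by (metis mult.commute power_mult_distrib power_one)
  moreover have "x ^ m \<in> adjoin_inv D x y"
    using poly_in_adjoin_inv[of "[:0, 1:] ^ m"] D
    by (simp add: pCons_in_polys_over subring_intros PD)
  ultimately have "rel_unit (adjoin_inv D x y) (y ^ m)" using yE unfolding rel_unit_def by blast
  hence "rel_prime (adjoin_inv D x y) (y ^ m)"
    by (rule rel_unit_imp_prime[OF is_subring_adjoin_inv])
  thus "\<exists>ps. (\<forall>p\<in>set ps. rel_prime (adjoin_inv D x y) p) \<and> a = prod_list ps"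
    using ps(1) rel_prime_poly_adjoin_inv
    by (intro exI[of _ "map (\<lambda>p. poly p x) ps @ [y ^ m]"] conjI eq) auto
qed

lemma rel_prime_adjoin_inv: "rel_prime D p \<Longrightarrow> rel_prime (adjoin_inv D x y) p"
  using rel_prime_poly_adjoin_inv[OF rel_prime_const_poly[OF D]] by simp

end

lemma rel_factorial_UNIV: "rel_factorial (UNIV :: 'a::{factorial_semiring, idom} set)"
  unfolding rel_factorial_def
proof (intro conjI ballI impI is_subring_UNIV)
  fix x :: 'a assume "x \<noteq> 0"
  then obtain A where A: "\<And>p. p \<in># A \<Longrightarrow> prime_elem p" "normalize (prod_mset A) = normalize x"
    using prime_factorization_exists by blast
  have prime: "rel_prime UNIV p" if "prime_elem p" for p :: 'a
    using that unfolding rel_prime_def rel_dvd_def prime_elem_def by (auto simp: dvd_def)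
  obtain ps where ps: "mset ps = A" using ex_mset by blast
  obtain u where u: "is_unit u" "x = u * prod_mset A"
    using associatedE1[OF A(2)[symmetric]] by blast
  obtain w where "u * w = 1" using u(1) by (metis dvdE)
  hence "rel_prime UNIV u" by (intro rel_unit_imp_prime is_subring_UNIV) (auto simp: rel_unit_def)
  moreover have "x = prod_list (u # ps)" using u ps by (simp flip: prod_mset_prod_list)
  moreover have "set ps = set_mset A" using ps by auto
  ultimately show "\<exists>ps. (\<forall>p\<in>set ps. rel_prime UNIV p) \<and> x = prod_list ps"
    using A(1) prime by (intro exI[of _ "u # ps"]) auto
qed

section \<open>Laurent polynomial rings\<close>

type_synonym ('x, 'r) laurent = "('x \<Rightarrow>\<^sub>0 int) \<Rightarrow>\<^sub>0 'r"

type_synonym ('x, 'r) laurent_fract = "('x, 'r) laurent fract"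

section \<open>Ring homomorphisms and transport of divisibility\<close>

definition is_hom :: "('a::comm_ring_1 \<Rightarrow> 'b::comm_ring_1) \<Rightarrow> bool" where
  "is_hom j \<longleftrightarrow> j 1 = 1 \<and> (\<forall>a b. j (a + b) = j a + j b) \<and> (\<forall>a b. j (a * b) = j a * j b)"

lemma
  assumes "is_hom j"
  shows hom_1: "j 1 = 1" and hom_add: "j (a + b) = j a + j b" and hom_mult: "j (a * b) = j a * j b"
  using assms by (auto simp: is_hom_def)

lemma hom_0: "is_hom j \<Longrightarrow> j 0 = 0"
  using hom_add[of j 0 0] by (metis add.right_neutral add_left_cancel)

lemma hom_uminus: "is_hom j \<Longrightarrow> j (- a) = - j a"
  using hom_add[of j a "- a"] by (simp add: hom_0 eq_neg_iff_add_eq_0 add.commute)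

lemma hom_sum: "is_hom j \<Longrightarrow> j (sum f I) = (\<Sum>i\<in>I. j (f i))"
  by (induction I rule: infinite_finite_induct) (auto simp: hom_0 hom_add)

lemma hom_prod: "is_hom j \<Longrightarrow> j (prod f I) = (\<Prod>i\<in>I. j (f i))"
  by (induction I rule: infinite_finite_induct) (auto simp: hom_1 hom_mult)

lemma hom_power: "is_hom j \<Longrightarrow> j (a ^ n) = j a ^ n"
  by (induction n) (auto simp: hom_1 hom_mult)

lemma hom_field_eq_0_iff: "is_hom (j :: 'a::field \<Rightarrow> 'b::comm_ring_1) \<Longrightarrow> j a = 0 \<longleftrightarrow> a = 0"
  by (metis hom_0 hom_1 hom_mult mult_zero_left right_inverse zero_neq_one)

lemma hom_field_inj: "is_hom (j :: 'a::field \<Rightarrow> 'b::comm_ring_1) \<Longrightarrow> inj j"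
proof (rule injI)
  fix a b assume j: "is_hom j" and "j a = j b"
  hence "j (a + - b) = 0" by (simp only: hom_add[OF j] hom_uminus[OF j]) simp
  thus "a = b" using hom_field_eq_0_iff[OF j, of "a + - b"] by simp
qed

lemma hom_inverse: "is_hom (j :: 'a::field \<Rightarrow> 'b::field) \<Longrightarrow> j (inverse a) = inverse (j a)"
  by (cases "a = 0") (auto simp: hom_0 hom_1 simp flip: hom_mult intro!: inverse_unique[symmetric])

lemma hom_powi: "is_hom (j :: 'a::field \<Rightarrow> 'b::field) \<Longrightarrow> j (a powi k) = j a powi k"
  by (simp add: power_int_def hom_power hom_inverse)

lemma hom_comp: "is_hom f \<Longrightarrow> is_hom g \<Longrightarrow> is_hom (\<lambda>x. f (g x))"
  by (simp add: is_hom_def)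

lemma rel_coprime_iff: "rel_coprime S a b \<longleftrightarrow> a \<in> S \<and> b \<in> S \<and>
    (\<forall>d\<in>S. rel_dvd S d a \<longrightarrow> rel_dvd S d b \<longrightarrow> rel_unit S d)"
  by (auto simp: rel_coprime_def rel_dvd_def)

context
  fixes j :: "'a::idom \<Rightarrow> 'b::idom" and S :: "'a set"
  assumes j: "is_hom j" and inj: "inj_on j S" and S: "is_subring S"
begin

lemma is_subring_image: "is_subring (j ` S)"
  unfolding is_subring_def
  using S hom_1[OF j] by (auto simp flip: hom_add[OF j] hom_mult[OF j] hom_uminus[OF j]
    simp: subring_intros intro: image_eqI[of _ j 1])

lemma rel_dvd_image: "a \<in> S \<Longrightarrow> b \<in> S \<Longrightarrow> rel_dvd (j ` S) (j a) (j b) \<longleftrightarrow> rel_dvd S a b"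
  unfolding rel_dvd_def using S inj
  by (auto simp flip: hom_mult[OF j] dest!: inj_onD simp: subring_mult)

lemma rel_unit_image: "a \<in> S \<Longrightarrow> rel_unit (j ` S) (j a) \<longleftrightarrow> rel_unit S a"
  using rel_dvd_image[of a 1] S subring_1[OF S] unfolding rel_unit_def rel_dvd_def
  by (auto simp: hom_1[OF j] dest: sym)

lemma image_nonzero: "a \<in> S \<Longrightarrow> j a = 0 \<longleftrightarrow> a = 0"
  using inj subring_0[OF S] by (metis hom_0[OF j] inj_onD)

lemma rel_prime_image: "a \<in> S \<Longrightarrow> rel_prime (j ` S) (j a) \<longleftrightarrow> rel_prime S a"
  unfolding rel_prime_def
  by (auto simp: image_nonzero rel_dvd_image subring_mult[OF S] simp flip: hom_mult[OF j])

lemma rel_irred_image: "a \<in> S \<Longrightarrow> rel_irred (j ` S) (j a) \<longleftrightarrow> rel_irred S a"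
  unfolding rel_irred_def
  by (auto simp: image_nonzero rel_unit_image inj_on_eq_iff[OF inj] subring_mult[OF S] simp flip: hom_mult[OF j])

lemma rel_coprime_image:
  "a \<in> S \<Longrightarrow> b \<in> S \<Longrightarrow> rel_coprime (j ` S) (j a) (j b) \<longleftrightarrow> rel_coprime S a b"
  by (auto simp: rel_coprime_iff rel_unit_image rel_dvd_image)

lemma rel_factorial_image:
  assumes fac: "rel_factorial S"
  shows "rel_factorial (j ` S)"
  unfolding rel_factorial_def
proof (intro conjI ballI impI is_subring_image)
  fix x assume "x \<in> j ` S" "x \<noteq> 0"
  then obtain a where a: "a \<in> S" "x = j a" "a \<noteq> 0" using hom_0[OF j] by auto
  then obtain ps where ps: "\<forall>p\<in>set ps. rel_prime S p" "a = prod_list ps"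
    using fac by (auto simp: rel_factorial_def)
  have "j (prod_list ps) = prod_list (map j ps)"
    by (induction ps) (auto simp: hom_1[OF j] hom_mult[OF j])
  thus "\<exists>ps. (\<forall>p\<in>set ps. rel_prime (j ` S) p) \<and> x = prod_list ps"
    using a ps by (intro exI[of _ "map j ps"]) (auto simp: rel_prime_image rel_prime_in)
qed

end

section \<open>Laurent polynomials in a given set of variables\<close>

abbreviation "pkeys \<equiv> Poly_Mapping.keys"
abbreviation "plookup \<equiv> Poly_Mapping.lookup"
abbreviation "psingle \<equiv> Poly_Mapping.single"

lemma poly_mapping_expand: "(X :: 'a \<Rightarrow>\<^sub>0 'b::comm_monoid_add) = (\<Sum>m\<in>pkeys X. psingle m (plookup X m))"
  by (rule poly_mapping_eqI) (auto simp: lookup_sum lookup_single when_def in_keys_iff)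

lemma poly_mapping_single_induct:
  fixes X :: "'a \<Rightarrow>\<^sub>0 'b::comm_monoid_add"
  assumes "\<And>m c. m \<in> pkeys X \<Longrightarrow> P (psingle m c)" "P 0" "\<And>X Y. P X \<Longrightarrow> P Y \<Longrightarrow> P (X + Y)"
  shows "P X"
proof -
  have "finite A \<Longrightarrow> A \<subseteq> pkeys X \<Longrightarrow> P (\<Sum>m\<in>A. psingle m (plookup X m))" for A
    by (induction A rule: finite_induct) (auto intro!: assms)
  thus ?thesis using poly_mapping_expand[of X] by (metis finite_keys order_refl)
qed

lemma is_subring_laurent_in: "is_subring (laurent_in T :: ('x, 'r::idom) laurent set)"
  unfolding is_subring_def
proof (intro conjI ballI)
  fix a b :: "('x, 'r) laurent" assume ab: "a \<in> laurent_in T" "b \<in> laurent_in T"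
  show "a + b \<in> laurent_in T"
    using ab keys_add[of a b] unfolding laurent_in_def by blast
  show "a * b \<in> laurent_in T"
    unfolding laurent_in_def
  proof (intro CollectI ballI)
    fix m assume "m \<in> pkeys (a * b)"
    then obtain k l where "k \<in> pkeys a" "l \<in> pkeys b" "m = k + l" using keys_mult by blast
    thus "pkeys m \<subseteq> T" using ab keys_add[of k l] unfolding laurent_in_def by blast
  qed
qed (auto simp: laurent_in_def)

lemma single_in_laurent_in: "pkeys m \<subseteq> T \<Longrightarrow> psingle m c \<in> laurent_in T"
  by (auto simp: laurent_in_def)

lemma laurent_in_mono: "S \<subseteq> T \<Longrightarrow> laurent_in S \<subseteq> laurent_in T"
  by (auto simp: laurent_in_def)

lemma laur_const_in: "laur_const c \<in> laurent_in T"
  by (simp add: laur_const_def single_in_laurent_in)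

lemma laur_var_in: "x \<in> T \<Longrightarrow> laur_var x \<in> laurent_in T"
  by (simp add: laur_var_def single_in_laurent_in)

definition laur_var_inv :: "'x \<Rightarrow> ('x, 'r::{zero,one}) laurent" where
  "laur_var_inv x = psingle (psingle x (- 1)) 1"

lemma laur_var_inv_in: "x \<in> T \<Longrightarrow> laur_var_inv x \<in> laurent_in T"
  by (simp add: laur_var_inv_def single_in_laurent_in)

lemma laur_var_mult_inv: "laur_var x * laur_var_inv x = (1 :: ('x, 'r::idom) laurent)"
  by (simp add: laur_var_def laur_var_inv_def mult_single flip: single_add)

lemma is_hom_laur_const: "is_hom (laur_const :: 'r::idom \<Rightarrow> ('x::linorder, 'r) laurent)"
  by (simp add: is_hom_def laur_const_def single_add mult_single)

lemma laurent_in_induct [consumes 1, case_names const var inv add mult]: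
  fixes X :: "('x, 'r::idom) laurent"
  assumes X: "X \<in> laurent_in T"
    and const: "\<And>c. P (laur_const c)"
    and var: "\<And>x. x \<in> T \<Longrightarrow> P (laur_var x)"
    and inv: "\<And>x. x \<in> T \<Longrightarrow> P (laur_var_inv x)"
    and add: "\<And>X Y. P X \<Longrightarrow> P Y \<Longrightarrow> P (X + Y)"
    and mult: "\<And>X Y. P X \<Longrightarrow> P Y \<Longrightarrow> P (X * Y)"
  shows "P X"
proof (rule poly_mapping_single_induct[of X])
  fix m and c :: 'r assume "m \<in> pkeys X"
  hence "pkeys m \<subseteq> T" using X by (auto simp: laurent_in_def)
  \<comment> \<open>Exponent vectors are elements of a free abelian group and are built up by
    differences, so \<open>m\<close> and \<open>- m\<close> have to be carried along
    together.\<close>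
  hence "P (psingle m 1) \<and> P (psingle (- m) 1)"
  proof (induction m rule: frag_induction)
    case zero
    have "P (psingle 0 1)" using const[of 1] by (simp add: laur_const_def)
    thus ?case by simp
  next
    case (one x)
    thus ?case using var inv by (simp add: laur_var_def laur_var_inv_def single_uminus)
  next
    case (diff a b)
    have "psingle (a - b) (1::'r) = psingle a 1 * psingle (- b) 1"
      "psingle (- (a - b)) (1::'r) = psingle b 1 * psingle (- a) 1"
      by (simp_all add: mult_single)
    thus ?case using diff mult by metis
  qed
  moreover have "psingle m c = laur_const c * psingle m 1"
    by (simp add: laur_const_def mult_single)
  ultimately show "P (psingle m c)" using const mult by simp
next
  show "P 0" using const[of 0] by (simp add: laur_const_def)
qed (rule add)

lemma lookup_mult_single:
  fixes c :: "'a::ab_group_add \<Rightarrow>\<^sub>0 'r::idom"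
  shows "plookup (c * psingle s 1) m = plookup c (m - s)"
proof (induction rule: poly_mapping_single_induct[of c])
  case (1 n d)
  show ?case by (auto simp: mult_single lookup_single when_def)
qed (auto simp: lookup_add distrib_right)

lemma laur_var_power: "laur_var x ^ n = (psingle (psingle x (int n)) 1 :: ('x, 'r::idom) laurent)"
  by (induction n) (auto simp: laur_var_def mult_single simp flip: single_add)

text \<open>As \<open>x\<close> occurs in no coefficient of \<open>g\<close>, the terms of the value
  with \<open>x\<close>-exponent \<open>k\<close> come from coefficient \<open>k\<close> alone, so
  each coefficient can be read off from the value.\<close>

lemma laur_var_transcendental:
  fixes g :: "('x::linorder, 'r::idom) laurent poly"
  assumes x: "x \<notin> T" and g: "g \<in> polys_over (laurent_in T)" and 0: "poly g (laur_var x) = 0"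
  shows "g = 0"
proof (rule poly_eqI)
  fix k
  have no_x: "plookup (coeff g i) m = 0" if "plookup m x \<noteq> 0" for i m
    using polys_over_coeff[OF g, of i] x that unfolding laurent_in_def
    by (metis (mono_tags, lifting) in_keys_iff mem_Collect_eq subsetD)
  have "plookup (coeff g k) m = 0" for m
  proof (cases "plookup m x = 0")
    case True
    have "poly g (laur_var x) = (\<Sum>i\<le>degree g. coeff g i * psingle (psingle x (int i)) 1)"
      by (simp add: poly_altdef laur_var_power)
    hence "0 = (\<Sum>i\<le>degree g. coeff g i * psingle (psingle x (int i)) 1)" using 0 by (simp only:)
    from arg_cong[OF this, of "\<lambda>X. plookup X (m + psingle x (int k))"]
    have "0 = (\<Sum>i\<le>degree g. plookup (coeff g i) (m + psingle x (int k) - psingle x (int i)))"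
      by (simp only: lookup_sum lookup_mult_single lookup_zero)
    also have "\<dots> = (\<Sum>i\<le>degree g. if i = k then plookup (coeff g i) m else 0)"
      by (intro sum.cong refl) (auto intro!: no_x simp: lookup_add lookup_minus True)
    also have "\<dots> = plookup (coeff g k) m" by (simp add: coeff_eq_0)
    finally show ?thesis by simp
  qed (rule no_x)
  thus "coeff g k = coeff 0 k" by (simp add: poly_mapping_eqI)
qed

text \<open>This makes one more variable a single Laurent extension, so that the results on
  \<open>adjoin_inv\<close> can be iterated over finite sets of variables.\<close>

lemma laurent_in_insert:
  assumes x: "x \<notin> T"
  shows "laurent_in (insert x T) =
    adjoin_inv (laurent_in T) (laur_var x) (laur_var_inv x :: ('x::linorder, 'r::idom) laurent)"
    (is "?L = ?E")
proof
  note L = is_subring_laurent_in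
  note PL = is_subring_polys_over[OF is_subring_laurent_in]
  note tr = laur_var_transcendental[OF x]
  have E: "is_subring ?E"
    by (rule is_subring_adjoin_inv[OF L laur_var_mult_inv tr])
  have poly_E: "poly g (laur_var x) \<in> ?E" if "g \<in> polys_over (laurent_in T)" for g
    by (rule poly_in_adjoin_inv[OF L laur_var_mult_inv tr that])
  have const_E: "c \<in> ?E" if "c \<in> laurent_in T" for c
    using poly_E[of "[:c:]"] that by (simp add: const_in_polys_over L)
  show "?L \<subseteq> ?E"
  proof
    fix X :: "('x, 'r) laurent" assume "X \<in> ?L"
    thus "X \<in> ?E"
    proof (induction rule: laurent_in_induct)
      case (var z)
      show ?case
      proof (cases "z = x")
        case True
        have "[:0, 1:] \<in> polys_over (laurent_in T :: ('x, 'r) laurent set)"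
          unfolding pCons_in_polys_over using subring_0[OF L] subring_1[OF L] subring_0[OF PL] by blast
        from poly_E[OF this] show ?thesis using True by simp
      qed (use var const_E[OF laur_var_in[of z T]] in simp)
    next
      case (inv z)
      show ?case
      proof (cases "z = x")
        case True
        have "laur_var_inv x = poly 1 (laur_var x) * laur_var_inv x ^ 1"
          by simp
        thus ?thesis using subring_1[OF PL] True unfolding adjoin_inv_def by blast
      qed (use inv const_E[OF laur_var_inv_in[of z T]] in simp)
    qed (use const_E[OF laur_const_in] subring_add[OF E] subring_mult[OF E] in simp_all)
  qed
  show "?E \<subseteq> ?L"
  proof
    fix X assume "X \<in> ?E"
    then obtain g n where g: "g \<in> polys_over (laurent_in T)" "X = poly g (laur_var x) * laur_var_inv x ^ n"
      unfolding adjoin_inv_def by blast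
    have "coeff g i \<in> ?L" for i
      using polys_over_coeff[OF g(1)] laurent_in_mono[of T "insert x T"] by blast
    thus "X \<in> ?L"
      unfolding g(2) poly_altdef
      by (intro subring_mult[OF L] subring_sum[OF L] subring_power[OF L])
         (auto simp: laur_var_in laur_var_inv_in)
  qed
qed

lemma rel_factorial_laurent_in:
  "finite T \<Longrightarrow> rel_factorial (laurent_in T :: ('x::linorder, 'r::{factorial_semiring, idom}) laurent set)"
proof (induction T rule: finite_induct)
  case empty
  have "laurent_in {} = range (laur_const :: 'r \<Rightarrow> ('x, 'r) laurent)"
  proof (intro equalityI subsetI)
    fix X :: "('x, 'r) laurent" assume "X \<in> laurent_in {}"
    thus "X \<in> range laur_const"
      by (induction rule: laurent_in_induct)
         (auto simp flip: hom_add[OF is_hom_laur_const] hom_mult[OF is_hom_laur_const])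
  qed (auto simp: laur_const_in)
  moreover have "inj (laur_const :: 'r \<Rightarrow> ('x, 'r) laurent)"
    by (rule injI) (metis laur_const_def lookup_single_eq)
  ultimately show ?case
    using rel_factorial_image[OF is_hom_laur_const _ is_subring_UNIV rel_factorial_UNIV] by metis
next
  case (insert x T)
  show ?case
    unfolding laurent_in_insert[OF insert.hyps(2)]
    by (rule rel_factorial_adjoin_inv[OF is_subring_laurent_in laur_var_mult_inv
          laur_var_transcendental[OF insert.hyps(2)] insert.IH])
qed

definition laur_vars :: "('x, 'r::zero) laurent \<Rightarrow> 'x set" where
  "laur_vars X = (\<Union>m\<in>pkeys X. pkeys m)"

lemma finite_laur_vars: "finite (laur_vars X)"
  by (simp add: laur_vars_def)

lemma laurent_in_iff: "X \<in> laurent_in T \<longleftrightarrow> laur_vars X \<subseteq> T"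
  by (auto simp: laurent_in_def laur_vars_def)

text \<open>\<open>T\<close> may be infinite, but the elements of one divisibility relation involve
  only finitely many variables, and adjoining those to \<open>S\<close> one at a time preserves
  primality.\<close>

lemma rel_prime_laurent_in_mono:
  fixes p :: "('x::linorder, 'r::idom) laurent"
  assumes p: "rel_prime (laurent_in S) p" and ST: "S \<subseteq> T"
  shows "rel_prime (laurent_in T) p"
proof -
  have fin: "finite A \<Longrightarrow> rel_prime (laurent_in (S \<union> A)) p" for A
  proof (induction A rule: finite_induct)
    case (insert x A)
    show ?case
    proof (cases "x \<in> S \<union> A")
      case False
      have "rel_prime (laurent_in (insert x (S \<union> A))) p"
        unfolding laurent_in_insert[OF False]
        by (rule rel_prime_adjoin_inv[OF is_subring_laurent_in laur_var_mult_inv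
              laur_var_transcendental[OF False] insert.IH])
      thus ?thesis by simp
    qed (use insert.IH in \<open>simp add: insert_absorb\<close>)
  qed (use p in simp)
  show ?thesis
    unfolding rel_prime_def
  proof (intro conjI ballI impI)
    show "p \<in> laurent_in T" "p \<noteq> 0"
      using p laurent_in_mono[OF ST] by (auto simp: rel_prime_def)
    fix a b assume ab: "a \<in> laurent_in T" "b \<in> laurent_in T" "rel_dvd (laurent_in T) p (a * b)"
    then obtain c where c: "c \<in> laurent_in T" "a * b = p * c" by (auto simp: rel_dvd_def)
    let ?A = "laur_vars a \<union> laur_vars b \<union> laur_vars c"
    have sub: "laurent_in (S \<union> ?A) \<subseteq> laurent_in T"
      using ab c ST by (intro laurent_in_mono) (auto simp: laurent_in_iff)
    have "rel_dvd (laurent_in (S \<union> ?A)) p a \<or> rel_dvd (laurent_in (S \<union> ?A)) p b"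
      using c fin[of ?A]
      by (intro rel_prime_dvd_multD) (auto simp: laurent_in_iff rel_dvd_def finite_laur_vars)
    thus "rel_dvd (laurent_in T) p a \<or> rel_dvd (laurent_in T) p b"
      using sub unfolding rel_dvd_def by blast
  qed
qed

section \<open>The function field and its Laurent polynomial subrings\<close>

lemma is_hom_to_frac: "is_hom (to_frac :: ('x::linorder, 'r::idom) laurent \<Rightarrow> _)"
  by (simp add: is_hom_def to_frac_def One_fract_def)

lemma inj_to_frac: "inj to_frac"
  by (rule injI) (simp add: to_frac_def eq_fract)

lemma to_frac_eq_iff [simp]: "to_frac X = to_frac Y \<longleftrightarrow> X = Y"
  using inj_to_frac by (auto dest: injD)

lemma to_frac_eq_0_iff [simp]: "to_frac X = 0 \<longleftrightarrow> X = 0"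
  using to_frac_eq_iff[of X 0] by (simp add: hom_0[OF is_hom_to_frac])

lemma is_hom_coef_emb: "is_hom (coef_emb :: 'r::idom \<Rightarrow> ('x::linorder, 'r) laurent_fract)"
  unfolding coef_emb_def by (rule hom_comp[OF is_hom_to_frac is_hom_laur_const])

definition var_frac :: "'x::linorder \<Rightarrow> ('x, 'r::idom) laurent_fract" where
  "var_frac x = to_frac (laur_var x)"

lemma to_frac_laur_var_inv: "to_frac (laur_var_inv x) = inverse (var_frac x)"
  unfolding var_frac_def using arg_cong[OF laur_var_mult_inv, of to_frac x]
  by (metis hom_mult[OF is_hom_to_frac] hom_1[OF is_hom_to_frac] inverse_unique)

lemma laur_var_nonzero: "laur_var x \<noteq> (0 :: ('x::linorder, 'r::idom) laurent)"
  using laur_var_mult_inv[of x] by (metis mult_zero_left zero_neq_one)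

lemma var_frac_nonzero: "var_frac x \<noteq> 0"
  by (simp add: var_frac_def laur_var_nonzero)

lemma fract_to_frac: "\<exists>a b. b \<noteq> 0 \<and> f = to_frac a / to_frac b"
  by (cases f) (auto simp: to_frac_def intro!: exI)

definition laurent_frac :: "'x::linorder set \<Rightarrow> ('x, 'r::idom) laurent_fract set" where
  "laurent_frac T = to_frac ` laurent_in T"

lemma is_subring_laurent_frac: "is_subring (laurent_frac T)"
  unfolding laurent_frac_def
  by (rule is_subring_image[OF is_hom_to_frac inj_on_subset[OF inj_to_frac subset_UNIV] is_subring_laurent_in])

lemma laurent_frac_mono: "S \<subseteq> T \<Longrightarrow> laurent_frac S \<subseteq> laurent_frac T"
  unfolding laurent_frac_def using laurent_in_mono by blast

lemma coef_emb_in: "coef_emb c \<in> laurent_frac T"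
  by (simp add: coef_emb_def laurent_frac_def laur_const_in)

lemma var_frac_in: "x \<in> T \<Longrightarrow> var_frac x \<in> laurent_frac T"
  by (simp add: var_frac_def laurent_frac_def laur_var_in)

lemma inverse_var_frac_in: "x \<in> T \<Longrightarrow> inverse (var_frac x) \<in> laurent_frac T"
  unfolding laurent_frac_def by (simp add: laur_var_inv_in flip: to_frac_laur_var_inv)

lemma laurent_frac_induct [consumes 1, case_names const var inv add mult]:
  assumes "f \<in> laurent_frac T"
    and "\<And>c. P (coef_emb c)" "\<And>x. x \<in> T \<Longrightarrow> P (var_frac x)" "\<And>x. x \<in> T \<Longrightarrow> P (inverse (var_frac x))"
    and "\<And>f g. P f \<Longrightarrow> P g \<Longrightarrow> P (f + g)" "\<And>f g. P f \<Longrightarrow> P g \<Longrightarrow> P (f * g)"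
  shows "P f"
proof -
  obtain X where X: "X \<in> laurent_in T" "f = to_frac X" using assms(1) by (auto simp: laurent_frac_def)
  have "P (to_frac X)"
    using X(1)
    by (induction rule: laurent_in_induct)
       (use assms(2-) in \<open>auto simp: hom_add[OF is_hom_to_frac] hom_mult[OF is_hom_to_frac]
          to_frac_laur_var_inv coef_emb_def var_frac_def\<close>)
  thus ?thesis using X by simp
qed

section \<open>Evaluation of Laurent polynomials\<close>

definition laur_mon :: "('x \<Rightarrow> 'f::field) \<Rightarrow> ('x \<Rightarrow>\<^sub>0 int) \<Rightarrow> 'f" where
  "laur_mon y m = (\<Prod>i\<in>pkeys m. y i powi plookup m i)"

lemma laur_mon_superset: "finite A \<Longrightarrow> pkeys m \<subseteq> A \<Longrightarrow> laur_mon y m = (\<Prod>i\<in>A. y i powi plookup m i)"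
  unfolding laur_mon_def by (rule prod.mono_neutral_left) (auto simp: in_keys_iff)

lemma laur_mon_add:
  assumes "\<And>i. y i \<noteq> 0"
  shows "laur_mon y (m + n) = laur_mon y m * laur_mon y n"
proof -
  let ?A = "pkeys m \<union> pkeys n"
  have "laur_mon y (m + n) = (\<Prod>i\<in>?A. y i powi plookup (m + n) i)"
    using keys_add[of m n] by (intro laur_mon_superset) auto
  also have "\<dots> = (\<Prod>i\<in>?A. y i powi plookup m i) * (\<Prod>i\<in>?A. y i powi plookup n i)"
    by (simp add: lookup_add power_int_add assms flip: prod.distrib)
  finally show ?thesis by (simp add: laur_mon_superset[of ?A])
qed

lemma laur_eval_alt: "laur_eval emb P y = (\<Sum>m\<in>pkeys P. emb (plookup P m) * laur_mon y m)"
  by (simp add: laur_eval_def laur_mon_def)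

lemma laur_eval_cong:
  "P \<in> laurent_in T \<Longrightarrow> (\<And>i. i \<in> T \<Longrightarrow> y i = z i) \<Longrightarrow> laur_eval emb P y = laur_eval emb P z"
  unfolding laur_eval_def laurent_in_def
  by (intro sum.cong arg_cong2[where f = "(*)"] prod.cong) (auto dest!: bspec)

context
  fixes emb :: "'r::idom \<Rightarrow> 'f::field"
  assumes emb: "is_hom emb"
begin

lemma laur_eval_superset:
  "finite A \<Longrightarrow> pkeys P \<subseteq> A \<Longrightarrow> laur_eval emb P y = (\<Sum>m\<in>A. emb (plookup P m) * laur_mon y m)"
  unfolding laur_eval_alt by (rule sum.mono_neutral_left) (auto simp: in_keys_iff hom_0[OF emb])

lemma laur_eval_add: "laur_eval emb (P + Q) y = laur_eval emb P y + laur_eval emb Q y"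
proof -
  let ?A = "pkeys P \<union> pkeys Q"
  have "laur_eval emb (P + Q) y = (\<Sum>m\<in>?A. emb (plookup (P + Q) m) * laur_mon y m)"
    using keys_add[of P Q] by (intro laur_eval_superset) auto
  thus ?thesis
    by (simp add: laur_eval_superset[of ?A] lookup_add hom_add[OF emb] distrib_right sum.distrib)
qed

lemma laur_eval_single: "laur_eval emb (psingle m c) y = emb c * laur_mon y m"
  by (simp add: laur_eval_alt hom_0[OF emb])

lemma laur_eval_mult:
  assumes "\<And>i. y i \<noteq> 0"
  shows "laur_eval emb (P * Q) y = laur_eval emb P y * laur_eval emb Q y"
proof (induction rule: poly_mapping_single_induct[of P])
  case P: (1 m c)
  show ?case
  proof (induction rule: poly_mapping_single_induct[of Q])
    case (1 n d)
    show ?case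
      using laur_mon_add[of y m n] assms by (simp add: mult_single laur_eval_single hom_mult[OF emb])
  qed (auto simp: laur_eval_alt[of _ 0] laur_eval_add algebra_simps)
qed (auto simp: laur_eval_alt[of _ 0] laur_eval_add algebra_simps)

lemma is_hom_laur_eval:
  assumes "\<And>i. y i \<noteq> 0"
  shows "is_hom (\<lambda>P. laur_eval emb P y)"
  using laur_eval_single[of 0 1 y]
  by (simp add: is_hom_def laur_eval_add laur_eval_mult assms laur_mon_def hom_1[OF emb])

lemma laur_eval_const: "laur_eval emb (laur_const c) y = emb c"
  by (simp add: laur_const_def laur_eval_single laur_mon_def)

lemma laur_eval_var: "laur_eval emb (laur_var x) y = y x"
  by (simp add: laur_var_def laur_eval_single laur_mon_def hom_1[OF emb])

lemma laur_eval_var_inv: "laur_eval emb (laur_var_inv x) y = inverse (y x)"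
  by (simp add: laur_var_inv_def laur_eval_single laur_mon_def hom_1[OF emb] power_int_minus)

end

lemma hom_laur_eval:
  fixes j :: "'f::field \<Rightarrow> 'g::field"
  assumes "is_hom j" "\<And>c. j (emb c) = emb' c"
  shows "j (laur_eval emb P y) = laur_eval emb' P (\<lambda>i. j (y i))"
  unfolding laur_eval_def
  by (simp add: hom_sum[OF assms(1)] hom_mult[OF assms(1)] hom_prod[OF assms(1)] hom_powi[OF assms(1)] assms(2))

lemma laur_eval_var_frac: "laur_eval coef_emb X var_frac = to_frac X"
proof -
  have "X \<in> laurent_in UNIV" by (simp add: laurent_in_def)
  thus ?thesis
  proof (induction rule: laurent_in_induct)
    case (const c)
    show ?case unfolding laur_eval_const[OF is_hom_coef_emb] by (rule coef_emb_def)
  next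
    case (var x)
    show ?case unfolding laur_eval_var[OF is_hom_coef_emb] by (rule var_frac_def)
  next
    case (inv x)
    show ?case unfolding laur_eval_var_inv[OF is_hom_coef_emb] by (rule to_frac_laur_var_inv[symmetric])
  next
    case (add X Y)
    thus ?case unfolding laur_eval_add[OF is_hom_coef_emb] hom_add[OF is_hom_to_frac] by simp
  next
    case (mult X Y)
    thus ?case unfolding laur_eval_mult[OF is_hom_coef_emb var_frac_nonzero] hom_mult[OF is_hom_to_frac] by simp
  qed
qed

lemma laur_eval_in_subring:
  assumes X: "X \<in> laurent_in T" and S: "is_subring S" and const: "\<And>c. coef_emb c \<in> S"
    and y: "\<And>i. i \<in> T \<Longrightarrow> y i \<in> S" "\<And>i. i \<in> T \<Longrightarrow> inverse (y i) \<in> S"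
  shows "laur_eval coef_emb X y \<in> S"
proof -
  have powi: "a powi k \<in> S" if "a \<in> S" "inverse a \<in> S" for a k
    using that S by (auto simp: power_int_def subring_power)
  show ?thesis unfolding laur_eval_def
    using X y by (intro subring_sum[OF S] subring_mult[OF S] subring_prod[OF S] const powi)
      (auto simp: laurent_in_def)
qed

section \<open>Independence of the ambient set of variables\<close>

text \<open>A retraction onto the Laurent ring in the variables \<open>T\<close>. The other
  variables are sent to 1 because their images must be invertible.\<close>

definition laur_retract :: "'x::linorder set \<Rightarrow> ('x, 'r::idom) laurent \<Rightarrow> ('x, 'r) laurent_fract" where
  "laur_retract T X = laur_eval coef_emb X (\<lambda>i. if i \<in> T then var_frac i else 1)"

lemma is_hom_laur_retract: "is_hom (laur_retract T)"
  unfolding laur_retract_def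
  by (rule is_hom_laur_eval[OF is_hom_coef_emb]) (simp add: var_frac_nonzero)

lemma laur_retract_id:
  assumes "X \<in> laurent_in T"
  shows "laur_retract T X = to_frac X"
proof -
  have "laur_retract T X = laur_eval coef_emb X var_frac"
    unfolding laur_retract_def using assms by (rule laur_eval_cong) simp
  thus ?thesis by (simp add: laur_eval_var_frac)
qed

lemma laur_retract_in: "X \<in> laurent_in S \<Longrightarrow> laur_retract T X \<in> laurent_frac (S \<inter> T)"
  unfolding laur_retract_def
  by (rule laur_eval_in_subring[OF _ is_subring_laurent_frac])
     (auto simp: coef_emb_in var_frac_in inverse_var_frac_in subring_1 is_subring_laurent_frac)

text \<open>Retracting the cofactor to the variables \<open>S\<close> fixes \<open>a\<close> and
  \<open>b\<close>, so the retracted cofactor again witnesses the divisibility.\<close>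

lemma rel_dvd_laurent_frac_restrict:
  assumes ST: "S \<subseteq> T" and a: "a \<in> laurent_frac S" and b: "b \<in> laurent_frac S"
  shows "rel_dvd (laurent_frac T) a b \<longleftrightarrow> rel_dvd (laurent_frac S) a b"
proof
  assume "rel_dvd (laurent_frac T) a b"
  then obtain c where c: "c \<in> laurent_frac T" "b = a * c" by (auto simp: rel_dvd_def)
  obtain A B C where *: "A \<in> laurent_in S" "a = to_frac A" "B \<in> laurent_in S" "b = to_frac B"
    "C \<in> laurent_in T" "c = to_frac C" using a b c unfolding laurent_frac_def by blast
  have "B = A * C" using c(2) * by (simp flip: hom_mult[OF is_hom_to_frac])
  hence "laur_retract S B = laur_retract S A * laur_retract S C" by (simp add: hom_mult[OF is_hom_laur_retract])
  hence "b = a * laur_retract S C" using * by (simp add: laur_retract_id)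
  moreover have "laur_retract S C \<in> laurent_frac S"
    using laur_retract_in[OF *(5), of S] laurent_frac_mono[of "T \<inter> S" S] by blast
  ultimately show "rel_dvd (laurent_frac S) a b" by (auto simp: rel_dvd_def)
next
  assume "rel_dvd (laurent_frac S) a b"
  thus "rel_dvd (laurent_frac T) a b" using laurent_frac_mono[OF ST] by (auto simp: rel_dvd_def)
qed

lemma rel_unit_iff_dvd: "is_subring S \<Longrightarrow> rel_unit S a \<longleftrightarrow> a \<in> S \<and> rel_dvd S a 1"
  by (auto simp: rel_unit_def rel_dvd_def)

lemma rel_unit_laurent_frac_restrict:
  "S \<subseteq> T \<Longrightarrow> a \<in> laurent_frac S \<Longrightarrow> rel_unit (laurent_frac T) a \<longleftrightarrow> rel_unit (laurent_frac S) a"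
  using rel_dvd_laurent_frac_restrict[of S T a 1] laurent_frac_mono[of S T]
  by (auto simp: rel_unit_iff_dvd is_subring_laurent_frac subring_1)

lemmas inj_on_to_frac = inj_on_subset[OF inj_to_frac subset_UNIV]

lemma rel_prime_laurent_frac_iff:
  "X \<in> laurent_in T \<Longrightarrow> rel_prime (laurent_frac T) (to_frac X) \<longleftrightarrow> rel_prime (laurent_in T) X"
  unfolding laurent_frac_def
  by (rule rel_prime_image[OF is_hom_to_frac inj_on_to_frac is_subring_laurent_in])

lemma rel_irred_laurent_frac_iff:
  "X \<in> laurent_in T \<Longrightarrow> rel_irred (laurent_frac T) (to_frac X) \<longleftrightarrow> rel_irred (laurent_in T) X"
  unfolding laurent_frac_def
  by (rule rel_irred_image[OF is_hom_to_frac inj_on_to_frac is_subring_laurent_in])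

lemma rel_prime_laurent_frac_mono:
  assumes "rel_prime (laurent_frac S) a" "S \<subseteq> T"
  shows "rel_prime (laurent_frac T) a"
proof -
  obtain X where X: "X \<in> laurent_in S" "a = to_frac X"
    using rel_prime_in[OF assms(1)] unfolding laurent_frac_def by blast
  thus ?thesis
    using assms rel_prime_laurent_in_mono[of S X T] laurent_in_mono[OF assms(2)]
    by (auto simp: rel_prime_laurent_frac_iff)
qed

lemma rel_prime_laurent_frac_restrict:
  assumes "rel_prime (laurent_frac T) a" "S \<subseteq> T" "a \<in> laurent_frac S"
  shows "rel_prime (laurent_frac S) a"
  unfolding rel_prime_def
proof (intro conjI ballI impI)
  fix x y assume xy: "x \<in> laurent_frac S" "y \<in> laurent_frac S" "rel_dvd (laurent_frac S) a (x * y)"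
  have "rel_dvd (laurent_frac T) a (x * y)"
    using xy laurent_frac_mono[OF assms(2)] by (auto simp: rel_dvd_def)
  hence "rel_dvd (laurent_frac T) a x \<or> rel_dvd (laurent_frac T) a y"
    using rel_prime_dvd_multD[OF assms(1)] xy laurent_frac_mono[OF assms(2)] by blast
  thus "rel_dvd (laurent_frac S) a x \<or> rel_dvd (laurent_frac S) a y"
    using rel_dvd_laurent_frac_restrict[OF assms(2,3)] xy by blast
qed (use assms in \<open>auto simp: rel_prime_def\<close>)

text \<open>Irreducibility descends to the finitely many variables occurring in \<open>a\<close>,
  where factorisation into primes is available; primality then ascends to all of
  \<open>T\<close>.\<close>

lemma laurent_frac_irred_imp_prime:
  fixes a :: "('x::linorder, 'r::{factorial_semiring, idom}) laurent_fract"
  assumes a: "rel_irred (laurent_frac T) a"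
  shows "rel_prime (laurent_frac T) a"
proof -
  obtain X where X: "X \<in> laurent_in T" "a = to_frac X"
    using a unfolding rel_irred_def laurent_frac_def by blast
  let ?S = "laur_vars X"
  have ST: "?S \<subseteq> T" using X by (simp add: laurent_in_iff)
  have aS: "a \<in> laurent_frac ?S" using X by (auto simp: laurent_frac_def laurent_in_iff)
  have "rel_irred (laurent_frac ?S) a"
    unfolding rel_irred_def
  proof (intro conjI ballI impI)
    fix x y assume xy: "x \<in> laurent_frac ?S" "y \<in> laurent_frac ?S" "a = x * y"
    hence "rel_unit (laurent_frac T) x \<or> rel_unit (laurent_frac T) y"
      using a laurent_frac_mono[OF ST] unfolding rel_irred_def by blast
    thus "rel_unit (laurent_frac ?S) x \<or> rel_unit (laurent_frac ?S) y"
      using rel_unit_laurent_frac_restrict[OF ST] xy by blast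
  qed (use a aS in \<open>auto simp: rel_irred_def\<close>)
  moreover have "rel_factorial (laurent_frac ?S :: ('x, 'r) laurent_fract set)"
    unfolding laurent_frac_def
    by (intro rel_factorial_image is_hom_to_frac inj_on_to_frac is_subring_laurent_in
        rel_factorial_laurent_in finite_laur_vars)
  ultimately have "rel_prime (laurent_frac ?S) a" by (rule rel_factorial_irred_imp_prime[rotated])
  thus ?thesis using ST by (rule rel_prime_laurent_frac_mono)
qed

section \<open>Homomorphisms of the function field\<close>

text \<open>For a homomorphism \<open>g\<close> from a Laurent polynomial ring to a field, \<open>frac_rel g\<close> is its partial
  extension to the local ring at the kernel of \<open>g\<close>.\<close>
definition frac_rel ::
  "(('x::linorder, 'r::idom) laurent \<Rightarrow> 'f::field) \<Rightarrow> ('x, 'r) laurent_fract \<Rightarrow> 'f \<Rightarrow> bool" where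
  "frac_rel g f z \<longleftrightarrow> (\<exists>a b. g b \<noteq> 0 \<and> f = to_frac a / to_frac b \<and> z = g a / g b)"

context
  fixes g :: "('x::linorder, 'r::idom) laurent \<Rightarrow> 'f::field"
  assumes g: "is_hom g"
begin

lemma frac_rel_unique:
  assumes "frac_rel g f z" "frac_rel g f z'"
  shows "z = z'"
proof -
  obtain a b a' b' where *: "g b \<noteq> 0" "f = to_frac a / to_frac b" "z = g a / g b"
    "g b' \<noteq> 0" "f = to_frac a' / to_frac b'" "z' = g a' / g b'"
    using assms unfolding frac_rel_def by blast
  have "b \<noteq> 0" "b' \<noteq> 0" using * hom_0[OF g] by auto
  hence "to_frac (a * b') = to_frac (a' * b)"
    using *(2,5) unfolding hom_mult[OF is_hom_to_frac] by (simp add: frac_eq_eq)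
  hence "g (a * b') = g (a' * b)" by simp
  thus ?thesis using * unfolding hom_mult[OF g] by (simp add: frac_eq_eq)
qed

lemma frac_rel_to_frac: "frac_rel g (to_frac X) (g X)"
  unfolding frac_rel_def
  by (intro exI[of _ X] exI[of _ 1]) (simp add: hom_1[OF g] hom_1[OF is_hom_to_frac])

lemma frac_rel_add:
  assumes "frac_rel g f z" "frac_rel g f' z'"
  shows "frac_rel g (f + f') (z + z')"
proof -
  obtain a b a' b' where *: "g b \<noteq> 0" "f = to_frac a / to_frac b" "z = g a / g b"
    "g b' \<noteq> 0" "f' = to_frac a' / to_frac b'" "z' = g a' / g b'"
    using assms unfolding frac_rel_def by blast
  have "b \<noteq> 0" "b' \<noteq> 0" using * hom_0[OF g] by auto
  hence "f + f' = to_frac (a * b' + a' * b) / to_frac (b * b')"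
    unfolding * hom_mult[OF is_hom_to_frac] hom_add[OF is_hom_to_frac] by (simp add: add_frac_eq)
  moreover have "z + z' = g (a * b' + a' * b) / g (b * b')"
    using *(1,4) unfolding *(3,6) hom_mult[OF g] hom_add[OF g] by (simp add: add_frac_eq)
  moreover have "g (b * b') \<noteq> 0" using * unfolding hom_mult[OF g] by simp
  ultimately show ?thesis unfolding frac_rel_def by blast
qed

lemma frac_rel_mult:
  assumes "frac_rel g f z" "frac_rel g f' z'"
  shows "frac_rel g (f * f') (z * z')"
proof -
  obtain a b a' b' where *: "g b \<noteq> 0" "f = to_frac a / to_frac b" "z = g a / g b"
    "g b' \<noteq> 0" "f' = to_frac a' / to_frac b'" "z' = g a' / g b'"
    using assms unfolding frac_rel_def by blast
  have "f * f' = to_frac (a * a') / to_frac (b * b')" "z * z' = g (a * a') / g (b * b')"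
    unfolding * hom_mult[OF is_hom_to_frac] hom_mult[OF g] by simp_all
  moreover have "g (b * b') \<noteq> 0" using * unfolding hom_mult[OF g] by simp
  ultimately show ?thesis unfolding frac_rel_def by blast
qed

lemma frac_rel_inverse:
  assumes "frac_rel g f z" "z \<noteq> 0"
  shows "frac_rel g (inverse f) (inverse z)"
proof -
  obtain a b where *: "g b \<noteq> 0" "f = to_frac a / to_frac b" "z = g a / g b"
    using assms unfolding frac_rel_def by blast
  hence "g a \<noteq> 0" using assms by auto
  thus ?thesis unfolding frac_rel_def using * by (intro exI[of _ b] exI[of _ a]) simp
qed

lemma frac_rel_1: "frac_rel g 1 1"
  using frac_rel_to_frac[of 1] by (simp add: hom_1[OF g] hom_1[OF is_hom_to_frac])

lemma frac_rel_power: "frac_rel g f z \<Longrightarrow> frac_rel g (f ^ n) (z ^ n)"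
  by (induction n) (auto intro: frac_rel_1 frac_rel_mult)

lemma frac_rel_powi: "frac_rel g f z \<Longrightarrow> z \<noteq> 0 \<Longrightarrow> frac_rel g (f powi k) (z powi k)"
  by (auto simp: power_int_def intro: frac_rel_power frac_rel_inverse)

lemma frac_rel_prod:
  "(\<And>i. i \<in> I \<Longrightarrow> frac_rel g (f i) (z i)) \<Longrightarrow> frac_rel g (prod f I) (prod z I)"
  by (induction I rule: infinite_finite_induct) (auto intro: frac_rel_1 frac_rel_mult)

lemma frac_rel_sum:
  "(\<And>i. i \<in> I \<Longrightarrow> frac_rel g (f i) (z i)) \<Longrightarrow> frac_rel g (sum f I) (sum z I)"
  using frac_rel_to_frac[of 0]
  by (induction I rule: infinite_finite_induct)
     (auto intro: frac_rel_add simp: hom_0[OF g] hom_0[OF is_hom_to_frac])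

text \<open>The negative exponents in \<open>P\<close> are the reason for requiring
  \<open>z i \<noteq> 0\<close>: a specialisation commutes with \<open>P\<close> as long as no
  inserted value is specialised to zero.\<close>

lemma frac_rel_laur_eval:
  assumes P: "P \<in> laurent_in T" and const: "\<And>c. g (laur_const c) = emb c"
    and y: "\<And>i. i \<in> T \<Longrightarrow> frac_rel g (y i) (z i)" "\<And>i. i \<in> T \<Longrightarrow> z i \<noteq> 0"
  shows "frac_rel g (laur_eval coef_emb P y) (laur_eval emb P z)"
  unfolding laur_eval_def
proof (intro frac_rel_sum frac_rel_mult frac_rel_prod frac_rel_powi)
  fix m i assume "m \<in> pkeys P" "i \<in> pkeys m"
  hence "i \<in> T" using P by (auto simp: laurent_in_def)
  thus "frac_rel g (y i) (z i)" "z i \<noteq> 0" using y by auto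
qed (use frac_rel_to_frac[of "laur_const _"] in \<open>auto simp: coef_emb_def const\<close>)

lemma frac_rel_total: "(\<And>X. g X = 0 \<Longrightarrow> X = 0) \<Longrightarrow> \<exists>z. frac_rel g f z"
  using fract_to_frac[of f] unfolding frac_rel_def by blast

end

lemma frac_rel_field_hom:
  assumes E: "is_hom (E :: _ \<Rightarrow> 'f::field)" and "frac_rel (\<lambda>X. E (to_frac X)) f z"
  shows "E f = z"
  using assms(2) unfolding frac_rel_def
  by (auto simp: divide_inverse hom_mult[OF E] hom_inverse[OF E])

lemma ex_field_hom_extending:
  assumes g: "is_hom (g :: ('x::linorder, 'r::idom) laurent \<Rightarrow> 'f::field)"
    and inj: "\<And>X. g X = 0 \<Longrightarrow> X = 0"
  shows "\<exists>E. is_hom E \<and> (\<forall>X. E (to_frac X) = g X)"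
proof -
  define E where "E f = (THE z. frac_rel g f z)" for f
  have E: "frac_rel g f z \<longleftrightarrow> E f = z" for f z
    unfolding E_def using frac_rel_unique[OF g] frac_rel_total[OF g inj] by (metis the_equality)
  have "is_hom E"
    unfolding is_hom_def using frac_rel_1[OF g] frac_rel_add[OF g] frac_rel_mult[OF g] E by metis
  thus ?thesis using E frac_rel_to_frac[OF g] by blast
qed

lemma field_hom_eqI:
  fixes E E' :: "('x::linorder, 'r::idom) laurent_fract \<Rightarrow> 'f::field"
  assumes E: "is_hom E" and E': "is_hom E'"
    and const: "\<And>c. E (coef_emb c) = E' (coef_emb c)"
    and var: "\<And>x. E (var_frac x) = E' (var_frac x)"
  shows "E f = E' f"
proof -
  have poly: "E (to_frac X) = E' (to_frac X)" for X
  proof -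
    have "to_frac X \<in> laurent_frac UNIV" by (auto simp: laurent_frac_def laurent_in_def)
    thus ?thesis
      by (induction rule: laurent_frac_induct)
        (simp_all add: const var hom_add[OF E] hom_add[OF E'] hom_mult[OF E] hom_mult[OF E']
          hom_inverse[OF E] hom_inverse[OF E'])
  qed
  obtain a b where "f = to_frac a / to_frac b" using fract_to_frac by blast
  thus ?thesis
    by (simp add: divide_inverse hom_mult[OF E] hom_mult[OF E'] hom_inverse[OF E] hom_inverse[OF E'] poly)
qed

text \<open>If a substitution \<open>x \<mapsto> Y x\<close> has a left inverse, then it is injective: after clearing a
  monomial, every Laurent polynomial can be recovered from its image.\<close>
lemma ex_field_hom_subst:
  fixes Y :: "'x::linorder \<Rightarrow> ('y::linorder, 'r::idom) laurent"
  assumes y: "\<And>x. y x = to_frac (Y x)" "\<And>x. y x \<noteq> 0"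
    and y': "\<And>i. y' i \<noteq> 0" and inv: "\<And>x. laur_eval coef_emb (Y x) y' = var_frac x"
  shows "\<exists>E. is_hom E \<and> (\<forall>c. E (coef_emb c) = coef_emb c) \<and> (\<forall>x. E (var_frac x) = y x)"
proof -
  define g where "g X = laur_eval coef_emb X y" for X :: "('x, 'r) laurent"
  define g' where "g' X = laur_eval coef_emb X y'" for X :: "('y, 'r) laurent"
  have g: "is_hom g" unfolding g_def by (rule is_hom_laur_eval[OF is_hom_coef_emb y(2)])
  have g': "is_hom g'" unfolding g'_def by (rule is_hom_laur_eval[OF is_hom_coef_emb y'])
  have g_const: "g (laur_const c) = coef_emb c" for c
    unfolding g_def by (rule laur_eval_const[OF is_hom_coef_emb])
  have g_var: "g (laur_var x) = y x" for x
    unfolding g_def by (rule laur_eval_var[OF is_hom_coef_emb])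
  \<comment> \<open>\<open>P\<close> consists of the elements whose image under the substitution is
    itself a Laurent polynomial \<open>Z\<close> from which they can be recovered. It contains
    constants and variables and is closed under sums and products.\<close>
  define P where "P = {W. \<exists>Z. g W = to_frac Z \<and> g' Z = to_frac W}"
  have P_const: "laur_const c \<in> P" for c
    unfolding P_def g'_def
    by (intro CollectI exI[of _ "laur_const c"]) (simp add: g_const laur_eval_const[OF is_hom_coef_emb] coef_emb_def)
  have P_var: "laur_var x \<in> P" for x
    unfolding P_def
    by (intro CollectI exI[of _ "Y x"]) (simp add: g_var y inv g'_def var_frac_def)
  have P_add: "U + W \<in> P" if "U \<in> P" "W \<in> P" for U W
  proof -
    obtain Z Z' where "g U = to_frac Z" "g' Z = to_frac U" "g W = to_frac Z'" "g' Z' = to_frac W"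
      using \<open>U \<in> P\<close> \<open>W \<in> P\<close> unfolding P_def by blast
    thus ?thesis unfolding P_def
      by (intro CollectI exI[of _ "Z + Z'"]) (simp add: hom_add[OF g] hom_add[OF g'] hom_add[OF is_hom_to_frac])
  qed
  have P_mult: "U * W \<in> P" if "U \<in> P" "W \<in> P" for U W
  proof -
    obtain Z Z' where "g U = to_frac Z" "g' Z = to_frac U" "g W = to_frac Z'" "g' Z' = to_frac W"
      using \<open>U \<in> P\<close> \<open>W \<in> P\<close> unfolding P_def by blast
    thus ?thesis unfolding P_def
      by (intro CollectI exI[of _ "Z * Z'"]) (simp add: hom_mult[OF g] hom_mult[OF g'] hom_mult[OF is_hom_to_frac])
  qed
  have P_1: "1 \<in> P" using P_const[of 1] by (simp add: hom_1[OF is_hom_laur_const])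
  \<comment> \<open>The inverse of a variable may have an image that is no Laurent polynomial, so
    every \<open>X\<close> is first multiplied into \<open>P\<close> by a product \<open>M\<close>
    of variables.\<close>
  have clear: "\<exists>M. M \<in> P \<and> M \<noteq> 0 \<and> X * M \<in> P" for X
  proof -
    have "X \<in> laurent_in UNIV" by (simp add: laurent_in_def)
    thus ?thesis
    proof (induction rule: laurent_in_induct)
      case (const c)
      show ?case using P_1 P_const by (intro exI[of _ 1]) simp
    next
      case (var x)
      show ?case using P_1 P_var by (intro exI[of _ 1]) simp
    next
      case (inv x)
      have "laur_var_inv x * laur_var x = (1 :: ('x, 'r) laurent)"
        using laur_var_mult_inv[of x] by (simp add: mult.commute)
      thus ?case using P_1 P_var by (intro exI[of _ "laur_var x"]) (simp add: laur_var_nonzero)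
    next
      case (add X Y)
      then obtain M M' where *: "M \<in> P" "M \<noteq> 0" "X * M \<in> P" "M' \<in> P" "M' \<noteq> 0" "Y * M' \<in> P" by blast
      have "(X + Y) * (M * M') = (X * M) * M' + (Y * M') * M" by (simp add: algebra_simps)
      also have "\<dots> \<in> P" by (rule P_add[OF P_mult[OF *(3,4)] P_mult[OF *(6,1)]])
      finally show ?case using * P_mult by (intro exI[of _ "M * M'"]) simp
    next
      case (mult X Y)
      then obtain M M' where *: "M \<in> P" "M \<noteq> 0" "X * M \<in> P" "M' \<in> P" "M' \<noteq> 0" "Y * M' \<in> P" by blast
      have "(X * Y) * (M * M') = (X * M) * (Y * M')" by (simp add: algebra_simps)
      also have "\<dots> \<in> P" by (rule P_mult[OF *(3,6)])
      finally show ?case using * P_mult by (intro exI[of _ "M * M'"]) simp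
    qed
  qed
  have "X = 0" if "g X = 0" for X
  proof -
    obtain M where M: "M \<in> P" "M \<noteq> 0" "X * M \<in> P" using clear by blast
    then obtain Z where Z: "g (X * M) = to_frac Z" "g' Z = to_frac (X * M)" unfolding P_def by blast
    have "g (X * M) = 0" using that by (simp only: hom_mult[OF g]) simp
    hence "Z = 0" using Z by simp
    thus ?thesis using Z(2) M by (simp add: hom_0[OF g'])
  qed
  then obtain E where "is_hom E" "\<forall>X. E (to_frac X) = g X"
    using ex_field_hom_extending[OF g] by blast
  thus ?thesis using g_const g_var by (auto simp: coef_emb_def var_frac_def)
qed

lemma ex_field_hom_rename:
  assumes "inj \<gamma>"
  shows "\<exists>E :: ('x::linorder, 'r::idom) laurent_fract \<Rightarrow> ('y::linorder, 'r) laurent_fract.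
    is_hom E \<and> (\<forall>c. E (coef_emb c) = coef_emb c) \<and> (\<forall>x. E (var_frac x) = var_frac (\<gamma> x))"
proof (rule ex_field_hom_subst)
  show "var_frac (\<gamma> x) = to_frac (laur_var (\<gamma> x))" for x by (simp add: var_frac_def)
  \<comment> \<open>The left inverse renames back on the range of \<open>\<gamma>\<close>; the value
    1 elsewhere serves only to be nonzero.\<close>
  show "(if i \<in> range \<gamma> then var_frac (inv \<gamma> i) else 1) \<noteq> (0 :: ('x, 'r) laurent_fract)" for i
    by (simp add: var_frac_nonzero)
  show "laur_eval coef_emb (laur_var (\<gamma> x)) (\<lambda>i. if i \<in> range \<gamma> then var_frac (inv \<gamma> i) else 1)
    = (var_frac x :: ('x, 'r) laurent_fract)" for x
    using assms by (simp add: laur_eval_var[OF is_hom_coef_emb])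
qed (rule var_frac_nonzero)

section \<open>Light-cone regular domains and solutions\<close>

lemma nsc_0: "nsc 0 x = 0" by (simp add: nsc_def)

lemma nsc_Suc: "nsc (Suc n) x = x + nsc n x" by (simp add: nsc_def)

lemma nsc_add: "nsc (m + n) x = nsc m x + nsc n x"
  by (induction m) (auto simp: nsc_0 nsc_Suc add.assoc)

lemma light_cone_regularD:
  assumes "light_cone_regular v N H"
  shows "H \<noteq> {}" "h \<in> H \<Longrightarrow> finite {h'\<in>H. cle v N h' h}" "h \<in> H \<Longrightarrow> cle v N h h' \<Longrightarrow> h' \<in> H"
  using assms unfolding light_cone_regular_def by blast+

lemma init_bd_subset: "init_bd v N H \<subseteq> H"
  by (auto simp: init_bd_def)

locale solvable_equation =
  fixes v :: "nat \<Rightarrow> 'l::{ab_group_add,linorder}"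
    and N :: nat
    and Phi Psi :: "(nat, 'r::{factorial_semiring,idom}) laurent"
  assumes N_pos: "0 < N"
    and distinct: "inj_on v {..<N}"
    and generate: "\<forall>x. \<exists>a::nat \<Rightarrow> int. x = (\<Sum>i<N. zsc (a i) (v i))"
    and pos_indep: "\<forall>a::nat \<Rightarrow> nat. (\<Sum>i<N. nsc (a i) (v i)) = 0 \<longrightarrow> (\<forall>i<N. a i = 0)"
    and Phi_vars: "Phi \<in> laurent_in {..<N}"
    and Phi_irred: "rel_irred (laurent_in {..<N}) Phi"
    and Phi_not_monomial: "\<not> (\<exists>m c. Phi = Poly_Mapping.single m c)"
    and vN_min: "cle v N (v (N - 1)) 0 \<and> (\<forall>i<N. cle v N (v (N - 1)) (v i))"
    and Psi_vars: "Psi \<in> laurent_in {..<N}"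
    and Psi_irred: "rel_irred (laurent_in {..<N}) Psi"
    and solve1: "gen_eval Phi ((\<lambda>i. Yv (i + 1))(N - 1 := gen_eval Psi ((\<lambda>i. Yv (i + 1))(N - 1 := Yv 0)))) = Yv 0"
    and solve2: "gen_eval Psi ((\<lambda>i. Yv (i + 1))(N - 1 := gen_eval Phi (\<lambda>i. Yv (i + 1)))) = Yv N"
begin

abbreviation le (infix "\<preceq>" 50) where "x \<preceq> y \<equiv> cle v N x y"
abbreviation w where "w \<equiv> v (N - 1)"
abbreviation lcr where "lcr \<equiv> light_cone_regular v N"
abbreviation bd where "bd \<equiv> init_bd v N"
abbreviation LR :: "'l set \<Rightarrow> ('l, 'r) laurent_fract set" where "LR H \<equiv> laurent_frac (bd H)"
abbreviation S :: "'l set \<Rightarrow> 'l \<Rightarrow> ('l, 'r) laurent_fract" where "S \<equiv> sol v N Phi"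
abbreviation Phi_at :: "('l \<Rightarrow> ('l, 'r) laurent_fract) \<Rightarrow> 'l \<Rightarrow> ('l, 'r) laurent_fract" where
  "Phi_at z h \<equiv> laur_eval coef_emb Phi (\<lambda>i. z (h + v i))"

section \<open>The order defined by the cone\<close>

lemma cone_0: "0 \<in> cone v N"
  unfolding cone_def by (intro CollectI exI[of _ "\<lambda>_. 0"]) (simp add: nsc_0)

lemma cone_add:
  assumes "x \<in> cone v N" "y \<in> cone v N"
  shows "x + y \<in> cone v N"
proof -
  obtain a b where "x = (\<Sum>i<N. nsc (a i) (v i))" "y = (\<Sum>i<N. nsc (b i) (v i))"
    using assms unfolding cone_def by blast
  thus ?thesis unfolding cone_def
    by (intro CollectI exI[of _ "\<lambda>i. a i + b i"]) (simp add: nsc_add sum.distrib)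
qed

lemma cone_v: "i < N \<Longrightarrow> v i \<in> cone v N"
  unfolding cone_def
proof (intro CollectI exI[of _ "\<lambda>j. if j = i then 1 else 0"])
  assume "i < N"
  have "(\<Sum>j<N. nsc (if j = i then 1 else 0) (v j)) = (\<Sum>j<N. if j = i then v j else 0)"
    by (intro sum.cong) (auto simp: nsc_0 nsc_Suc)
  thus "v i = (\<Sum>j<N. nsc (if j = i then 1 else 0) (v j))" using \<open>i < N\<close> by simp
qed

lemma nsc_in_cone: "x \<in> cone v N \<Longrightarrow> nsc k x \<in> cone v N"
  by (induction k) (simp_all add: nsc_0 nsc_Suc cone_0 cone_add)

lemma cone_antisym:
  assumes "x \<in> cone v N" "- x \<in> cone v N"
  shows "x = 0"
proof -
  obtain a b where a: "x = (\<Sum>i<N. nsc (a i) (v i))" and b: "- x = (\<Sum>i<N. nsc (b i) (v i))"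
    using assms unfolding cone_def by blast
  have "(\<Sum>i<N. nsc (a i + b i) (v i)) = x + - x"
    unfolding b unfolding a by (simp add: nsc_add sum.distrib)
  hence "\<forall>i<N. a i + b i = 0" using pos_indep[rule_format, of "\<lambda>i. a i + b i"] by simp
  thus ?thesis unfolding a by (simp add: nsc_0)
qed

lemma le_refl: "x \<preceq> x" by (simp add: cle_def cone_0)

lemma le_trans: "x \<preceq> y \<Longrightarrow> y \<preceq> z \<Longrightarrow> x \<preceq> z"
  using cone_add[of "x - y" "y - z"] by (simp add: cle_def)

lemma le_antisym: "x \<preceq> y \<Longrightarrow> y \<preceq> x \<Longrightarrow> x = y"
  using cone_antisym[of "x - y"] by (simp add: cle_def)

lemma le_shift: "x + z \<preceq> y + z \<longleftrightarrow> x \<preceq> y" by (simp add: cle_def)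

lemma v_nonzero: "i < N \<Longrightarrow> v i \<noteq> 0"
proof
  assume i: "i < N" "v i = 0"
  have "(\<Sum>j<N. nsc (if j = i then 1 else 0) (v j)) = 0"
    using i by (intro sum.neutral) (auto simp: nsc_0 nsc_Suc)
  thus False using pos_indep[rule_format, of "\<lambda>j. if j = i then 1 else 0" i] i by simp
qed

lemma add_v_le: "i < N \<Longrightarrow> h + v i \<preceq> h" by (simp add: cle_def cone_v)

lemma w_index: "N - 1 < N" using N_pos by simp

lemma w_le_v: "i < N \<Longrightarrow> w \<preceq> v i" using vN_min by blast

lemma w_le_0: "w \<preceq> 0" using vN_min by blast

lemma add_w_le_add_v: "i < N \<Longrightarrow> h + w \<preceq> h + v i"
  using w_le_v le_shift[of w h "v i"] by (simp add: add.commute)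

text \<open>In an integer combination of the generators, a positive multiple of \<open>v i\<close>
  lies above the same multiple of \<open>w\<close>, and a negative multiple lies above 0.
  Consequently finite sets have lower bounds, which is what allows a translated domain to cover any
  finite set.\<close>

lemma ex_nsc_w_le: "\<exists>n. nsc n w \<preceq> x"
proof -
  obtain a :: "nat \<Rightarrow> int" where a: "x = (\<Sum>i<N. zsc (a i) (v i))" using generate by blast
  have one: "\<exists>n. nsc n w \<preceq> zsc (a i) (v i)" if i: "i < N" for i
  proof (cases "a i \<ge> 0")
    case True
    have "nsc k w \<preceq> nsc k (v i)" for k
    proof (induction k)
      case (Suc k)
      have "nsc (Suc k) w - nsc (Suc k) (v i) = (w - v i) + (nsc k w - nsc k (v i))"
        by (simp add: nsc_Suc)
      thus ?case using Suc cone_add w_le_v[OF i] unfolding cle_def by presburger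
    qed (simp add: nsc_0 le_refl)
    thus ?thesis using True by (auto simp: zsc_def)
  next
    case False
    thus ?thesis using False nsc_in_cone[OF cone_v[OF i]] by (intro exI[of _ 0]) (simp add: zsc_def nsc_0 cle_def)
  qed
  have "\<exists>n. nsc n w \<preceq> (\<Sum>i\<in>I. zsc (a i) (v i))" if "I \<subseteq> {..<N}" for I
    using finite_subset[OF that finite_lessThan] that
  proof (induction I rule: finite_induct)
    case empty
    show ?case by (intro exI[of _ 0]) (simp add: nsc_0 le_refl)
  next
    case (insert i I)
    then obtain n m where nm: "nsc n w \<preceq> (\<Sum>i\<in>I. zsc (a i) (v i))" "nsc m w \<preceq> zsc (a i) (v i)"
      using one[of i] by auto
    have "nsc (m + n) w - (\<Sum>i\<in>insert i I. zsc (a i) (v i))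
      = (nsc m w - zsc (a i) (v i)) + (nsc n w - (\<Sum>i\<in>I. zsc (a i) (v i)))"
      using insert by (simp add: nsc_add)
    thus ?case using nm cone_add unfolding cle_def by metis
  qed
  thus ?thesis unfolding a by blast
qed

lemma ex_lower_bound: "finite Q \<Longrightarrow> \<exists>z. \<forall>x\<in>Q. z \<preceq> x"
proof -
  note nsc_w = nsc_in_cone[OF cone_v[OF w_index]]
  assume "finite Q"
  hence "\<exists>n. \<forall>x\<in>Q. nsc n w \<preceq> x"
  proof (induction Q rule: finite_induct)
    case (insert x Q)
    then obtain n m where nm: "\<forall>x\<in>Q. nsc n w \<preceq> x" "nsc m w \<preceq> x"
      using ex_nsc_w_le by blast
    have "nsc (m + n) w \<preceq> nsc m w" "nsc (m + n) w \<preceq> nsc n w"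
      unfolding cle_def nsc_add using nsc_w by simp_all
    thus ?case using nm le_trans by blast
  qed simp
  thus ?thesis by blast
qed

section \<open>Recursion along the order and uniqueness of solutions\<close>

lemma lcr_induct [consumes 2, case_names less]:
  assumes H: "lcr H" and "h \<in> H"
    and step: "\<And>h. h \<in> H \<Longrightarrow> (\<And>h'. h' \<in> H \<Longrightarrow> h' \<preceq> h \<Longrightarrow> h' \<noteq> h \<Longrightarrow> P h') \<Longrightarrow> P h"
  shows "P h"
  using \<open>h \<in> H\<close>
proof (induction "card {h'\<in>H. h' \<preceq> h}" arbitrary: h rule: less_induct)
  case less
  show ?case
  proof (rule step[OF \<open>h \<in> H\<close>])
    fix h' assume h': "h' \<in> H" "h' \<preceq> h" "h' \<noteq> h"
    have "{k\<in>H. k \<preceq> h'} \<subset> {k\<in>H. k \<preceq> h}"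
      using h' less.prems le_trans le_antisym le_refl by blast
    hence "card {k\<in>H. k \<preceq> h'} < card {k\<in>H. k \<preceq> h}"
      using light_cone_regularD(2)[OF H less.prems] by (rule psubset_card_mono[rotated])
    thus "P h'" using less.hyps h' by blast
  qed
qed

lemma wf_step_rel:
  assumes H: "lcr H"
  shows "wf (step_rel v N H)"
proof (rule wf_subset[OF wf_measure[of "\<lambda>h. card {h'\<in>H. h' \<preceq> h}"]])
  show "step_rel v N H \<subseteq> measure (\<lambda>h. card {h'\<in>H. h' \<preceq> h})"
  proof
    fix p assume "p \<in> step_rel v N H"
    then obtain h i where p: "p = (h + v i, h)" and h: "h \<in> H" "h \<notin> bd H" "i < N"
      unfolding step_rel_def by blast
    have "\<not> h \<preceq> h + v i"
      using add_v_le[OF h(3), of h] v_nonzero[OF h(3)] le_antisym by fastforce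
    hence "{k\<in>H. k \<preceq> h + v i} \<subset> {k\<in>H. k \<preceq> h}"
      using h add_v_le[OF h(3), of h] le_trans le_refl by blast
    hence "card {k\<in>H. k \<preceq> h + v i} < card {k\<in>H. k \<preceq> h}"
      using light_cone_regularD(2)[OF H h(1)] by (rule psubset_card_mono[rotated])
    thus "p \<in> measure (\<lambda>h. card {h'\<in>H. h' \<preceq> h})" using p by simp
  qed
qed

lemma S_init: "lcr H \<Longrightarrow> h \<in> bd H \<Longrightarrow> S H h = var_frac h"
  unfolding sol_def by (subst wfrec[OF wf_step_rel]) (auto simp: var_frac_def)

lemma S_rec:
  assumes H: "lcr H" and h: "h \<in> H" "h \<notin> bd H"
  shows "S H h = Phi_at (S H) h"
proof -
  have cut: "cut g (step_rel v N H) h (h + v i) = g (h + v i)" if "i < N" for g :: "'l \<Rightarrow> ('l, 'r) laurent_fract" and i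
    using h that by (intro cut_apply) (auto simp: step_rel_def)
  show ?thesis
    unfolding sol_def
    by (subst wfrec[OF wf_step_rel[OF H]])
       (use h in \<open>auto intro!: laur_eval_cong[OF Phi_vars] simp: cut\<close>)
qed

lemma add_v_in: "h \<in> H \<Longrightarrow> h \<notin> bd H \<Longrightarrow> i < N \<Longrightarrow> h + v i \<in> H"
  by (auto simp: init_bd_def)

text \<open>Uniqueness of solutions under specialisation: if \<open>z\<close> satisfies the
  recursion on a part \<open>Q\<close> that contains all arguments of its noninitial points, then
  \<open>g\<close> carries the solution to \<open>z\<close> as soon as it does so on the initial
  variables in \<open>Q\<close>. The map \<open>g\<close> may have a kernel, so the conclusion is
  phrased with \<open>frac_rel\<close>; nonvanishing of \<open>z\<close> keeps every inversion
  legitimate.\<close>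

lemma S_transport:
  assumes H: "lcr H" and Q: "Q \<subseteq> H"
    and closed: "\<And>h i. h \<in> Q \<Longrightarrow> h \<notin> bd H \<Longrightarrow> i < N \<Longrightarrow> h + v i \<in> Q"
    and g: "is_hom g" "\<And>c. g (laur_const c) = coef_emb c"
    and init: "\<And>h. h \<in> Q \<Longrightarrow> h \<in> bd H \<Longrightarrow> g (laur_var h) = z h"
    and nonzero: "\<And>h. h \<in> Q \<Longrightarrow> z h \<noteq> 0"
    and rec: "\<And>h. h \<in> Q \<Longrightarrow> h \<notin> bd H \<Longrightarrow> z h = Phi_at z h"
    and h: "h \<in> Q"
  shows "frac_rel g (S H h) (z h)"
proof -
  have "h \<in> H" using h Q by blast
  with H have "h \<in> Q \<longrightarrow> frac_rel g (S H h) (z h)"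
  proof (induction rule: lcr_induct)
    case (less h)
    show ?case
    proof
      assume hQ: "h \<in> Q"
      show "frac_rel g (S H h) (z h)"
      proof (cases "h \<in> bd H")
        case True
        have "frac_rel g (to_frac (laur_var h)) (g (laur_var h))" by (rule frac_rel_to_frac[OF g(1)])
        thus ?thesis using init[OF hQ True] S_init[OF H True] by (simp add: var_frac_def)
      next
        case False
        have IH: "frac_rel g (S H (h + v i)) (z (h + v i))" if "i < N" for i
          using less.IH[of "h + v i"] closed[OF hQ False that] Q add_v_le[OF that] v_nonzero[OF that] by auto
        show ?thesis
          unfolding S_rec[OF H less.hyps False] rec[OF hQ False]
          by (rule frac_rel_laur_eval[OF g(1) Phi_vars g(2)])
             (use IH nonzero closed[OF hQ False] in auto)
      qed
    qed
  qed
  thus ?thesis using h by blast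
qed

lemma S_hom_transport:
  assumes "lcr H" "Q \<subseteq> H" "\<And>h i. h \<in> Q \<Longrightarrow> h \<notin> bd H \<Longrightarrow> i < N \<Longrightarrow> h + v i \<in> Q"
    and E: "is_hom E" "\<And>c. E (coef_emb c) = coef_emb c"
    and "\<And>h. h \<in> Q \<Longrightarrow> h \<in> bd H \<Longrightarrow> E (var_frac h) = z h"
    and "\<And>h. h \<in> Q \<Longrightarrow> z h \<noteq> 0"
    and "\<And>h. h \<in> Q \<Longrightarrow> h \<notin> bd H \<Longrightarrow> z h = Phi_at z h"
    and "h \<in> Q"
  shows "E (S H h) = z h"
proof (rule frac_rel_field_hom[OF E(1)], rule S_transport)
  show "is_hom (\<lambda>X. E (to_frac X))" by (rule hom_comp[OF E(1) is_hom_to_frac])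
qed (use assms in \<open>auto simp: coef_emb_def var_frac_def\<close>)

definition good :: "'l set \<Rightarrow> bool" where
  "good H \<longleftrightarrow> laurent_property v N Phi H \<and> irreducibility v N Phi H \<and> coprimeness v N Phi H"

lemma good_iff: "good H \<longleftrightarrow>
    (\<forall>h\<in>H. S H h \<in> LR H \<and> rel_irred (LR H) (S H h)) \<and>
    (\<forall>h1\<in>H. \<forall>h2\<in>H. h1 \<noteq> h2 \<longrightarrow> rel_coprime (LR H) (S H h1) (S H h2))"
  unfolding good_def laurent_property_def irreducibility_def coprimeness_def RH0_def laurent_frac_def
  by blast

lemma good_nonzero: "good H \<Longrightarrow> h \<in> H \<Longrightarrow> S H h \<noteq> 0"
  unfolding good_iff rel_irred_def by blast

end

section \<open>Units of Laurent polynomial rings and substitution of units\<close>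

lemma add_eq_add_imp_eq:
  fixes a b :: "'a::linordered_ab_group_add"
  shows "a \<le> k \<Longrightarrow> b \<le> l \<Longrightarrow> a + b = k + l \<Longrightarrow> a = k \<and> b = l"
  using add_less_le_mono[of a k b l] add_le_less_mono[of a k b l]
  by (auto simp: order.order_iff_strict)

lemma single_of_keys:
  assumes "pkeys X = {k}"
  shows "\<exists>k d. d \<noteq> 0 \<and> X = psingle k d"
proof (intro exI conjI)
  show "plookup X k \<noteq> 0" using assms by (simp flip: in_keys_iff)
  show "X = psingle k (plookup X k)"
    by (rule poly_mapping_eqI) (use assms in \<open>auto simp: lookup_single when_def simp flip: not_in_keys_iff_lookup_eq_zero\<close>)
qed

text \<open>Exponent vectors are linearly ordered compatibly with addition, so the products of the
  two largest and of the two smallest terms do not cancel in \<open>X * Y\<close>. As the product is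
  1, both have exponent 0, hence the largest and the smallest exponent of \<open>X\<close>
  coincide.\<close>

lemma rel_unit_laurent_in_single:
  fixes X :: "('x::linorder, 'r::idom) laurent"
  assumes "rel_unit (laurent_in T) X"
  shows "\<exists>k d. d \<noteq> 0 \<and> X = psingle k d"
proof -
  obtain Y where Y: "X * Y = 1" using assms by (auto simp: rel_unit_def)
  have ne: "pkeys X \<noteq> {}" "pkeys Y \<noteq> {}" using Y by auto
  have extreme: "plookup (X * Y) (k + l) = plookup X k * plookup Y l"
    if kl: "\<And>a b. a \<in> pkeys X \<Longrightarrow> b \<in> pkeys Y \<Longrightarrow> a + b = k + l \<Longrightarrow> a = k \<and> b = l"
      "k \<in> pkeys X" "l \<in> pkeys Y" for k l
  proof -
    have "X * Y = (\<Sum>a\<in>pkeys X. psingle a (plookup X a)) * (\<Sum>b\<in>pkeys Y. psingle b (plookup Y b))"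
      using poly_mapping_expand by metis
    also have "\<dots> = (\<Sum>(a, b)\<in>pkeys X \<times> pkeys Y. psingle (a + b) (plookup X a * plookup Y b))"
      by (simp add: sum_product mult_single sum.cartesian_product)
    finally have "plookup (X * Y) (k + l)
      = (\<Sum>(a, b)\<in>pkeys X \<times> pkeys Y. if a + b = k + l then plookup X a * plookup Y b else 0)"
      by (auto simp: lookup_sum lookup_single when_def split_def intro!: sum.cong)
    also have "\<dots> = (\<Sum>x\<in>pkeys X \<times> pkeys Y. if x = (k, l) then plookup X k * plookup Y l else 0)"
    proof (intro sum.cong refl)
      fix x assume x: "x \<in> pkeys X \<times> pkeys Y"
      show "(case x of (a, b) \<Rightarrow> if a + b = k + l then plookup X a * plookup Y b else 0)
        = (if x = (k, l) then plookup X k * plookup Y l else 0)"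
        using kl(1)[of "fst x" "snd x"] x by (auto simp: split_def prod_eq_iff)
    qed
    finally show ?thesis using kl(2,3) by simp
  qed
  have zero: "k + l = 0"
    if kl: "\<And>a b. a \<in> pkeys X \<Longrightarrow> b \<in> pkeys Y \<Longrightarrow> a + b = k + l \<Longrightarrow> a = k \<and> b = l"
      "k \<in> pkeys X" "l \<in> pkeys Y" for k l
  proof -
    have "plookup X k * plookup Y l \<noteq> 0" using kl(2,3) unfolding in_keys_iff by simp
    hence "plookup (X * Y) (k + l) \<noteq> 0" by (subst extreme[OF kl])
    thus ?thesis unfolding Y lookup_one when_def by presburger
  qed
  let ?k = "Max (pkeys X)" and ?l = "Max (pkeys Y)" and ?k' = "Min (pkeys X)" and ?l' = "Min (pkeys Y)"
  have "?k + ?l = 0"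
  proof (rule zero)
    fix a b assume "a \<in> pkeys X" "b \<in> pkeys Y" "a + b = ?k + ?l"
    moreover have "a \<le> ?k" "b \<le> ?l" using calculation by auto
    ultimately show "a = ?k \<and> b = ?l" by (intro add_eq_add_imp_eq)
  qed (use ne in auto)
  moreover have "?k' + ?l' = 0"
  proof (rule zero)
    fix a b assume "a \<in> pkeys X" "b \<in> pkeys Y" "a + b = ?k' + ?l'"
    moreover have "?k' \<le> a" "?l' \<le> b" using calculation by auto
    ultimately show "a = ?k' \<and> b = ?l'" using add_eq_add_imp_eq[of ?k' a ?l' b] by simp
  qed (use ne in auto)
  moreover have "?k' \<le> ?k" "?l' \<le> ?l" using ne by auto
  ultimately have "?k' = ?k" using add_eq_add_imp_eq[of ?k' ?k ?l' ?l] by simp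
  hence "a = ?k" if "a \<in> pkeys X" for a
    using that Max_ge[of "pkeys X" a] Min_le[of "pkeys X" a] by (metis antisym finite_keys)
  hence "pkeys X = {?k}" using ne by blast
  thus ?thesis by (rule single_of_keys)
qed

lemma rel_unit_laurent_frac_single:
  assumes "rel_unit (laurent_frac T) f"
  shows "\<exists>k d. d \<noteq> 0 \<and> f = to_frac (psingle k d)"
proof -
  obtain X where X: "X \<in> laurent_in T" "f = to_frac X"
    using rel_unit_in[OF assms] by (auto simp: laurent_frac_def)
  have "rel_unit (laurent_in T) X"
    using assms X rel_unit_image[OF is_hom_to_frac inj_on_to_frac is_subring_laurent_in X(1)]
    by (simp add: laurent_frac_def)
  thus ?thesis using rel_unit_laurent_in_single X(2) by blast
qed

lemma rel_unit_prod: "is_subring S \<Longrightarrow> (\<And>i. i \<in> I \<Longrightarrow> rel_unit S (f i)) \<Longrightarrow> rel_unit S (prod f I)"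
  by (induction I rule: infinite_finite_induct) (auto intro: rel_unit_1 rel_unit_mult)

lemma rel_unit_power: "is_subring S \<Longrightarrow> rel_unit S a \<Longrightarrow> rel_unit S (a ^ n)"
  by (induction n) (auto intro: rel_unit_1 rel_unit_mult)

lemma rel_unit_inverse: "rel_unit S (a :: 'a::field) \<Longrightarrow> rel_unit S (inverse a)"
  unfolding rel_unit_def by (metis inverse_unique mult.commute)

lemma rel_unit_powi: "is_subring S \<Longrightarrow> rel_unit S (a :: 'a::field) \<Longrightarrow> rel_unit S (a powi k)"
  by (auto simp: power_int_def intro: rel_unit_power rel_unit_inverse)

text \<open>Units are monomials, so every monomial of \<open>P\<close> is mapped to a single term.
  Two of these with the same exponent would be proportional, against injectivity of the field
  homomorphism \<open>G\<close>. Hence nothing cancels, and an image with one term comes from a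
  \<open>P\<close> with at most one term.\<close>

lemma laur_eval_units_monomial:
  fixes G :: "('x::linorder, 'r::idom) laurent_fract \<Rightarrow> ('y::linorder, 'r) laurent_fract"
  assumes G: "is_hom G" "\<And>c. G (coef_emb c) = coef_emb c"
    and P: "P \<in> laurent_in A" and units: "\<And>i. i \<in> A \<Longrightarrow> rel_unit (laurent_frac T) (G (var_frac i))"
    and unit: "rel_unit (laurent_frac T) (G (to_frac P))"
  shows "\<exists>m c. P = psingle m c"
proof -
  define y where "y i = G (var_frac i)" for i
  have G_eval: "G (to_frac Q) = laur_eval coef_emb Q y" for Q
    unfolding laur_eval_var_frac[symmetric] y_def by (rule hom_laur_eval[OF G])
  have "\<exists>k d. d \<noteq> 0 \<and> laur_mon y m = to_frac (psingle k d)" if "m \<in> pkeys P" for m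
    unfolding laur_mon_def
    using P that units
    by (intro rel_unit_laurent_frac_single[of T] rel_unit_prod rel_unit_powi is_subring_laurent_frac)
       (auto simp: laurent_in_def y_def)
  then obtain \<kappa> \<delta> where mon: "\<And>m. m \<in> pkeys P \<Longrightarrow> \<delta> m \<noteq> 0 \<and> laur_mon y m = to_frac (psingle (\<kappa> m) (\<delta> m))"
    by metis
  have inj: "m = n" if m: "m \<in> pkeys P" and n: "n \<in> pkeys P" and eq: "\<kappa> m = \<kappa> n" for m n
  proof -
    have "G (to_frac (psingle m (\<delta> n))) = G (to_frac (psingle n (\<delta> m)))"
      unfolding G_eval laur_eval_single[OF is_hom_coef_emb] coef_emb_def
      by (simp add: mon[OF m] mon[OF n] eq laur_const_def mult_single mult.commute
          flip: hom_mult[OF is_hom_to_frac])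
    hence "psingle m (\<delta> n) = psingle n (\<delta> m)"
      using hom_field_inj[OF G(1)] by (simp add: inj_eq)
    thus ?thesis using mon[OF n] by (metis lookup_single_eq lookup_single_not_eq)
  qed
  obtain k d where kd: "G (to_frac P) = to_frac (psingle k d)"
    using rel_unit_laurent_frac_single[OF unit] by blast
  have "G (to_frac P) = (\<Sum>m\<in>pkeys P. to_frac (psingle (\<kappa> m) (plookup P m * \<delta> m)))"
    unfolding G_eval laur_eval_alt coef_emb_def
    by (intro sum.cong refl) (simp add: mon laur_const_def mult_single flip: hom_mult[OF is_hom_to_frac])
  hence sum: "(\<Sum>m\<in>pkeys P. psingle (\<kappa> m) (plookup P m * \<delta> m)) = psingle k d"
    using kd by (simp flip: hom_sum[OF is_hom_to_frac])
  have k: "\<kappa> m = k" if m: "m \<in> pkeys P" for m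
  proof -
    have "plookup (psingle k d) (\<kappa> m) = (\<Sum>n\<in>pkeys P. if n = m then plookup P m * \<delta> m else 0)"
      unfolding sum[symmetric] lookup_sum lookup_single when_def
      using inj m by (intro sum.cong) auto
    also have "\<dots> \<noteq> 0" using m mon[OF m] by (simp add: in_keys_iff)
    finally show ?thesis by (metis lookup_single_not_eq)
  qed
  show ?thesis
  proof (cases "pkeys P = {}")
    case True
    thus ?thesis by (metis keys_eq_empty single_zero)
  next
    case False
    then obtain m where "m \<in> pkeys P" by blast
    hence "pkeys P = {m}" using k inj by blast
    from single_of_keys[OF this] show ?thesis by blast
  qed
qed

lemma hom_image_laurent_frac:
  fixes E :: "('x::linorder, 'r::idom) laurent_fract \<Rightarrow> ('y::linorder, 'r) laurent_fract"
  assumes E: "is_hom E" and const: "\<And>c. E (coef_emb c) = coef_emb c"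
    and var: "\<And>x. x \<in> T \<Longrightarrow> E (var_frac x) = var_frac (\<gamma> x)"
  shows "E ` laurent_frac T = laurent_frac (\<gamma> ` T)"
proof (intro equalityI subsetI)
  note L = is_subring_laurent_frac
  fix f assume "f \<in> E ` laurent_frac T"
  then obtain e where "e \<in> laurent_frac T" "f = E e" by blast
  moreover have "E e \<in> laurent_frac (\<gamma> ` T)"
    using calculation(1)
    by (induction rule: laurent_frac_induct)
       (auto simp: const var hom_inverse[OF E] hom_add[OF E] hom_mult[OF E] subring_add[OF L]
         subring_mult[OF L] coef_emb_in var_frac_in inverse_var_frac_in)
  ultimately show "f \<in> laurent_frac (\<gamma> ` T)" by simp
next
  note L = is_subring_laurent_frac
  fix f :: "('y, 'r) laurent_fract" assume "f \<in> laurent_frac (\<gamma> ` T)"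
  thus "f \<in> E ` laurent_frac T"
  proof (induction rule: laurent_frac_induct)
    case (const c)
    show ?case using \<open>\<And>c. E (coef_emb c) = coef_emb c\<close>[of c] coef_emb_in by (metis imageI)
  next
    case (var y)
    then obtain x where "x \<in> T" "y = \<gamma> x" by blast
    thus ?case using \<open>\<And>x. x \<in> T \<Longrightarrow> E (var_frac x) = var_frac (\<gamma> x)\<close>[of x] var_frac_in[of x T] by (metis imageI)
  next
    case (inv y)
    then obtain x where x: "x \<in> T" "y = \<gamma> x" by blast
    have "E (inverse (var_frac x)) = inverse (var_frac y)"
      using \<open>\<And>x. x \<in> T \<Longrightarrow> E (var_frac x) = var_frac (\<gamma> x)\<close>[of x] x by (simp add: hom_inverse[OF E])
    thus ?case using inverse_var_frac_in[OF x(1)] by (metis imageI)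
  next
    case (add f g)
    then obtain a b where "a \<in> laurent_frac T" "b \<in> laurent_frac T" "f = E a" "g = E b" by blast
    thus ?case using subring_add[OF L, of a T b] hom_add[OF E, of a b] by (metis imageI)
  next
    case (mult f g)
    then obtain a b where "a \<in> laurent_frac T" "b \<in> laurent_frac T" "f = E a" "g = E b" by blast
    thus ?case using subring_mult[OF L, of a T b] hom_mult[OF E, of a b] by (metis imageI)
  qed
qed

text \<open>Turns a numbering of finitely many stencil points into an injection on all of
  \<open>nat\<close>, as required for a renaming homomorphism of the whole function field.\<close>

lemma inj_extend:
  fixes f :: "nat \<Rightarrow> 'b"
  assumes "finite A" "inj_on f A" "infinite (UNIV :: 'b set)"
  shows "\<exists>\<gamma>. inj \<gamma> \<and> (\<forall>k\<in>A. \<gamma> k = f k)"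
proof -
  have "infinite (UNIV - f ` A)" using assms by (simp add: Diff_infinite_finite)
  then obtain h :: "nat \<Rightarrow> 'b" where h: "inj h" "range h \<subseteq> UNIV - f ` A"
    using infinite_countable_subset by blast
  have "inj (\<lambda>k. if k \<in> A then f k else h k)"
  proof (rule injI)
    fix a b assume ab: "(if a \<in> A then f a else h a) = (if b \<in> A then f b else h b)"
    have "h c \<notin> f ` A" for c using h(2) by blast
    hence "a \<in> A \<longleftrightarrow> b \<in> A" using ab by (metis imageI)
    thus "a = b" using ab assms(2) h(1) by (metis inj_onD injD)
  qed
  thus ?thesis by (intro exI[of _ "\<lambda>k. if k \<in> A then f k else h k"]) simp
qed

section \<open>Mutations\<close>

context solvable_equation
begin

text \<open>A lower bound \<open>z\<close> of the whole module would satisfy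
  \<open>z = z + w\<close>, but \<open>w\<close> is nonzero.\<close>

lemma infinite_index: "infinite (UNIV :: 'l set)"
proof
  assume "finite (UNIV :: 'l set)"
  then obtain z where "\<forall>x. z \<preceq> x" using ex_lower_bound[of UNIV] by auto
  hence "z = z + w" using add_v_le[OF w_index, of z] by (intro le_antisym) simp_all
  thus False using v_nonzero[OF w_index] by simp
qed

definition phi_frac :: "'l \<Rightarrow> ('l, 'r) laurent_fract" where
  "phi_frac q = Phi_at var_frac q"

text \<open>The value at \<open>q + w\<close> obtained by solving the equation at \<open>q\<close>
  for its last argument; the last slot of \<open>Psi\<close> therefore receives the centre
  \<open>q\<close>.\<close>

definition psi_frac :: "'l \<Rightarrow> ('l, 'r) laurent_fract" where
  "psi_frac q = laur_eval coef_emb Psi ((\<lambda>i. var_frac (q + v i))(N - 1 := var_frac q))"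

lemma add_v_inj: "i < N \<Longrightarrow> j < N \<Longrightarrow> q + v i = q + v j \<longleftrightarrow> i = j"
  using distinct by (auto simp: inj_on_def)

text \<open>Index 0 stands for the centre and \<open>Suc i\<close> for \<open>q + v i\<close>, the
  numbering used in \<open>solve1\<close> and \<open>solve2\<close>. All these points are distinct,
  so both generic identities can be moved to any \<open>q\<close>.\<close>

lemma ex_stencil_rename:
  "\<exists>E :: (nat, 'r) laurent_fract \<Rightarrow> ('l, 'r) laurent_fract.
    is_hom E \<and> (\<forall>c. E (coef_emb c) = coef_emb c) \<and>
    E (var_frac 0) = var_frac q \<and> (\<forall>i<N. E (var_frac (Suc i)) = var_frac (q + v i))"
proof -
  let ?f = "\<lambda>k. if k = 0 then q else q + v (k - 1)"
  have "inj_on ?f {..N}"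
  proof (rule inj_onI)
    fix a b assume ab: "a \<in> {..N}" "b \<in> {..N}" "?f a = ?f b"
    show "a = b"
      using ab add_v_inj[of "a - 1" "b - 1" q] v_nonzero[of "a - 1"] v_nonzero[of "b - 1"] by (auto split: if_splits)
  qed
  then obtain \<gamma> where \<gamma>: "inj \<gamma>" "\<forall>k\<in>{..N}. \<gamma> k = ?f k"
    using inj_extend[of "{..N}" ?f] infinite_index by blast
  from ex_field_hom_rename[OF \<gamma>(1)] obtain E :: "(nat, 'r) laurent_fract \<Rightarrow> ('l, 'r) laurent_fract"
    where E: "is_hom E" "\<forall>c. E (coef_emb c) = coef_emb c" "\<forall>x. E (var_frac x) = var_frac (\<gamma> x)" by blast
  have "\<gamma> 0 = q" "\<forall>i<N. \<gamma> (Suc i) = q + v i" using \<gamma>(2) by auto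
  thus ?thesis using E by auto
qed

lemma Yv_eq: "Yv i = var_frac i"
  by (simp add: Yv_def var_frac_def)

lemma
  shows phi_psi_frac: "laur_eval coef_emb Phi ((\<lambda>i. var_frac (q + v i))(N - 1 := psi_frac q)) = var_frac q"
    and psi_phi_frac: "laur_eval coef_emb Psi ((\<lambda>i. var_frac (q + v i))(N - 1 := phi_frac q)) = var_frac (q + w)"
proof -
  obtain E :: "(nat, 'r) laurent_fract \<Rightarrow> ('l, 'r) laurent_fract"
    where E: "is_hom E" "\<And>c. E (coef_emb c) = coef_emb c" "E (var_frac 0) = var_frac q"
      "\<And>i. i < N \<Longrightarrow> E (var_frac (Suc i)) = var_frac (q + v i)"
    using ex_stencil_rename[of q] by blast
  note eval = hom_laur_eval[OF E(1), of coef_emb coef_emb, OF E(2)]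
  have upd: "E (((\<lambda>i. Yv (i + 1))(N - 1 := A)) i) = ((\<lambda>i. var_frac (q + v i))(N - 1 := E A)) i"
    if "i \<in> {..<N}" for i A
    using that E(4)[of i] by (simp add: Yv_eq)
  have psi: "E (gen_eval Psi ((\<lambda>i. Yv (i + 1))(N - 1 := Yv 0))) = psi_frac q"
    unfolding gen_eval_def eval psi_frac_def
    by (rule laur_eval_cong[OF Psi_vars]) (auto simp: Yv_eq E)
  have phi: "E (gen_eval Phi (\<lambda>i. Yv (i + 1))) = phi_frac q"
    unfolding gen_eval_def eval phi_frac_def
    by (rule laur_eval_cong[OF Phi_vars]) (auto simp: Yv_eq E)
  have "E (Yv 0) = laur_eval coef_emb Phi
      (\<lambda>i. E (((\<lambda>i. Yv (i + 1))(N - 1 := gen_eval Psi ((\<lambda>i. Yv (i + 1))(N - 1 := Yv 0)))) i))"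
    by (subst solve1[symmetric], subst gen_eval_def[of Phi]) (rule eval)
  also have "\<dots> = laur_eval coef_emb Phi ((\<lambda>i. var_frac (q + v i))(N - 1 := psi_frac q))"
    by (rule laur_eval_cong[OF Phi_vars]) (simp only: upd psi)
  finally show "laur_eval coef_emb Phi ((\<lambda>i. var_frac (q + v i))(N - 1 := psi_frac q)) = var_frac q"
    by (simp add: Yv_eq E)
  have "E (Yv N) = laur_eval coef_emb Psi
      (\<lambda>i. E (((\<lambda>i. Yv (i + 1))(N - 1 := gen_eval Phi (\<lambda>i. Yv (i + 1)))) i))"
    by (subst solve2[symmetric], subst gen_eval_def[of Psi]) (rule eval)
  also have "\<dots> = laur_eval coef_emb Psi ((\<lambda>i. var_frac (q + v i))(N - 1 := phi_frac q))"
    by (rule laur_eval_cong[OF Psi_vars]) (simp only: upd phi)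
  finally show "laur_eval coef_emb Psi ((\<lambda>i. var_frac (q + v i))(N - 1 := phi_frac q)) = var_frac (q + w)"
    using E(4)[OF w_index] N_pos by (simp add: Yv_eq)
qed

lemma phi_frac_nonzero: "phi_frac q \<noteq> 0"
proof -
  obtain E :: "(nat, 'r) laurent_fract \<Rightarrow> ('l, 'r) laurent_fract"
    where E: "is_hom E" "\<And>c. E (coef_emb c) = coef_emb c"
      "\<And>i. i < N \<Longrightarrow> E (var_frac i) = var_frac (q + v i)"
  proof -
    obtain \<gamma> where \<gamma>: "inj \<gamma>" "\<forall>k\<in>{..<N}. \<gamma> k = q + v k"
      using inj_extend[of "{..<N}" "\<lambda>k. q + v k"] infinite_index add_v_inj by (auto simp: inj_on_def)
    thus ?thesis using that ex_field_hom_rename[OF \<gamma>(1), where 'r = 'r] by (metis lessThan_iff)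
  qed
  have "phi_frac q = E (to_frac Phi)"
    unfolding laur_eval_var_frac[symmetric] hom_laur_eval[OF E(1), of coef_emb coef_emb, OF E(2)] phi_frac_def
    by (rule laur_eval_cong[OF Phi_vars]) (simp add: E)
  moreover have "Phi \<noteq> 0" using Phi_irred by (simp add: rel_irred_def)
  ultimately show ?thesis by (simp add: hom_field_eq_0_iff[OF E(1)])
qed

text \<open>\<open>Psi\<close> is irreducible, hence prime; renaming its variables is an isomorphism
  onto a Laurent ring in stencil points, and enlarging that ring to \<open>T\<close> preserves
  primality.\<close>

lemma psi_frac_prime:
  assumes T: "q \<in> T" "\<And>i. i < N \<Longrightarrow> i \<noteq> N - 1 \<Longrightarrow> q + v i \<in> T"
  shows "rel_prime (laurent_frac T) (psi_frac q)"
proof -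
  let ?f = "(\<lambda>i. q + v i)(N - 1 := q)"
  have "inj_on ?f {..<N}"
    using v_nonzero add_v_inj by (auto simp: inj_on_def)
  then obtain \<gamma> where \<gamma>: "inj \<gamma>" "\<forall>k\<in>{..<N}. \<gamma> k = ?f k"
    using inj_extend[of "{..<N}" ?f] infinite_index by blast
  from ex_field_hom_rename[OF \<gamma>(1)] obtain E :: "(nat, 'r) laurent_fract \<Rightarrow> ('l, 'r) laurent_fract"
    where E: "is_hom E" "\<And>c. E (coef_emb c) = coef_emb c" "\<And>x. E (var_frac x) = var_frac (\<gamma> x)" by blast
  have psi: "psi_frac q = E (to_frac Psi)"
    unfolding laur_eval_var_frac[symmetric] hom_laur_eval[OF E(1), of coef_emb coef_emb, OF E(2)] psi_frac_def
    by (rule laur_eval_cong[OF Psi_vars]) (use \<gamma>(2) in \<open>auto simp: E\<close>)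
  have "rel_prime (laurent_frac {..<N}) (to_frac Psi)"
    by (rule laurent_frac_irred_imp_prime)
       (use Psi_irred Psi_vars in \<open>simp add: rel_irred_laurent_frac_iff\<close>)
  hence "rel_prime (E ` laurent_frac {..<N}) (E (to_frac Psi))"
    using rel_prime_image[OF E(1) inj_on_subset[OF hom_field_inj[OF E(1)] subset_UNIV] is_subring_laurent_frac]
      rel_prime_in by blast
  hence "rel_prime (laurent_frac (\<gamma> ` {..<N})) (psi_frac q)"
    unfolding psi using hom_image_laurent_frac[of E "{..<N}" \<gamma>, OF E(1,2,3)] by simp
  moreover have "\<gamma> ` {..<N} \<subseteq> T" using \<gamma>(2) T by auto
  ultimately show ?thesis by (rule rel_prime_laurent_frac_mono)
qed

lemma phi_frac_in: "(\<And>i. i < N \<Longrightarrow> q + v i \<in> T) \<Longrightarrow> phi_frac q \<in> laurent_frac T"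
  unfolding phi_frac_def
  by (rule laur_eval_in_subring[OF Phi_vars is_subring_laurent_frac coef_emb_in])
     (auto intro: var_frac_in inverse_var_frac_in)

text \<open>Exchanging the variables \<open>q + w\<close> and \<open>q\<close> through the equation is an involution of the whole
  function field, because \<open>Phi\<close> and \<open>Psi\<close> are inverse to each other in the last variable.\<close>
lemma ex_mutation:
  "\<exists>\<theta> :: ('l, 'r) laurent_fract \<Rightarrow> ('l, 'r) laurent_fract.
    is_hom \<theta> \<and> (\<forall>c. \<theta> (coef_emb c) = coef_emb c) \<and> (\<forall>f. \<theta> (\<theta> f) = f) \<and>
    \<theta> (var_frac (q + w)) = psi_frac q \<and> \<theta> (var_frac q) = phi_frac q \<and>
    (\<forall>x. x \<noteq> q \<longrightarrow> x \<noteq> q + w \<longrightarrow> \<theta> (var_frac x) = var_frac x)"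
proof -
  let ?p = "q + w"
  have pq: "?p \<noteq> q" using v_nonzero[OF w_index] by simp
  have ne: "q + v i \<noteq> q" "q + v i = ?p \<longleftrightarrow> i = N - 1" if "i < N" for i
    using that v_nonzero add_v_inj[OF that w_index] by auto
  have psi_prime: "rel_prime (laurent_frac UNIV) (psi_frac q)" by (rule psi_frac_prime) auto
  define y where "y x = (if x = ?p then psi_frac q else if x = q then phi_frac q else var_frac x)" for x
  have y_nz: "y x \<noteq> 0" for x
    using rel_prime_nonzero[OF psi_prime] by (simp add: y_def phi_frac_nonzero var_frac_nonzero)
  have y_in: "y x \<in> laurent_frac UNIV" for x
    using rel_prime_in[OF psi_prime] by (simp add: y_def phi_frac_in var_frac_in)
  have "\<forall>x. \<exists>X. y x = to_frac X" using y_in unfolding laurent_frac_def by blast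
  from choice[OF this] obtain Y where Y: "\<And>x. y x = to_frac (Y x)" by blast
  have g: "is_hom (\<lambda>X. laur_eval coef_emb X y)" by (rule is_hom_laur_eval[OF is_hom_coef_emb y_nz])
  \<comment> \<open>Compatibility of successive substitutions. The Laurent polynomials
    \<open>Y x\<close> are known only through their fractions, so the partial extension of the
    second substitution is used to evaluate them.\<close>
  have subst: "laur_eval coef_emb Z y = laur_eval coef_emb P (\<lambda>i. y (\<gamma> i))"
    if Z: "to_frac Z = laur_eval coef_emb P (\<lambda>i. var_frac (\<gamma> i))" and P: "P \<in> laurent_in {..<N}"
    for P :: "(nat, 'r) laurent" and Z \<gamma>
  proof (rule frac_rel_unique[OF g])
    show "frac_rel (\<lambda>X. laur_eval coef_emb X y) (to_frac Z) (laur_eval coef_emb Z y)"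
      by (rule frac_rel_to_frac[OF g])
    show "frac_rel (\<lambda>X. laur_eval coef_emb X y) (to_frac Z) (laur_eval coef_emb P (\<lambda>i. y (\<gamma> i)))"
      unfolding Z
    proof (rule frac_rel_laur_eval[OF g P laur_eval_const[OF is_hom_coef_emb] _ y_nz])
      fix i show "frac_rel (\<lambda>X. laur_eval coef_emb X y) (var_frac (\<gamma> i)) (y (\<gamma> i))"
        using frac_rel_to_frac[OF g, of "laur_var (\<gamma> i)"]
        by (simp add: laur_eval_var[OF is_hom_coef_emb] var_frac_def)
    qed
  qed
  have Psi_y: "laur_eval coef_emb Psi (\<lambda>i. y (((\<lambda>i. q + v i)(N - 1 := q)) i)) = var_frac ?p"
    unfolding psi_phi_frac[of q, symmetric]
    by (rule laur_eval_cong[OF Psi_vars]) (use pq ne in \<open>auto simp: y_def\<close>)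
  have Phi_y: "laur_eval coef_emb Phi (\<lambda>i. y (q + v i)) = var_frac q"
    unfolding phi_psi_frac[of q, symmetric]
    by (rule laur_eval_cong[OF Phi_vars]) (use ne in \<open>auto simp: y_def\<close>)
  have psi_alt: "psi_frac q = laur_eval coef_emb Psi (\<lambda>i. var_frac (((\<lambda>i. q + v i)(N - 1 := q)) i))"
    unfolding psi_frac_def by (rule laur_eval_cong[OF Psi_vars]) auto
  have inv: "laur_eval coef_emb (Y x) y = var_frac x" for x
  proof -
    consider "x = ?p" | "x = q" | "x \<noteq> ?p" "x \<noteq> q" by blast
    thus ?thesis
    proof cases
      case 1
      have "to_frac (Y x) = psi_frac q" using 1 by (simp add: y_def flip: Y)
      from subst[OF this[unfolded psi_alt] Psi_vars] show ?thesis using Psi_y 1 by simp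
    next
      case 2
      have "to_frac (Y x) = phi_frac q" using 2 pq by (simp add: y_def flip: Y)
      from subst[OF this[unfolded phi_frac_def] Phi_vars] show ?thesis using Phi_y 2 by simp
    next
      case 3
      have "to_frac (Y x) = to_frac (laur_var x)" using 3 by (simp add: y_def var_frac_def flip: Y)
      thus ?thesis using 3 by (simp add: laur_eval_var[OF is_hom_coef_emb] y_def)
    qed
  qed
  from ex_field_hom_subst[of y Y y, OF Y y_nz y_nz inv] obtain \<theta>
    where \<theta>: "is_hom \<theta>" "\<And>c. \<theta> (coef_emb c) = coef_emb c" "\<And>x. \<theta> (var_frac x) = y x" by blast
  note eval = hom_laur_eval[OF \<theta>(1), of coef_emb coef_emb, OF \<theta>(2)]
  have "\<theta> (\<theta> f) = f" for f
  proof -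
    have "\<theta> (psi_frac q) = var_frac ?p" unfolding psi_alt eval \<theta>(3) by (rule Psi_y)
    moreover have "\<theta> (phi_frac q) = var_frac q" unfolding phi_frac_def eval \<theta>(3) by (rule Phi_y)
    ultimately have "\<theta> (y x) = var_frac x" for x by (simp add: y_def \<theta>(3))
    hence var: "\<theta> (\<theta> (var_frac x)) = var_frac x" for x by (simp add: \<theta>(3))
    have "is_hom (\<lambda>f :: ('l, 'r) laurent_fract. f)" by (simp add: is_hom_def)
    from field_hom_eqI[OF hom_comp[OF \<theta>(1) \<theta>(1)] this] show ?thesis by (simp add: \<theta>(2) var)
  qed
  thus ?thesis using \<theta> pq by (intro exI[of _ \<theta>]) (auto simp: y_def)
qed

section \<open>Removal of minimal points\<close>

definition minimal_in :: "'l set \<Rightarrow> 'l \<Rightarrow> bool" where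
  "minimal_in H p \<longleftrightarrow> p \<in> H \<and> (\<forall>x\<in>H. x \<preceq> p \<longrightarrow> x = p)"

lemma lcr_up: "lcr H \<Longrightarrow> h \<in> H \<Longrightarrow> h \<preceq> h' \<Longrightarrow> h' \<in> H"
  by (rule light_cone_regularD(3))

lemma lcr_Diff:
  assumes H: "lcr H" and up: "\<And>x y. x \<in> H - D \<Longrightarrow> x \<preceq> y \<Longrightarrow> y \<notin> D" and ne: "H - D \<noteq> {}"
  shows "lcr (H - D)"
  unfolding light_cone_regular_def
proof (intro conjI ballI ne)
  fix h assume h: "h \<in> H - D"
  show "finite {h' \<in> H - D. h' \<preceq> h}"
    using light_cone_regularD(2)[OF H, of h] h by (rule_tac finite_subset[of _ "{h' \<in> H. h' \<preceq> h}"]) auto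
  show "{h'. h \<preceq> h'} \<subseteq> H - D" using up[OF h] lcr_up[OF H] h by blast
qed

context
  fixes H :: "'l set" and p :: 'l
  assumes H: "lcr H" and p: "minimal_in H p"
begin

lemma minimal_notin: "x \<preceq> p \<Longrightarrow> x \<noteq> p \<Longrightarrow> x \<notin> H"
  using p by (auto simp: minimal_in_def)

text \<open>Put \<open>q = p - w\<close>. Since \<open>w\<close> is the least vector, every
  \<open>q + v i\<close> lies above \<open>p\<close> and belongs to \<open>H\<close>. The point
  \<open>q + v i + w = p + v i\<close> lies strictly below the minimal \<open>p\<close>, so
  \<open>q + v i\<close> is initial.\<close>

lemma mutation_stencil: "i < N \<Longrightarrow> p - w + v i \<in> bd H"
proof -
  assume i: "i < N"
  have "p \<preceq> p - w + v i" using add_w_le_add_v[OF i, of "p - w"] by simp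
  hence "p - w + v i \<in> H" using lcr_up[OF H] p by (auto simp: minimal_in_def)
  moreover have "p - w + v i + w \<notin> H"
    using minimal_notin[of "p + v i"] add_v_le[OF i] v_nonzero[OF i] by (simp add: algebra_simps)
  ultimately show ?thesis using w_index by (auto simp: init_bd_def)
qed

lemma minimal_bd: "p \<in> bd H"
  using mutation_stencil[OF w_index] by simp

lemma mutation_new_in: "p - w \<in> H - {p}"
proof -
  have "p \<preceq> p - w" using w_le_0 le_shift[of w "p - w" 0] by (simp add: cle_def)
  thus ?thesis using lcr_up[OF H] p v_nonzero[OF w_index] by (auto simp: minimal_in_def)
qed

lemma mutation_new_notin_bd: "p - w \<notin> bd H"
  using mutation_stencil by (auto simp: init_bd_def)

lemma lcr_remove: "lcr (H - {p})"
proof (rule lcr_Diff[OF H])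
  show "y \<notin> {p}" if "x \<in> H - {p}" "x \<preceq> y" for x y using that minimal_notin by blast
qed (use mutation_new_in in blast)

text \<open>If \<open>p\<close> is the neighbour \<open>h + v i\<close> of \<open>h\<close> for some
  \<open>i\<close> other than \<open>N - 1\<close>, then \<open>h + w\<close> lies strictly below
  \<open>p\<close> and was missing already, so \<open>h\<close> was initial before. Only
  \<open>p - w\<close> becomes initial by the removal.\<close>

lemma bd_remove: "bd (H - {p}) = insert (p - w) (bd H - {p})"
proof (intro equalityI subsetI)
  fix h assume "h \<in> bd (H - {p})"
  then obtain i where h: "h \<in> H" "h \<noteq> p" "i < N" "h + v i \<notin> H - {p}" by (auto simp: init_bd_def)
  show "h \<in> insert (p - w) (bd H - {p})"
  proof (cases "h + v i \<in> H")
    case False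
    thus ?thesis using h by (auto simp: init_bd_def)
  next
    case True
    hence p_eq: "h + v i = p" using h by simp
    show ?thesis
    proof (cases "i = N - 1")
      case True
      thus ?thesis using p_eq by (simp add: algebra_simps)
    next
      case False
      have "h + w \<preceq> p" using add_w_le_add_v[OF h(3)] p_eq by metis
      moreover have "h + w \<noteq> p" using add_v_inj[OF w_index h(3)] p_eq False by metis
      ultimately have "h + w \<notin> H" by (rule minimal_notin)
      thus ?thesis using h w_index by (auto simp: init_bd_def)
    qed
  qed
next
  fix h assume "h \<in> insert (p - w) (bd H - {p})"
  thus "h \<in> bd (H - {p})"
    using mutation_new_in w_index by (auto simp: init_bd_def)
qed

text \<open>Both sides satisfy the recursion on \<open>H - {p}\<close> and agree on its boundary:
  the stencil at \<open>p - w\<close> is initial in \<open>H\<close>, so the value there is exactly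
  \<open>phi_frac (p - w)\<close>, the image of the new initial variable.\<close>

lemma mutation_transport:
  assumes nz: "\<And>h. h \<in> H \<Longrightarrow> S H h \<noteq> 0"
    and \<theta>: "is_hom \<theta>" "\<And>c. \<theta> (coef_emb c) = coef_emb c" "\<theta> (var_frac (p - w)) = phi_frac (p - w)"
      "\<And>x. x \<noteq> p - w \<Longrightarrow> x \<noteq> p \<Longrightarrow> \<theta> (var_frac x) = var_frac x"
    and h: "h \<in> H - {p}"
  shows "\<theta> (S (H - {p}) h) = S H h"
proof (rule S_hom_transport[OF lcr_remove subset_refl _ \<theta>(1,2)])
  show "h + v i \<in> H - {p}" if "h \<in> H - {p}" "h \<notin> bd (H - {p})" "i < N" for h i
    using that by (rule add_v_in)
  show "S H h \<noteq> 0" if "h \<in> H - {p}" for h using nz that by blast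
  show "S H h = Phi_at (S H) h" if "h \<in> H - {p}" "h \<notin> bd (H - {p})" for h
    using that bd_remove by (intro S_rec[OF H]) auto
  show "\<theta> (var_frac h) = S H h" if "h \<in> H - {p}" "h \<in> bd (H - {p})" for h
  proof (cases "h = p - w")
    case True
    have "S H h = Phi_at (S H) (p - w)"
      unfolding True using mutation_new_in mutation_new_notin_bd by (intro S_rec[OF H]) auto
    also have "\<dots> = phi_frac (p - w)"
      unfolding phi_frac_def
      by (rule laur_eval_cong[OF Phi_vars], rule S_init[OF H], rule mutation_stencil) simp
    finally show ?thesis using \<theta>(3) True by simp
  next
    case False
    thus ?thesis using that bd_remove \<theta>(4)[of h] S_init[OF H, of h] by auto
  qed
qed (rule h)

end

text \<open>\<open>D\<close> is closed downwards in \<open>H\<close>. A minimal element of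
  \<open>D\<close> is therefore minimal in \<open>H\<close> too, and after its removal the rest of
  \<open>D\<close> is still closed downwards.\<close>

lemma removal_induct [consumes 3, case_names base step]:
  assumes "lcr H" "finite D" "D \<subseteq> H" and up: "\<And>x y. x \<in> H - D \<Longrightarrow> x \<preceq> y \<Longrightarrow> y \<notin> D"
    and base: "P H" and step: "\<And>H p. lcr H \<Longrightarrow> P H \<Longrightarrow> minimal_in H p \<Longrightarrow> P (H - {p})"
  shows "lcr (H - D) \<and> P (H - D)"
  using assms(2,1,3-5)
proof (induction "card D" arbitrary: H D)
  case 0
  thus ?case by simp
next
  case (Suc n)
  then obtain d where d: "d \<in> D" by fastforce
  have "d \<in> H" using d Suc.prems by blast
  with \<open>lcr H\<close> have "d \<in> D \<longrightarrow> (\<exists>p\<in>D. \<forall>x\<in>D. x \<preceq> p \<longrightarrow> x = p)"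
  proof (induction rule: lcr_induct)
    case (less h)
    thus ?case using \<open>D \<subseteq> H\<close> by blast
  qed
  then obtain p where p: "p \<in> D" "\<And>x. x \<in> D \<Longrightarrow> x \<preceq> p \<Longrightarrow> x = p" using d by blast
  have min: "minimal_in H p"
    unfolding minimal_in_def using p Suc.prems by blast
  have "card (D - {p}) = n" using Suc.hyps(2) p by simp
  moreover have "lcr (H - {p})" "P (H - {p})"
    using lcr_remove[OF _ min] step[OF _ _ min] Suc.prems by auto
  moreover have "y \<notin> D - {p}" if "x \<in> H - {p} - (D - {p})" "x \<preceq> y" for x y
    using that Suc.prems(4)[of x y] by blast
  ultimately have "lcr (H - {p} - (D - {p})) \<and> P (H - {p} - (D - {p}))"
    using Suc.hyps(1)[of "D - {p}" "H - {p}"] Suc.prems by blast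
  moreover have "H - {p} - (D - {p}) = H - D" using p by blast
  ultimately show ?case by simp
qed

section \<open>Nonunit values arbitrarily far up\<close>

text \<open>Suppose all values above \<open>y0\<close> are units. Removing everything strictly below
  a point \<open>u\<close> makes the stencil at \<open>u - w\<close> initial, so its values are
  images of independent variables under a field homomorphism. These images and the value of
  \<open>Phi\<close> at them are units, so \<open>Phi\<close> would be a monomial.\<close>

lemma ex_nonunit:
  assumes Ht: "lcr Ht" and gd: "good Ht"
  shows "\<exists>y. y0 \<preceq> y \<and> y \<in> Ht \<and> \<not> rel_unit (LR Ht) (S Ht y)"
proof (rule ccontr)
  assume neg: "\<not> ?thesis"
  obtain h0 where h0: "h0 \<in> Ht" using light_cone_regularD(1)[OF Ht] by blast
  \<comment> \<open>A lower bound of the negatives becomes an upper bound \<open>u\<close> of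
    \<open>y0\<close> and \<open>h0\<close>; being above \<open>h0\<close> puts \<open>u\<close>
    into \<open>Ht\<close>.\<close>
  obtain z where z: "z \<preceq> - y0" "z \<preceq> - h0" using ex_lower_bound[of "{- y0, - h0}"] by auto
  define u where "u = - z"
  have u: "y0 \<preceq> u" "h0 \<preceq> u" using z by (simp_all add: u_def cle_def add.commute)
  have uH: "u \<in> Ht" using lcr_up[OF Ht h0 u(2)] .
  define D where "D = {x\<in>Ht. x \<preceq> u \<and> x \<noteq> u}"
  \<comment> \<open>Invariant of the removals: a field homomorphism carries the solution on the
    smaller domain back to the one on \<open>Ht\<close>. It also yields nonvanishing on the smaller
    domain, which each mutation requires.\<close>
  let ?ext = "\<lambda>H. H \<subseteq> Ht \<and> (\<exists>\<Theta> :: ('l, 'r) laurent_fract \<Rightarrow> ('l, 'r) laurent_fract. is_hom \<Theta> \<and>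
    (\<forall>c. \<Theta> (coef_emb c) = coef_emb c) \<and> (\<forall>h\<in>H. \<Theta> (S H h) = S Ht h))"
  have fD: "finite D" using light_cone_regularD(2)[OF Ht uH] by (rule finite_subset[rotated]) (auto simp: D_def)
  have subD: "D \<subseteq> Ht" by (auto simp: D_def)
  have upD: "y \<notin> D" if "x \<in> Ht - D" "x \<preceq> y" for x y
    using that le_trans le_antisym unfolding D_def by blast
  have base: "?ext Ht"
    by (intro conjI subset_refl exI[of _ "\<lambda>f. f"]) (simp_all add: is_hom_def)
  have step: "?ext (H - {p})" if HP: "lcr H" "?ext H" "minimal_in H p" for H p
  proof -
    obtain \<Theta> where \<Theta>: "H \<subseteq> Ht" "is_hom \<Theta>" "\<And>c. \<Theta> (coef_emb c) = coef_emb c"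
      "\<And>h. h \<in> H \<Longrightarrow> \<Theta> (S H h) = S Ht h" using HP(2) by blast
    have nz: "S H h \<noteq> 0" if "h \<in> H" for h
      using good_nonzero[OF gd, of h] \<Theta>(1) \<Theta>(4)[OF that] that hom_0[OF \<Theta>(2)] by auto
    obtain \<theta> where \<theta>: "is_hom \<theta>" "\<And>c. \<theta> (coef_emb c) = coef_emb c" "\<theta> (var_frac (p - w)) = phi_frac (p - w)"
      "\<And>x. x \<noteq> p - w \<Longrightarrow> x \<noteq> p \<Longrightarrow> \<theta> (var_frac x) = var_frac x"
      using ex_mutation[of "p - w"] by auto
    have "\<theta> (S (H - {p}) h) = S H h" if "h \<in> H - {p}" for h
      using mutation_transport[OF HP(1,3) nz \<theta> that] .
    thus ?thesis using \<Theta> \<theta> hom_comp[OF \<Theta>(2) \<theta>(1)]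
      by (intro conjI exI[of _ "\<lambda>f. \<Theta> (\<theta> f)"]) auto
  qed
  have "lcr (Ht - D) \<and> ?ext (Ht - D)"
    by (rule removal_induct[where P = ?ext, OF Ht fD subD _ base], erule (1) upD, rule step)
  then obtain \<Theta> :: "('l, 'r) laurent_fract \<Rightarrow> ('l, 'r) laurent_fract"
    where lcr': "lcr (Ht - D)" and \<Theta>: "is_hom \<Theta>" "\<And>c. \<Theta> (coef_emb c) = coef_emb c"
      "\<And>h. h \<in> Ht - D \<Longrightarrow> \<Theta> (S (Ht - D) h) = S Ht h" by blast
  have min: "minimal_in (Ht - D) u" using uH by (auto simp: minimal_in_def D_def)
  let ?q = "u - w"
  note stencil = mutation_stencil[OF lcr' min]
  have q: "?q \<in> Ht - D" "?q \<notin> bd (Ht - D)"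
    using mutation_new_in[OF lcr' min] mutation_new_notin_bd[OF lcr' min] by auto
  have unit: "rel_unit (LR Ht) (S Ht y)" if "u \<preceq> y" for y
    using neg that u lcr_up[OF Ht uH] le_trans by blast
  obtain \<gamma> where \<gamma>: "inj \<gamma>" "\<forall>k\<in>{..<N}. \<gamma> k = ?q + v k"
    using inj_extend[of "{..<N}" "\<lambda>k. ?q + v k"] infinite_index add_v_inj by (auto simp: inj_on_def)
  from ex_field_hom_rename[OF \<gamma>(1)] obtain E :: "(nat, 'r) laurent_fract \<Rightarrow> ('l, 'r) laurent_fract"
    where E: "is_hom E" "\<And>c. E (coef_emb c) = coef_emb c" "\<And>x. E (var_frac x) = var_frac (\<gamma> x)" by blast
  have GE: "\<Theta> (E (var_frac i)) = S Ht (?q + v i)" if i: "i < N" for i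
  proof -
    have "?q + v i \<in> Ht - D" using stencil[OF i] init_bd_subset by blast
    thus ?thesis using \<Theta>(3)[of "?q + v i"] S_init[OF lcr' stencil[OF i]] E(3) \<gamma>(2) i by simp
  qed
  have "\<exists>m c. Phi = psingle m c"
  proof (rule laur_eval_units_monomial[OF hom_comp[OF \<Theta>(1) E(1)] _ Phi_vars])
    show "\<Theta> (E (coef_emb c)) = coef_emb c" for c by (simp add: E \<Theta>)
    fix i assume i: "i \<in> {..<N}"
    have "u \<preceq> ?q + v i" using add_w_le_add_v[of i ?q] i by simp
    thus "rel_unit (LR Ht) (\<Theta> (E (var_frac i)))" using GE i unit by simp
  next
    have "\<Theta> (E (to_frac Phi)) = laur_eval coef_emb Phi (\<lambda>i. \<Theta> (E (var_frac i)))"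
      unfolding laur_eval_var_frac[symmetric]
      by (rule hom_laur_eval[OF hom_comp[OF \<Theta>(1) E(1)]]) (simp add: E \<Theta>)
    also have "\<dots> = Phi_at (S Ht) ?q"
      by (rule laur_eval_cong[OF Phi_vars]) (simp add: GE)
    also have "\<dots> = S Ht ?q"
      using q by (intro S_rec[OF Ht, symmetric]) (auto simp: init_bd_def)
    finally have eq: "\<Theta> (E (to_frac Phi)) = S Ht ?q" .
    have "u \<preceq> ?q" using w_le_0 by (simp add: cle_def)
    thus "rel_unit (LR Ht) (\<Theta> (E (to_frac Phi)))" unfolding eq by (rule unit)
  qed
  thus False using Phi_not_monomial by blast
qed

end

section \<open>Irreducibility and coprimeness under mutations\<close>

lemma divisor_prime_power:
  fixes a :: "'a::idom"
  assumes S: "is_subring S" and \<pi>: "rel_prime S \<pi>"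
  shows "a \<in> S \<Longrightarrow> b \<in> S \<Longrightarrow> a * b = \<pi> ^ n \<Longrightarrow> \<exists>u k. rel_unit S u \<and> a = u * \<pi> ^ k"
proof (induction n arbitrary: a b)
  case 0
  hence "rel_unit S a" by (auto simp: rel_unit_def)
  thus ?case by (intro exI[of _ a] exI[of _ 0]) simp
next
  case (Suc n)
  have "rel_dvd S \<pi> (a * b)"
    unfolding Suc.prems(3) rel_dvd_def using subring_power[OF S rel_prime_in[OF \<pi>]] by (auto intro!: bexI[of _ "\<pi> ^ n"])
  then consider c where "c \<in> S" "a = \<pi> * c" | c where "c \<in> S" "b = \<pi> * c"
    using rel_prime_dvd_multD[OF \<pi>] Suc.prems unfolding rel_dvd_def by blast
  thus ?case
  proof cases
    case (1 c)
    have "\<pi> * (c * b) = \<pi> * \<pi> ^ n" using Suc.prems(3) 1 by (simp add: mult.assoc)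
    hence "c * b = \<pi> ^ n" using rel_prime_nonzero[OF \<pi>] by simp
    then obtain u k where u: "rel_unit S u" "c = u * \<pi> ^ k" using Suc.IH 1 Suc.prems by blast
    have "a = u * \<pi> ^ Suc k" using 1 u by simp
    thus ?thesis using u by blast
  next
    case (2 c)
    have "\<pi> * (a * c) = \<pi> * \<pi> ^ n" using Suc.prems(3) 2 by (simp add: mult.left_commute)
    hence "a * c = \<pi> ^ n" using rel_prime_nonzero[OF \<pi>] by simp
    thus ?thesis using Suc.IH 2 Suc.prems by blast
  qed
qed

section \<open>The local ring at a prime\<close>

definition local_ring :: "'a::field set \<Rightarrow> 'a \<Rightarrow> 'a set" where
  "local_ring S \<pi> = {x. \<exists>g\<in>S. \<not> rel_dvd S \<pi> g \<and> x * g \<in> S}"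

context
  fixes S :: "'a::field set" and \<pi> :: 'a
  assumes S: "is_subring S" and \<pi>: "rel_prime S \<pi>" and nonunit: "\<not> rel_unit S \<pi>"
begin

lemma not_dvd_1: "\<not> rel_dvd S \<pi> 1"
  using rel_dvd_unit[OF S] rel_prime_in[OF \<pi>] nonunit by blast

lemma not_dvd_mult: "a \<in> S \<Longrightarrow> b \<in> S \<Longrightarrow> \<not> rel_dvd S \<pi> a \<Longrightarrow> \<not> rel_dvd S \<pi> b \<Longrightarrow> \<not> rel_dvd S \<pi> (a * b)"
  using rel_prime_dvd_multD[OF \<pi>] by blast

lemma subset_local_ring: "S \<subseteq> local_ring S \<pi>"
  unfolding local_ring_def using not_dvd_1 subring_1[OF S] by force

lemma is_subring_local_ring: "is_subring (local_ring S \<pi>)"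
  unfolding is_subring_def
proof (intro conjI ballI)
  show "1 \<in> local_ring S \<pi>" using subset_local_ring subring_1[OF S] by blast
next
  fix a b assume "a \<in> local_ring S \<pi>" "b \<in> local_ring S \<pi>"
  then obtain g h where *: "g \<in> S" "\<not> rel_dvd S \<pi> g" "a * g \<in> S" "h \<in> S" "\<not> rel_dvd S \<pi> h" "b * h \<in> S"
    unfolding local_ring_def by blast
  have gh: "g * h \<in> S" "\<not> rel_dvd S \<pi> (g * h)" using * not_dvd_mult subring_mult[OF S] by auto
  have "(a + b) * (g * h) = (a * g) * h + (b * h) * g" by (simp add: algebra_simps)
  also have "\<dots> \<in> S" using * S by (auto intro!: subring_add subring_mult[OF S, of "a * g"] subring_mult[OF S, of "b * h"])
  finally show "a + b \<in> local_ring S \<pi>" unfolding local_ring_def using gh by blast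
  have "(a * b) * (g * h) = (a * g) * (b * h)" by (simp add: algebra_simps)
  also have "\<dots> \<in> S" using * subring_mult[OF S, of "a * g"] by blast
  finally show "a * b \<in> local_ring S \<pi>" unfolding local_ring_def using gh by blast
next
  fix a assume "a \<in> local_ring S \<pi>"
  then obtain g where "g \<in> S" "\<not> rel_dvd S \<pi> g" "a * g \<in> S" unfolding local_ring_def by blast
  thus "- a \<in> local_ring S \<pi>" unfolding local_ring_def using subring_uminus[OF S, of "a * g"] by auto
qed

lemma inverse_in_local_ring: "g \<in> S \<Longrightarrow> \<not> rel_dvd S \<pi> g \<Longrightarrow> inverse g \<in> local_ring S \<pi>"
  unfolding local_ring_def using rel_dvd_0[OF S] subring_1[OF S]
  by (cases "g = 0") (auto intro!: bexI[of _ g])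

text \<open>A denominator prime to \<open>\<pi>\<close> and a denominator that is a power of
  \<open>\<pi>\<close> exclude each other: as \<open>\<pi>\<close> does not divide \<open>g\<close>,
  it divides \<open>x * \<pi> ^ Suc n\<close> within \<open>S\<close> and can be cancelled, one
  power at a time.\<close>

lemma local_ring_clear: "x \<in> local_ring S \<pi> \<Longrightarrow> x * \<pi> ^ n \<in> S \<Longrightarrow> x \<in> S"
proof (induction n)
  case (Suc n)
  obtain g where g: "g \<in> S" "\<not> rel_dvd S \<pi> g" "x * g \<in> S" using Suc.prems unfolding local_ring_def by blast
  let ?y = "x * \<pi> ^ n"
  have "?y * \<pi> * g = \<pi> * (\<pi> ^ n * (x * g))" by (simp add: ac_simps)
  moreover have "\<pi> ^ n * (x * g) \<in> S"
    using g subring_power[OF S rel_prime_in[OF \<pi>]] subring_mult[OF S] by blast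
  ultimately have "rel_dvd S \<pi> (?y * \<pi> * g)" unfolding rel_dvd_def by blast
  moreover have yp: "?y * \<pi> \<in> S" using Suc.prems(2) by (simp add: ac_simps)
  ultimately have "rel_dvd S \<pi> (?y * \<pi>)" using rel_prime_dvd_multD[OF \<pi>] g by blast
  then obtain c where "c \<in> S" "?y * \<pi> = \<pi> * c" unfolding rel_dvd_def by blast
  hence "?y \<in> S" using rel_prime_nonzero[OF \<pi>] by (simp add: mult.commute)
  thus ?case using Suc by blast
qed simp

end

text \<open>The coordinate rings before and after a mutation become equal once \<open>q\<close>, respectively \<open>p\<close>, is
  inverted; irreducibility therefore passes from one to the other up to powers of \<open>p\<close>.\<close>
locale mutation_rings =
  fixes R1 R2 :: "'a::field set" and p q :: 'a
  assumes R1: "is_subring R1" and R2: "is_subring R2"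
    and p1: "p \<in> R1" "inverse p \<in> R1" and p2: "rel_prime R2 p"
    and q2: "q \<in> R2" "inverse q \<in> R2" and q1: "rel_prime R1 q"
    and clear12: "\<And>x. x \<in> R1 \<Longrightarrow> \<exists>n. x * p ^ n \<in> R2"
    and clear21: "\<And>x. x \<in> R2 \<Longrightarrow> \<exists>n. x * q ^ n \<in> R1"
begin

lemma p_nonzero: "p \<noteq> 0" using p2 by (rule rel_prime_nonzero)

lemma q_nonzero: "q \<noteq> 0" using q1 by (rule rel_prime_nonzero)

lemma q_unit: "rel_unit R2 q"
  using q2 q_nonzero unfolding rel_unit_def by (auto intro!: bexI[of _ "inverse q"])

text \<open>After multiplication by powers of \<open>p\<close>, the unit and its inverse lie in
  \<open>R2\<close> and their product is a power of the prime \<open>p\<close>, so each is a unit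
  times a power of \<open>p\<close>.\<close>

lemma unit_transfer:
  assumes u: "rel_unit R1 u"
  shows "\<exists>u' d. rel_unit R2 u' \<and> u = u' * p powi d"
proof -
  obtain u1 where u1: "u1 \<in> R1" "u * u1 = 1" using u by (auto simp: rel_unit_def)
  obtain n where n: "u * p ^ n \<in> R2" using clear12 rel_unit_in[OF u] by blast
  obtain m where m: "u1 * p ^ m \<in> R2" using clear12 u1 by blast
  have "(u * p ^ n) * (u1 * p ^ m) = (u * u1) * p ^ (n + m)" by (simp add: power_add ac_simps)
  hence "(u * p ^ n) * (u1 * p ^ m) = p ^ (n + m)" using u1 by simp
  from divisor_prime_power[OF R2 p2 n m this]
  obtain u' k where u': "rel_unit R2 u'" "u * p ^ n = u' * p ^ k" by blast
  have "u = u' * p powi (int k - int n)"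
    using u'(2) p_nonzero by (simp add: power_int_diff field_simps)
  thus ?thesis using u' by blast
qed

text \<open>For a nonunit \<open>p\<close>, a positive exponent \<open>d\<close> would make
  \<open>p\<close> divide \<open>b\<close>; for \<open>d \<le> 0\<close> the element
  \<open>b\<close> divides the unit \<open>u\<close>. If \<open>p\<close> is a unit of
  \<open>R2\<close>, the exponent does not matter.\<close>

lemma p_free_unit:
  assumes b: "b \<in> R2" "b = u * p powi d" "rel_unit R2 u" and free: "rel_unit R2 p \<or> \<not> rel_dvd R2 p b"
  shows "rel_unit R2 b"
proof (cases "rel_unit R2 p")
  case True
  thus ?thesis using b(2,3) by (auto intro: rel_unit_mult rel_unit_powi R2)
next
  case False
  hence nd: "\<not> rel_dvd R2 p b" using free by blast
  have "d \<le> 0"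
  proof (rule ccontr)
    assume "\<not> d \<le> 0"
    then obtain k where "d = int (Suc k)" by (metis not_le_imp_less zero_less_imp_eq_int gr0_conv_Suc)
    hence "b = p * (u * p ^ k)" using b(2) by (simp only: power_int_of_nat) (simp add: ac_simps)
    moreover have "u * p ^ k \<in> R2"
      using rel_unit_in[OF b(3)] rel_prime_in[OF p2] subring_mult[OF R2] subring_power[OF R2] by blast
    ultimately show False using nd unfolding rel_dvd_def by blast
  qed
  then obtain k where k: "d = - int k" by (metis nonpos_int_cases)
  have "b * p ^ k = u" using b(2) p_nonzero unfolding k by (simp add: power_int_minus)
  hence "rel_unit R2 (b * p ^ k)" using b(3) by simp
  thus ?thesis by (rule rel_unit_multD(1)[OF R2 _ b(1) subring_power[OF R2 rel_prime_in[OF p2]]])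
qed

text \<open>Cancelling \<open>x\<close> shows that \<open>b\<close> divides a power of
  \<open>q\<close> once denominators are cleared. As \<open>q\<close> is prime in \<open>R1\<close>,
  \<open>b\<close> is a unit of \<open>R1\<close> times a power of \<open>q\<close>, hence a unit of
  \<open>R2\<close> times a power of \<open>p\<close>; that power is harmless because
  \<open>x\<close> is free of \<open>p\<close>.\<close>

lemma cofactor_unit:
  assumes x: "rel_prime R1 x" "x = a * b" and ab: "a \<in> R2" "b \<in> R2"
    and free: "rel_unit R2 p \<or> \<not> rel_dvd R2 p x" and dvd: "rel_dvd R1 x (a * q ^ i)"
  shows "rel_unit R2 b"
proof -
  obtain e where e: "e \<in> R1" "a * q ^ i = x * e" using dvd by (auto simp: rel_dvd_def)
  have "x * q ^ i = (a * q ^ i) * b" unfolding x(2) by (simp only: ac_simps)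
  hence "x * q ^ i = x * (e * b)" unfolding e(2) by (simp only: ac_simps)
  hence eb: "q ^ i = e * b" using rel_prime_nonzero[OF x(1)] by simp
  obtain j where j: "b * q ^ j \<in> R1" using clear21 ab by blast
  have "(b * q ^ j) * e = q ^ (i + j)" unfolding power_add eb by (simp only: ac_simps)
  from divisor_prime_power[OF R1 q1 j e(1) this]
  obtain u k where u: "rel_unit R1 u" "b * q ^ j = u * q ^ k" by blast
  obtain u' d where u': "rel_unit R2 u'" "u = u' * p powi d" using unit_transfer[OF u(1)] by blast
  have "b = (u' * q powi (int k - int j)) * p powi d"
    using u(2) u'(2) q_nonzero by (simp add: power_int_diff field_simps)
  moreover have "rel_unit R2 (u' * q powi (int k - int j))"
    using u' q_unit by (intro rel_unit_mult rel_unit_powi R2)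
  moreover have "rel_unit R2 p \<or> \<not> rel_dvd R2 p b"
    using free rel_dvd_mult2[OF R2 _ ab(1)] unfolding x(2) by blast
  ultimately show ?thesis using p_free_unit ab by blast
qed

lemma irred_transfer:
  assumes x: "rel_prime R1 x" "x \<in> R2" and free: "rel_unit R2 p \<or> \<not> rel_dvd R2 p x"
  shows "rel_irred R2 x"
  unfolding rel_irred_def
proof (intro conjI ballI impI)
  fix a b assume ab: "a \<in> R2" "b \<in> R2" "x = a * b"
  obtain i j where ij: "a * q ^ i \<in> R1" "b * q ^ j \<in> R1" using clear21 ab by blast
  have "(a * q ^ i) * (b * q ^ j) = x * (q ^ i * q ^ j)" unfolding ab(3) by (simp only: ac_simps)
  moreover have "q ^ i * q ^ j \<in> R1"
    using subring_power[OF R1 rel_prime_in[OF q1]] subring_mult[OF R1] by blast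
  ultimately have "rel_dvd R1 x ((a * q ^ i) * (b * q ^ j))" unfolding rel_dvd_def by blast
  hence "rel_dvd R1 x (a * q ^ i) \<or> rel_dvd R1 x (b * q ^ j)"
    using rel_prime_dvd_multD[OF x(1)] ij by blast
  thus "rel_unit R2 a \<or> rel_unit R2 b"
    using cofactor_unit[OF x(1) ab(3,1,2) free, of i]
      cofactor_unit[OF x(1) _ ab(2,1) free, of j] ab(3) by (auto simp: mult.commute)
qed (use x rel_prime_nonzero in auto)

lemma unit_free_transfer:
  assumes "rel_unit R1 x" "x \<in> R2" "rel_unit R2 p \<or> \<not> rel_dvd R2 p x"
  shows "rel_unit R2 x"
  using unit_transfer[OF assms(1)] p_free_unit[OF assms(2) _ _ assms(3)] by blast

text \<open>A common nonunit divisor is associated with both irreducible elements, so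
  \<open>x = y * c\<close> with a unit \<open>c\<close> of \<open>R2\<close>. In terms of
  \<open>R1\<close>, \<open>c\<close> is a unit times a possibly negative power of \<open>q\<close>,
  so one of \<open>x\<close> and \<open>y\<close> divides the other there. Coprimeness makes that
  divisor a unit of \<open>R1\<close>, and freeness from \<open>p\<close> makes it a unit of
  \<open>R2\<close>.\<close>

lemma coprime_transfer:
  assumes x: "rel_prime R1 x" "x \<in> R2" "rel_unit R2 p \<or> \<not> rel_dvd R2 p x"
    and y: "rel_prime R1 y" "y \<in> R2" "rel_unit R2 p \<or> \<not> rel_dvd R2 p y"
    and cop: "rel_coprime R1 x y"
  shows "rel_coprime R2 x y"
  unfolding rel_coprime_iff
proof (intro conjI ballI impI x(2) y(2))
  fix d assume d: "d \<in> R2" "rel_dvd R2 d x" "rel_dvd R2 d y"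
  then obtain a b where ab: "a \<in> R2" "x = d * a" "b \<in> R2" "y = d * b" unfolding rel_dvd_def by blast
  show "rel_unit R2 d"
  proof (rule ccontr)
    assume nu: "\<not> rel_unit R2 d"
    have a: "rel_unit R2 a" and b: "rel_unit R2 b"
      using irred_transfer[OF x] irred_transfer[OF y] ab d nu unfolding rel_irred_def by blast+
    define c where "c = a * inverse b"
    have c: "rel_unit R2 c" unfolding c_def using a b by (intro rel_unit_mult rel_unit_inverse R2)
    have c0: "c \<noteq> 0" using rel_unit_nonzero[OF c] .
    have xy: "x = y * c" using ab rel_unit_nonzero[OF b] by (simp add: c_def)
    obtain i where i: "c * q ^ i \<in> R1" using clear21 rel_unit_in[OF c] by blast
    obtain j where j: "inverse c * q ^ j \<in> R1" using clear21 rel_unit_in[OF rel_unit_inverse[OF c]] by blast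
    have "(c * q ^ i) * (inverse c * q ^ j) = q ^ (i + j)" using c0 by (simp add: power_add)
    from divisor_prime_power[OF R1 q1 i j this]
    obtain u k where u: "rel_unit R1 u" "c * q ^ i = u * q ^ k" by blast
    obtain u1 where u1: "u1 \<in> R1" "u * u1 = 1" using u(1) by (auto simp: rel_unit_def)
    have qR: "q ^ n \<in> R1" for n using subring_power[OF R1 rel_prime_in[OF q1]] .
    have "rel_unit R1 x \<or> rel_unit R1 y"
    proof (cases "i \<le> k")
      case True
      hence "c * q ^ i = (u * q ^ (k - i)) * q ^ i" using u(2) by (simp flip: power_add)
      hence "c = u * q ^ (k - i)" using q_nonzero by simp
      hence "x = y * (u * q ^ (k - i))" using xy by simp
      moreover have "u * q ^ (k - i) \<in> R1" using subring_mult[OF R1 rel_unit_in[OF u(1)] qR] .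
      ultimately have "rel_dvd R1 y x" unfolding rel_dvd_def by blast
      thus ?thesis using cop rel_dvd_refl[OF R1] unfolding rel_coprime_iff by blast
    next
      case False
      hence "(c * q ^ (i - k)) * q ^ k = u * q ^ k" using u(2) by (simp add: mult.assoc flip: power_add)
      hence cq: "c * q ^ (i - k) = u" using q_nonzero by simp
      have "y = y * (u * u1)" using u1(2) by simp
      also have "\<dots> = x * (q ^ (i - k) * u1)" unfolding cq[symmetric] xy by (simp only: ac_simps)
      finally have "y = x * (q ^ (i - k) * u1)" .
      moreover have "q ^ (i - k) * u1 \<in> R1" using subring_mult[OF R1 qR u1(1)] .
      ultimately have "rel_dvd R1 x y" unfolding rel_dvd_def by blast
      thus ?thesis using cop rel_dvd_refl[OF R1] unfolding rel_coprime_iff by blast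
    qed
    hence "rel_unit R2 x \<or> rel_unit R2 y" using unit_free_transfer x y by blast
    thus False using nu ab d rel_unit_multD(1)[OF R2] by blast
  qed
qed

end

lemma laurent_frac_clear:
  assumes f: "f \<in> laurent_frac T" and E: "is_hom E" and R: "is_subring R" and s: "s \<in> R"
    and const: "\<And>c. E (coef_emb c) \<in> R"
    and var: "\<And>x. x \<in> T \<Longrightarrow> E (var_frac x) \<in> R"
    and inv: "\<And>x. x \<in> T \<Longrightarrow> \<exists>n. E (inverse (var_frac x)) * s ^ n \<in> R"
  shows "\<exists>n. E f * s ^ n \<in> R"
  using f
proof (induction rule: laurent_frac_induct)
  case (const c)
  show ?case using assms(5) by (intro exI[of _ 0]) simp
next
  case (var x)
  thus ?case using assms(6) by (intro exI[of _ 0]) simp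
next
  case (inv x)
  thus ?case using assms(7) by blast
next
  case (add f g)
  then obtain n m where *: "E f * s ^ n \<in> R" "E g * s ^ m \<in> R" by blast
  have "E (f + g) * s ^ (n + m) = (E f * s ^ n) * s ^ m + (E g * s ^ m) * s ^ n"
    by (simp add: hom_add[OF E] algebra_simps power_add)
  also have "\<dots> \<in> R"
    by (rule subring_add[OF R subring_mult[OF R *(1) subring_power[OF R s]]
          subring_mult[OF R *(2) subring_power[OF R s]]])
  finally show ?case by blast
next
  case (mult f g)
  then obtain n m where *: "E f * s ^ n \<in> R" "E g * s ^ m \<in> R" by blast
  have "E (f * g) * s ^ (n + m) = (E f * s ^ n) * (E g * s ^ m)"
    by (simp add: hom_mult[OF E] algebra_simps power_add)
  also have "\<dots> \<in> R" by (rule subring_mult[OF R *])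
  finally show ?case by blast
qed

context solvable_equation
begin

lemma good_in: "good H \<Longrightarrow> h \<in> H \<Longrightarrow> S H h \<in> LR H"
  unfolding good_iff by blast

lemma good_prime: "good H \<Longrightarrow> h \<in> H \<Longrightarrow> rel_prime (LR H) (S H h)"
  unfolding good_iff by (blast intro: laurent_frac_irred_imp_prime)

lemma good_coprime:
  "good H \<Longrightarrow> h1 \<in> H \<Longrightarrow> h2 \<in> H \<Longrightarrow> h1 \<noteq> h2 \<Longrightarrow> rel_coprime (LR H) (S H h1) (S H h2)"
  unfolding good_iff by blast

section \<open>Translates of a good domain\<close>

lemma good_translate:
  fixes t :: 'l
  defines "sh \<equiv> \<lambda>x. x + t"
  assumes H: "lcr H" and gd: "good H"
  shows "lcr (sh ` H)" "good (sh ` H)"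
    and "h \<in> H \<Longrightarrow> rel_unit (LR (sh ` H)) (S (sh ` H) (sh h)) \<longleftrightarrow> rel_unit (LR H) (S H h)"
proof -
  have inj: "inj sh" unfolding sh_def by (rule injI) simp
  have mem: "x \<in> sh ` H \<longleftrightarrow> x - t \<in> H" for x
    unfolding sh_def by (metis (no_types, lifting) add_diff_cancel_right' diff_add_cancel image_iff)
  have mem_v: "x + v i \<in> sh ` H \<longleftrightarrow> x - t + v i \<in> H" for x i unfolding mem by (simp add: algebra_simps)
  have bd_mem: "x \<in> bd (sh ` H) \<longleftrightarrow> x - t \<in> bd H" for x
    unfolding init_bd_def mem_Collect_eq mem_v unfolding mem by (rule refl)
  have bd_eq: "bd (sh ` H) = sh ` bd H"
  proof (intro equalityI subsetI)
    fix x assume "x \<in> bd (sh ` H)"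
    hence "x - t \<in> bd H" unfolding bd_mem .
    moreover have "x = sh (x - t)" by (simp add: sh_def)
    ultimately show "x \<in> sh ` bd H" by blast
  next
    fix x assume "x \<in> sh ` bd H"
    then obtain h where "h \<in> bd H" "x - t = h" by (auto simp: sh_def)
    thus "x \<in> bd (sh ` H)" unfolding bd_mem by simp
  qed
  have le_sh: "sh x \<preceq> sh y \<longleftrightarrow> x \<preceq> y" for x y unfolding sh_def by (rule le_shift)
  show lcr': "lcr (sh ` H)"
    unfolding light_cone_regular_def
  proof (intro conjI ballI)
    show "sh ` H \<noteq> {}" using light_cone_regularD(1)[OF H] by simp
    fix k assume "k \<in> sh ` H"
    then obtain h where h: "h \<in> H" "k = sh h" by blast
    have "{h' \<in> sh ` H. h' \<preceq> k} = sh ` {h' \<in> H. h' \<preceq> h}" using le_sh h by auto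
    thus "finite {h' \<in> sh ` H. h' \<preceq> k}" using light_cone_regularD(2)[OF H h(1)] by simp
    show "{h'. k \<preceq> h'} \<subseteq> sh ` H"
    proof
      fix x assume "x \<in> {h'. k \<preceq> h'}"
      hence "h \<preceq> x - t" unfolding h(2) sh_def using le_shift[of h t "x - t"] by simp
      thus "x \<in> sh ` H" unfolding mem using lcr_up[OF H h(1)] by blast
    qed
  qed
  from ex_field_hom_rename[OF inj] obtain E :: "('l, 'r) laurent_fract \<Rightarrow> ('l, 'r) laurent_fract"
    where E: "is_hom E" "\<And>c. E (coef_emb c) = coef_emb c" "\<And>x. E (var_frac x) = var_frac (sh x)" by blast
  define z where "z x = E (S H (x - t))" for x
  have "(\<lambda>f. f) (S (sh ` H) x) = z x" if "x \<in> sh ` H" for x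
  proof (rule S_hom_transport[OF lcr' subset_refl])
    show "is_hom (\<lambda>f :: ('l, 'r) laurent_fract. f)" by (simp add: is_hom_def)
    show "h + v i \<in> sh ` H" if "h \<in> sh ` H" "h \<notin> bd (sh ` H)" "i < N" for h i using add_v_in that by blast
    show "var_frac h = z h" if "h \<in> bd (sh ` H)" for h
      using that unfolding bd_mem z_def by (simp add: S_init[OF H] E sh_def)
    show "z h \<noteq> 0" if "h \<in> sh ` H" for h
      using good_nonzero[OF gd] that unfolding mem z_def hom_field_eq_0_iff[OF E(1)] by blast
    show "z h = Phi_at z h" if "h \<in> sh ` H" "h \<notin> bd (sh ` H)" for h
    proof -
      have "z h = E (Phi_at (S H) (h - t))"
        unfolding z_def using that S_rec[OF H] unfolding mem bd_mem by simp
      also have "\<dots> = laur_eval coef_emb Phi (\<lambda>i. E (S H (h - t + v i)))"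
        by (rule hom_laur_eval[OF E(1,2)])
      also have "\<dots> = Phi_at z h" unfolding z_def by (simp add: algebra_simps)
      finally show ?thesis .
    qed
  qed (use that in auto)
  hence S_eq: "S (sh ` H) (sh h) = E (S H h)" if "h \<in> H" for h
    using that by (simp add: z_def sh_def)
  have R_eq: "LR (sh ` H) = E ` LR H"
    unfolding bd_eq by (rule hom_image_laurent_frac[OF E, symmetric])
  note im = E(1) inj_on_subset[OF hom_field_inj[OF E(1)] subset_UNIV] is_subring_laurent_frac
  show "h \<in> H \<Longrightarrow> rel_unit (LR (sh ` H)) (S (sh ` H) (sh h)) \<longleftrightarrow> rel_unit (LR H) (S H h)"
    unfolding R_eq by (simp only: S_eq rel_unit_image[OF im good_in[OF gd]])
  show "good (sh ` H)"
    unfolding good_iff R_eq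
  proof (intro conjI ballI impI)
    fix k assume "k \<in> sh ` H"
    then obtain h where h: "h \<in> H" "k = sh h" by blast
    show "S (sh ` H) k \<in> E ` LR H"
      unfolding h(2) S_eq[OF h(1)] using good_in[OF gd h(1)] by blast
    show "rel_irred (E ` LR H) (S (sh ` H) k)"
      unfolding h(2) S_eq[OF h(1)] rel_irred_image[OF im good_in[OF gd h(1)]]
      using gd h(1) unfolding good_iff by blast
  next
    fix k1 k2 assume "k1 \<in> sh ` H" "k2 \<in> sh ` H" "k1 \<noteq> k2"
    then obtain h1 h2 where h: "h1 \<in> H" "k1 = sh h1" "h2 \<in> H" "k2 = sh h2" "h1 \<noteq> h2" by blast
    show "rel_coprime (E ` LR H) (S (sh ` H) k1) (S (sh ` H) k2)"
      unfolding h(2,4) S_eq[OF h(1)] S_eq[OF h(3)]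
        rel_coprime_image[OF im good_in[OF gd h(1)] good_in[OF gd h(3)]]
      by (rule good_coprime[OF gd h(1,3,5)])
  qed
qed

text \<open>The farther up the nonunit value at \<open>y\<close> is found, the farther down the
  translation moving \<open>y\<close> to \<open>p\<close> shifts \<open>Ht\<close>. The bound
  \<open>- z \<preceq> y\<close> puts the translate of \<open>h0\<close> below all of
  \<open>Q\<close>.\<close>

lemma ex_deep_good:
  assumes Ht: "lcr Ht" and gd: "good Ht" and Q: "finite Q"
  shows "\<exists>H. lcr H \<and> good H \<and> Q \<subseteq> H \<and> p \<in> H \<and> \<not> rel_unit (LR H) (S H p)"
proof -
  obtain h0 where h0: "h0 \<in> Ht" using light_cone_regularD(1)[OF Ht] by blast
  obtain z where z: "\<forall>x\<in>(\<lambda>x. x - p - h0) ` Q. z \<preceq> x" using ex_lower_bound Q by blast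
  obtain y where y: "- z \<preceq> y" "y \<in> Ht" "\<not> rel_unit (LR Ht) (S Ht y)"
    using ex_nonunit[OF Ht gd] by blast
  let ?sh = "\<lambda>x. x + (p - y)"
  have "x \<in> ?sh ` Ht" if "x \<in> Q" for x
  proof -
    have "z \<preceq> x - p - h0" using z that by blast
    hence "(z - (x - p - h0)) + (- z - y) \<in> cone v N" using y(1) cone_add unfolding cle_def by blast
    hence "h0 \<preceq> x - (p - y)" by (simp add: cle_def algebra_simps)
    hence "x - (p - y) \<in> Ht" using lcr_up[OF Ht h0] by blast
    moreover have "x = ?sh (x - (p - y))" by simp
    ultimately show ?thesis by blast
  qed
  moreover have p: "p = ?sh y" by simp
  moreover have "\<not> rel_unit (LR (?sh ` Ht)) (S (?sh ` Ht) p)"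
    using good_translate(3)[OF Ht gd y(2), of "p - y"] y(3) by simp
  ultimately show ?thesis
    using good_translate(1,2)[OF Ht gd, of "p - y"] y(2) by blast
qed

section \<open>A single mutation preserves the three properties\<close>

lemma good_remove:
  assumes Ht: "lcr Ht" "good Ht" and H: "lcr H" and gd: "good H" and min: "minimal_in H p"
  shows "good (H - {p})"
proof -
  define q where "q = p - w"
  define H' where "H' = H - {p}"
  have pH: "p \<in> H" using min by (simp add: minimal_in_def)
  have lcr': "lcr H'" unfolding H'_def by (rule lcr_remove[OF H min])
  have bd': "bd H' = insert q (bd H - {p})" unfolding H'_def q_def by (rule bd_remove[OF H min])
  have q_nb: "q \<notin> bd H" unfolding q_def by (rule mutation_new_notin_bd[OF H min])
  have qH': "q \<in> H'" unfolding H'_def q_def by (rule mutation_new_in[OF H min])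
  hence qH: "q \<in> H" "q \<noteq> p" by (auto simp: H'_def)
  have p_bd: "p \<in> bd H" by (rule minimal_bd[OF H min])
  have qw: "q + w = p" by (simp add: q_def)
  have stencil: "q + v i \<in> bd H" if "i < N" for i
    unfolding q_def by (rule mutation_stencil[OF H min that])
  obtain \<theta> where \<theta>: "is_hom \<theta>" "\<And>c. \<theta> (coef_emb c) = coef_emb c" "\<And>f. \<theta> (\<theta> f) = f"
      "\<theta> (var_frac p) = psi_frac q" "\<theta> (var_frac q) = phi_frac q"
      "\<And>x. x \<noteq> q \<Longrightarrow> x \<noteq> p \<Longrightarrow> \<theta> (var_frac x) = var_frac x"
    using ex_mutation[of q] unfolding qw by blast
  have S\<theta>: "\<theta> (S H' h) = S H h" if "h \<in> H'" for h
    unfolding H'_def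
    by (rule mutation_transport[OF H min good_nonzero[OF gd] \<theta>(1,2)])
       (use that \<theta>(5,6) in \<open>auto simp: H'_def q_def\<close>)
  have Sp: "S H p = var_frac p" by (rule S_init[OF H p_bd])
  have S_bd': "S H h = \<theta> (var_frac h)" if "h \<in> bd H'" for h
    using S\<theta>[of h] S_init[OF lcr' that] init_bd_subset[of v N H'] that by auto
  define R1 where "R1 = LR H"
  \<comment> \<open>\<open>R2\<close> is the new Laurent ring expressed through the old initial
    variables, so that both rings lie in one field and the solution is \<open>S H\<close> in either
    case.\<close>
  define R2 where "R2 = \<theta> ` LR H'"
  have R1: "is_subring R1" unfolding R1_def by (rule is_subring_laurent_frac)
  note im = \<theta>(1) inj_on_subset[OF hom_field_inj[OF \<theta>(1)] subset_UNIV] is_subring_laurent_frac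
  have R2: "is_subring R2" unfolding R2_def by (rule is_subring_image[OF im])
  have constR2: "coef_emb c \<in> R2" for c
    unfolding R2_def using \<theta>(2) coef_emb_in by (metis imageI)
  have invR2: "S H h \<in> R2" "inverse (S H h) \<in> R2" if "h \<in> bd H'" for h
    unfolding S_bd'[OF that] R2_def hom_inverse[OF \<theta>(1), symmetric]
    using var_frac_in[OF that] inverse_var_frac_in[OF that] by blast+
  have var_eq: "\<theta> (var_frac x) = var_frac x" "S H x = var_frac x" "x \<in> bd H'" if "x \<in> bd H" "x \<noteq> p" for x
    using that \<theta>(6)[of x] q_nb bd' S_init[OF H, of x] by blast+
  have p2: "rel_prime R2 (var_frac p)"
  proof -
    have "rel_prime (LR H') (psi_frac q)"
    proof (rule psi_frac_prime)
      show "q \<in> bd H'" using bd' by blast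
      show "q + v i \<in> bd H'" if "i < N" "i \<noteq> N - 1" for i
        using stencil[OF that(1)] add_v_inj[OF that(1) w_index, of q] that(2) unfolding qw bd' by blast
    qed
    hence "rel_prime R2 (\<theta> (psi_frac q))"
      unfolding R2_def using rel_prime_image[OF im] rel_prime_in by blast
    thus ?thesis using \<theta>(3)[of "var_frac p"] unfolding \<theta>(4) by simp
  qed
  interpret M: mutation_rings R1 R2 "var_frac p" "S H q"
  proof
    show "var_frac p \<in> R1" "inverse (var_frac p) \<in> R1"
      unfolding R1_def using var_frac_in[OF p_bd] inverse_var_frac_in[OF p_bd] by blast+
    show "S H q \<in> R2" "inverse (S H q) \<in> R2" using invR2[of q] bd' by auto
    show "rel_prime R1 (S H q)" unfolding R1_def by (rule good_prime[OF gd qH(1)])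
    show "\<exists>n. x * var_frac p ^ n \<in> R2" if "x \<in> R1" for x
    proof -
      have "\<exists>n. (\<lambda>f. f) x * var_frac p ^ n \<in> R2"
      proof (rule laurent_frac_clear[where E = "\<lambda>f. f", OF that[unfolded R1_def] _ R2 rel_prime_in[OF p2]])
        show "coef_emb c \<in> R2" for c by (rule constR2)
        show "is_hom (\<lambda>f :: ('l, 'r) laurent_fract. f)" by (simp add: is_hom_def)
        fix x assume x: "x \<in> bd H"
        show "var_frac x \<in> R2"
          using rel_prime_in[OF p2] var_eq[OF x] invR2(1)[of x] by (cases "x = p") auto
        show "\<exists>n. inverse (var_frac x) * var_frac p ^ n \<in> R2"
        proof (cases "x = p")
          case True
          thus ?thesis using subring_1[OF R2] by (intro exI[of _ 1]) (simp add: var_frac_nonzero)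
        next
          case False
          thus ?thesis using var_eq[OF x] invR2(2)[of x] by (intro exI[of _ 0]) simp
        qed
      qed
      thus ?thesis .
    qed
    show "\<exists>n. x * S H q ^ n \<in> R1" if xR2: "x \<in> R2" for x
    proof -
      obtain f where f: "f \<in> LR H'" "x = \<theta> f" using xR2 unfolding R2_def by blast
      have qR1: "S H q \<in> R1" unfolding R1_def by (rule good_in[OF gd qH(1)])
      have \<theta>q: "\<theta> (var_frac q) = S H q" using S_bd'[of q] bd' by simp
      have vars: "\<theta> (var_frac x) \<in> R1 \<and> (x \<noteq> q \<longrightarrow> \<theta> (inverse (var_frac x)) \<in> R1)" if "x \<in> bd H'" for x
      proof (cases "x = q")
        case False
        hence x: "x \<in> bd H" "x \<noteq> p" using that bd' by auto
        show ?thesis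
          unfolding hom_inverse[OF \<theta>(1)] var_eq(1)[OF x] R1_def
          using var_frac_in[OF x(1)] inverse_var_frac_in[OF x(1)] by blast
      qed (use \<theta>q qR1 in simp)
      show ?thesis
        unfolding f(2)
      proof (rule laurent_frac_clear[OF f(1) \<theta>(1) R1 qR1])
        show "\<theta> (coef_emb c) \<in> R1" for c unfolding \<theta>(2) R1_def by (rule coef_emb_in)
        fix x assume x: "x \<in> bd H'"
        show "\<theta> (var_frac x) \<in> R1" using vars[OF x] by blast
        show "\<exists>n. \<theta> (inverse (var_frac x)) * S H q ^ n \<in> R1"
        proof (cases "x = q")
          case True
          thus ?thesis using subring_1[OF R1] good_nonzero[OF gd qH(1)] \<theta>q
            by (intro exI[of _ 1]) (simp add: hom_inverse[OF \<theta>(1)])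
        next
          case False
          thus ?thesis using vars[OF x] by (intro exI[of _ 0]) simp
        qed
      qed
    qed
  qed (fact R1 R2 p2)+
  let ?\<pi> = "var_frac p :: ('l, 'r) laurent_fract"
  \<comment> \<open>An equation \<open>S H h = ?\<pi> * \<theta> f\<close> is specialised to the
    values of a deep good domain \<open>H1\<close>. There it reads
    \<open>S H1 h = S H1 p * z\<close> with \<open>z\<close> in the local ring at
    \<open>S H1 p\<close>, against coprimeness of \<open>S H1 h\<close> and the nonunit
    \<open>S H1 p\<close>.\<close>
  have not_dvd: "\<not> rel_dvd R2 ?\<pi> (S H h)" if h: "h \<in> H'" and nu: "\<not> rel_unit R2 ?\<pi>" for h
  proof
    assume "rel_dvd R2 ?\<pi> (S H h)"
    then obtain f where f: "f \<in> LR H'" "S H h = ?\<pi> * \<theta> f"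
      unfolding rel_dvd_def R2_def by blast
    have hH: "h \<in> H" "h \<noteq> p" using h by (auto simp: H'_def)
    \<comment> \<open>A finite region containing \<open>h\<close>, \<open>q\<close> and
      \<open>p\<close> in which the recursion for these points takes place: from a noninitial point
      of \<open>Q\<close> it steps down and stays in \<open>Q\<close>.\<close>
    define Q where "Q = {x\<in>H. x \<preceq> h} \<union> {x\<in>H. x \<preceq> q}"
    have "finite Q" unfolding Q_def using light_cone_regularD(2)[OF H] hH qH by blast
    from ex_deep_good[OF Ht this] obtain H1 where
      H1: "lcr H1" "good H1" "Q \<subseteq> H1" "p \<in> H1" "\<not> rel_unit (LR H1) (S H1 p)" by blast
    have Qq: "q \<in> Q" "h \<in> Q" using qH hH le_refl by (auto simp: Q_def)
    have "p \<preceq> q" using w_le_0 by (simp add: q_def cle_def)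
    hence pQ: "p \<in> Q" using pH by (simp add: Q_def)
    have Q_closed: "x + v i \<in> Q" if "x \<in> Q" "x \<notin> bd H" "i < N" for x i
      using that add_v_in[of x H i] add_v_le[OF that(3), of x] le_trans unfolding Q_def by blast
    \<comment> \<open>Variables outside \<open>Q\<close> are sent to 1, which is nonzero and causes
      no trouble in the local ring.\<close>
    define y where "y x = (if x \<in> Q then S H1 x else 1)" for x
    have y_nz: "y x \<noteq> 0" for x using good_nonzero[OF H1(2)] H1(3) by (auto simp: y_def)
    define \<rho> where "\<rho> X = laur_eval coef_emb X y" for X :: "('l, 'r) laurent"
    have \<rho>: "is_hom \<rho>" unfolding \<rho>_def by (rule is_hom_laur_eval[OF is_hom_coef_emb y_nz])
    have \<rho>_const: "\<rho> (laur_const c) = coef_emb c" for c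
      unfolding \<rho>_def by (rule laur_eval_const[OF is_hom_coef_emb])
    have \<rho>_var: "\<rho> (laur_var x) = y x" for x
      unfolding \<rho>_def by (rule laur_eval_var[OF is_hom_coef_emb])
    have rel: "frac_rel \<rho> (S H x) (S H1 x)" if "x \<in> Q" for x
    proof (rule S_transport[OF H _ Q_closed \<rho> \<rho>_const _ _ _ that])
      show "Q \<subseteq> H" by (auto simp: Q_def)
      show "\<rho> (laur_var x) = S H1 x" if "x \<in> Q" for x using that by (simp add: \<rho>_var y_def)
      show "S H1 x \<noteq> 0" if "x \<in> Q" for x using good_nonzero[OF H1(2)] H1(3) that by blast
      show "S H1 x = Phi_at (S H1) x" if "x \<in> Q" "x \<notin> bd H" for x
      proof (rule S_rec[OF H1(1)])
        show "x \<in> H1" "x \<notin> bd H1" using that Q_closed H1(3) by (auto simp: init_bd_def)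
      qed
    qed
    define R where "R = LR H1"
    have R: "is_subring R" unfolding R_def by (rule is_subring_laurent_frac)
    have \<pi>1: "rel_prime R (S H1 p)" "\<not> rel_unit R (S H1 p)"
      unfolding R_def using good_prime[OF H1(2,4)] H1(5) by auto
    have free: "S H1 x \<in> R" "\<not> rel_dvd R (S H1 p) (S H1 x)" if "x \<in> H1" "x \<noteq> p" for x
    proof -
      show "S H1 x \<in> R" unfolding R_def by (rule good_in[OF H1(2) that(1)])
      show "\<not> rel_dvd R (S H1 p) (S H1 x)"
        using good_coprime[OF H1(2,4) that(1)] that(2) \<pi>1(2) rel_dvd_refl[OF R, of "S H1 p"]
          rel_prime_in[OF \<pi>1(1)]
        unfolding rel_coprime_iff R_def by blast
    qed
    define Loc where "Loc = local_ring R (S H1 p)"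
    have Loc: "is_subring Loc" "R \<subseteq> Loc"
      unfolding Loc_def using is_subring_local_ring[OF R \<pi>1] subset_local_ring[OF R \<pi>1] by auto
    \<comment> \<open>Every value other than the one at \<open>p\<close> is not divisible by the
      prime \<open>S H1 p\<close>, so it becomes invertible in the local ring.\<close>
    have y_Loc: "y x \<in> Loc" "inverse (y x) \<in> Loc" if "x \<noteq> p" for x
      using that free[of x] H1(3) Loc subring_1[OF Loc(1)] inverse_in_local_ring[OF R \<pi>1, of "S H1 x"]
      unfolding y_def Loc_def by (auto split: if_splits)
    \<comment> \<open>The cofactor comes from a Laurent polynomial on the new boundary, where
      \<open>p\<close> does not occur. Its new variable \<open>q\<close> is sent by
      \<open>\<theta>\<close> to \<open>S H q\<close>, which specialises to \<open>S H1 q\<close>;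
      the other variables are specialised directly.\<close>
    have "\<exists>z\<in>Loc. frac_rel \<rho> (\<theta> f) z" if "f \<in> LR H'" for f
      using that
    proof (induction rule: laurent_frac_induct)
      case (const c)
      have "frac_rel \<rho> (coef_emb c) (coef_emb c)"
        using frac_rel_to_frac[OF \<rho>, of "laur_const c"] by (simp add: \<rho>_const coef_emb_def)
      moreover have "coef_emb c \<in> R" unfolding R_def by (rule coef_emb_in)
      ultimately show ?case using Loc unfolding \<theta>(2) by blast
    next
      case (var x)
      have x: "x \<noteq> p" using var qH(2) unfolding bd' by blast
      have "frac_rel \<rho> (\<theta> (var_frac x)) (y x)"
      proof (cases "x = q")
        case True
        thus ?thesis using rel[OF Qq(1)] S_bd'[OF var] Qq by (simp add: y_def)
      next
        case False
        thus ?thesis using frac_rel_to_frac[OF \<rho>, of "laur_var x"] \<theta>(6)[OF False x]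
          by (simp add: \<rho>_var var_frac_def)
      qed
      thus ?case using y_Loc[OF x] by blast
    next
      case (inv x)
      have x: "x \<noteq> p" using inv qH(2) unfolding bd' by blast
      have "frac_rel \<rho> (\<theta> (var_frac x)) (y x)"
      proof (cases "x = q")
        case True
        thus ?thesis using rel[OF Qq(1)] S_bd'[OF inv] Qq by (simp add: y_def)
      next
        case False
        thus ?thesis using frac_rel_to_frac[OF \<rho>, of "laur_var x"] \<theta>(6)[OF False x]
          by (simp add: \<rho>_var var_frac_def)
      qed
      hence "frac_rel \<rho> (\<theta> (inverse (var_frac x))) (inverse (y x))"
        unfolding hom_inverse[OF \<theta>(1)] using frac_rel_inverse[OF \<rho>] y_nz by blast
      thus ?case using y_Loc[OF x] by blast
    next
      case (add f g)
      thus ?case unfolding hom_add[OF \<theta>(1)] using frac_rel_add[OF \<rho>] subring_add[OF Loc(1)] by blast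
    next
      case (mult f g)
      thus ?case unfolding hom_mult[OF \<theta>(1)] using frac_rel_mult[OF \<rho>] subring_mult[OF Loc(1)] by blast
    qed
    then obtain z where z: "z \<in> Loc" "frac_rel \<rho> (\<theta> f) z" using f(1) by blast
    have "frac_rel \<rho> (S H h) (S H1 p * z)"
      unfolding f(2) Sp[symmetric] by (rule frac_rel_mult[OF \<rho> rel[OF pQ] z(2)])
    hence eq: "S H1 h = S H1 p * z" using frac_rel_unique[OF \<rho>] rel[OF Qq(2)] by blast
    obtain g where g: "g \<in> R" "\<not> rel_dvd R (S H1 p) g" "z * g \<in> R"
      using z(1) unfolding Loc_def local_ring_def by blast
    have "S H1 h * g = S H1 p * (z * g)" unfolding eq by (simp only: mult.assoc)
    hence "rel_dvd R (S H1 p) (S H1 h * g)" using g(3) unfolding rel_dvd_def by blast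
    hence "rel_dvd R (S H1 p) (S H1 h)"
      using rel_prime_dvd_multD[OF \<pi>1(1)] g free(1)[of h] hH(2) H1(3) Qq(2) by blast
    thus False using free(2)[of h] hH(2) H1(3) Qq(2) by blast
  qed
  have SR1: "S H h \<in> R1" if "h \<in> H" for h unfolding R1_def by (rule good_in[OF gd that])
  \<comment> \<open>If \<open>?\<pi>\<close> is a nonunit, the arguments of \<open>Phi\<close> lie
    in \<open>R2\<close> by induction and are not divisible by \<open>?\<pi>\<close>, so the value
    lies in the local ring at \<open>?\<pi>\<close>. It also lies in \<open>R2\<close> up to a power
    of \<open>?\<pi>\<close>, and both facts together leave no denominator.\<close>
  have in_R2: "S H h \<in> R2" if "h \<in> H'" for h
    using lcr' that
  proof (induction rule: lcr_induct)
    case (less h)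
    have hH: "h \<in> H" using less.hyps by (simp add: H'_def)
    obtain n where n: "S H h * ?\<pi> ^ n \<in> R2" using M.clear12 SR1[OF hH] by blast
    show ?case
    proof (cases "h \<in> bd H'")
      case True
      thus ?thesis by (rule invR2)
    next
      case False
      show ?thesis
      proof (cases "rel_unit R2 ?\<pi>")
        case True
        have "inverse ?\<pi> ^ n \<in> R2"
          using rel_unit_in[OF rel_unit_inverse[OF True]] by (rule subring_power[OF R2])
        hence "(S H h * ?\<pi> ^ n) * inverse ?\<pi> ^ n \<in> R2" using subring_mult[OF R2 n] by blast
        thus ?thesis by (simp add: power_inverse var_frac_nonzero mult.assoc)
      next
        case nu: False
        have "h \<notin> bd H" using False bd' less.hyps by (auto simp: H'_def)
        hence "S H h = Phi_at (S H) h" using S_rec[OF H hH] by blast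
        moreover have "Phi_at (S H) h \<in> local_ring R2 ?\<pi>"
        proof (rule laur_eval_in_subring[OF Phi_vars is_subring_local_ring[OF R2 p2 nu]])
          note sub = subset_local_ring[OF R2 p2 nu]
          show "coef_emb c \<in> local_ring R2 ?\<pi>" for c using sub constR2 by blast
          fix i assume "i \<in> {..<N}"
          hence i: "i < N" by simp
          have k: "h + v i \<in> H'" using add_v_in[OF less.hyps False i] .
          have IH: "S H (h + v i) \<in> R2"
            using less.IH[OF k add_v_le[OF i]] v_nonzero[OF i] by simp
          show "S H (h + v i) \<in> local_ring R2 ?\<pi>" using sub IH by blast
          show "inverse (S H (h + v i)) \<in> local_ring R2 ?\<pi>"
            by (rule inverse_in_local_ring[OF R2 p2 nu IH not_dvd[OF k nu]])
        qed
        ultimately show ?thesis using local_ring_clear[OF R2 p2 nu _ n] by simp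
      qed
    qed
  qed
  have free: "rel_unit R2 ?\<pi> \<or> \<not> rel_dvd R2 ?\<pi> (S H h)" if "h \<in> H'" for h
    using not_dvd[OF that] by blast
  have prime1: "rel_prime R1 (S H h)" if "h \<in> H" for h unfolding R1_def by (rule good_prime[OF gd that])
  have pull: "S H' h \<in> LR H'" if h: "h \<in> H'" for h
  proof -
    obtain f where "f \<in> LR H'" "\<theta> (S H' h) = \<theta> f"
      using in_R2[OF h] S\<theta>[OF h] unfolding R2_def by auto
    thus ?thesis using \<theta>(3) by metis
  qed
  have "good H'"
    unfolding good_iff
  proof (intro conjI ballI impI pull)
    fix h assume h: "h \<in> H'"
    have "rel_irred R2 (S H h)"
      using M.irred_transfer[OF prime1 in_R2[OF h] free[OF h]] h by (simp add: H'_def)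
    thus "rel_irred (LR H') (S H' h)"
      using rel_irred_image[OF im pull[OF h]] unfolding R2_def S\<theta>[OF h] by blast
  next
    fix h1 h2 assume h: "h1 \<in> H'" "h2 \<in> H'" "h1 \<noteq> h2"
    have hH: "h1 \<in> H" "h2 \<in> H" using h by (auto simp: H'_def)
    have "rel_coprime R1 (S H h1) (S H h2)"
      unfolding R1_def by (rule good_coprime[OF gd hH h(3)])
    hence "rel_coprime R2 (S H h1) (S H h2)"
      by (rule M.coprime_transfer[OF prime1[OF hH(1)] in_R2[OF h(1)] free[OF h(1)]
            prime1[OF hH(2)] in_R2[OF h(2)] free[OF h(2)]])
    thus "rel_coprime (LR H') (S H' h1) (S H' h2)"
      using rel_coprime_image[OF im pull[OF h(1)] pull[OF h(2)]]
      unfolding R2_def S\<theta>[OF h(1)] S\<theta>[OF h(2)] by blast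
  qed
  thus ?thesis by (simp add: H'_def)
qed

section \<open>From one good domain to all domains\<close>

text \<open>\<open>H\<close> may differ from every translate of \<open>Ht\<close> in infinitely many
  points, so the properties are checked for one pair \<open>h1\<close>, \<open>h2\<close> at a time.
  Only the points below this pair matter, and there a good domain \<open>H2\<close> can be made to
  coincide with \<open>H\<close>.\<close>

lemma good_everywhere:
  assumes Ht: "lcr Ht" "good Ht" and H: "lcr H"
  shows "good H"
proof -
  have main: "S H h1 \<in> LR H \<and> rel_irred (LR H) (S H h1) \<and>
      (h1 \<noteq> h2 \<longrightarrow> rel_coprime (LR H) (S H h1) (S H h2))"
    if h: "h1 \<in> H" "h2 \<in> H" for h1 h2
  proof -
    define below where "below x \<longleftrightarrow> x \<preceq> h1 \<or> x \<preceq> h2" for x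
    define P where "P = {x\<in>H. below x}"
    have "P = {x\<in>H. x \<preceq> h1} \<union> {x\<in>H. x \<preceq> h2}" by (auto simp: P_def below_def)
    hence "finite P" using light_cone_regularD(2)[OF H] h by simp
    from ex_deep_good[OF Ht this] obtain H1 where H1: "lcr H1" "good H1" "P \<subseteq> H1" by blast
    \<comment> \<open>The surplus of the translate below \<open>h1\<close> or \<open>h2\<close>. It
      is finite because \<open>h1\<close> and \<open>h2\<close> lie in \<open>H1\<close>, and closed
      downwards in \<open>H1\<close> because \<open>H\<close> is closed upwards.\<close>
    define D where "D = {x\<in>H1. below x \<and> x \<notin> H}"
    define H2 where "H2 = H1 - D"
    have hP: "h1 \<in> P" "h2 \<in> P" using h le_refl by (auto simp: P_def below_def)
    have "D \<subseteq> {x\<in>H1. x \<preceq> h1} \<union> {x\<in>H1. x \<preceq> h2}" by (auto simp: D_def below_def)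
    hence fD: "finite D"
      using light_cone_regularD(2)[OF H1(1), of h1] light_cone_regularD(2)[OF H1(1), of h2] hP H1(3)
      by (meson finite_UnI finite_subset subsetD)
    have below_trans: "below x" if "x \<preceq> y" "below y" for x y
      using that le_trans unfolding below_def by blast
    have upD: "y \<notin> D" if "x \<in> H1 - D" "x \<preceq> y" for x y
      using that below_trans[of x y] lcr_up[OF H, of x y] unfolding D_def by blast
    have subD: "D \<subseteq> H1" by (auto simp: D_def)
    have "lcr (H1 - D) \<and> good (H1 - D)"
      by (rule removal_induct[where P = good, OF H1(1) fD subD _ H1(2)], erule (1) upD, rule good_remove[OF Ht])
    hence H2: "lcr H2" "good H2" by (auto simp: H2_def)
    have PH: "P \<subseteq> H" "P \<subseteq> H2" using H1(3) by (auto simp: P_def H2_def D_def)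
    have next_iff: "x + v i \<in> H \<longleftrightarrow> x + v i \<in> H2" "x + v i \<in> H \<longleftrightarrow> x + v i \<in> P" if "x \<in> P" "i < N" for x i
    proof -
      have b: "below (x + v i)" using that below_trans[OF add_v_le] by (auto simp: P_def)
      show "x + v i \<in> H \<longleftrightarrow> x + v i \<in> P" using b by (auto simp: P_def)
      thus "x + v i \<in> H \<longleftrightarrow> x + v i \<in> H2" using b PH by (auto simp: H2_def D_def)
    qed
    have bd_iff: "x \<in> bd H \<longleftrightarrow> x \<in> bd H2" if "x \<in> P" for x
      using that PH next_iff(1)[OF that] by (auto simp: init_bd_def)
    have closed: "x + v i \<in> P" if "x \<in> P" "x \<notin> bd H" "i < N" for x i
      using next_iff(2)[OF that(1,3)] add_v_in[OF _ that(2,3)] that(1) PH by blast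
    have nz2: "S H2 x \<noteq> 0" if "x \<in> P" for x using good_nonzero[OF H2(2)] that PH by blast
    have rec2: "S H2 x = Phi_at (S H2) x" if "x \<in> P" "x \<notin> bd H" for x
      using S_rec[OF H2(1), of x] that bd_iff PH by blast
    have "(\<lambda>f. f) (S H x) = S H2 x" if "x \<in> P" for x
    proof (rule S_hom_transport[OF H PH(1) closed _ _ _ nz2 rec2 that])
      show "is_hom (\<lambda>f :: ('l, 'r) laurent_fract. f)" by (simp add: is_hom_def)
      show "var_frac x = S H2 x" if "x \<in> P" "x \<in> bd H" for x
        using S_init[OF H2(1), of x] bd_iff that by simp
    qed auto
    hence S_eq: "S H x = S H2 x" if "x \<in> P" for x using that by simp
    \<comment> \<open>The initial variables common to both domains near the pair. Values on
      \<open>P\<close> involve no others, so divisibility, units and primality can be moved between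
      the two rings through \<open>laurent_frac T\<close>.\<close>
    define T where "T = P \<inter> bd H"
    have T: "T \<subseteq> bd H" "T \<subseteq> bd H2" using bd_iff by (auto simp: T_def)
    have in_T: "S H x \<in> laurent_frac T" if x: "x \<in> P" for x
    proof -
      obtain X where X: "X \<in> laurent_in (bd H2)" "S H2 x = to_frac X"
        using good_in[OF H2(2)] x PH unfolding laurent_frac_def by blast
      \<comment> \<open>The recursion starting in \<open>P\<close> stays in \<open>P\<close> and
        ends in variables from \<open>T\<close>, so the retraction fixes the value. Applied to the
        Laurent polynomial \<open>X\<close> representing it, the retraction yields a representative
        in the variables \<open>T\<close>.\<close>
      have "frac_rel (laur_retract T) (S H2 x) (S H2 x)"
      proof (rule S_transport[OF H2(1) PH(2) _ is_hom_laur_retract _ _ nz2 _ x])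
        show "h + v i \<in> P" if "h \<in> P" "h \<notin> bd H2" "i < N" for h i using closed bd_iff that by blast
        show "S H2 h = Phi_at (S H2) h" if "h \<in> P" "h \<notin> bd H2" for h using rec2 bd_iff that by blast
        show "laur_retract T (laur_const c) = coef_emb c" for c
          unfolding coef_emb_def by (rule laur_retract_id[OF laur_const_in])
        show "laur_retract T (laur_var h) = S H2 h" if "h \<in> P" "h \<in> bd H2" for h
          using S_init[OF H2(1) that(2)] that bd_iff laur_retract_id[OF laur_var_in, of h T]
          by (simp add: T_def var_frac_def)
      qed
      hence "laur_retract T X = S H2 x"
        using frac_rel_unique[OF is_hom_laur_retract] frac_rel_to_frac[OF is_hom_laur_retract] X(2) by metis
      moreover have "laur_retract T X \<in> laurent_frac T"
        using laur_retract_in[OF X(1), of T] laurent_frac_mono[of "bd H2 \<inter> T" T] by blast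
      ultimately show ?thesis using S_eq[OF x] by simp
    qed
    note R = is_subring_laurent_frac
    have prime: "rel_prime (LR H) (S H x)" if x: "x \<in> P" for x
    proof -
      have "rel_prime (LR H2) (S H x)"
        unfolding S_eq[OF x] using good_prime[OF H2(2)] x PH by blast
      thus ?thesis
        using rel_prime_laurent_frac_mono[OF rel_prime_laurent_frac_restrict[OF _ T(2) in_T[OF x]] T(1)] by blast
    qed
    have irred: "rel_irred (LR H) (S H x)" if "x \<in> P" for x
      by (rule rel_prime_imp_irred[OF R prime[OF that]])
    have "rel_coprime (LR H) (S H h1) (S H h2)" if ne: "h1 \<noteq> h2"
      unfolding rel_coprime_iff
    proof (intro conjI ballI impI)
      show "S H h1 \<in> LR H" "S H h2 \<in> LR H"
        using rel_prime_in[OF prime] hP by auto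
      fix d :: "('l, 'r) laurent_fract" assume d: "d \<in> LR H" "rel_dvd (LR H) d (S H h1)"
        "rel_dvd (LR H) d (S H h2)"
      then obtain a b where ab: "a \<in> LR H" "S H h1 = d * a"
        "b \<in> LR H" "S H h2 = d * b" unfolding rel_dvd_def by blast
      \<comment> \<open>The divisor \<open>d\<close> may involve variables outside \<open>T\<close>
        and cannot be moved to \<open>H2\<close>. If it is a nonunit, irreducibility makes it an
        associate of \<open>S H h1\<close>, so that \<open>S H h1\<close> divides
        \<open>S H h2\<close>; this relation only involves elements over \<open>T\<close>.\<close>
      show "rel_unit (LR H) d"
      proof (rule ccontr)
        assume nu: "\<not> rel_unit (LR H) d"
        hence "rel_unit (LR H) a"
          using irred[OF hP(1)] ab d unfolding rel_irred_def by blast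
        then obtain a' where a': "a' \<in> LR H" "a * a' = 1" by (auto simp: rel_unit_def)
        have "S H h1 * (a' * b) = S H h2 * (a * a')" unfolding ab by (simp only: ac_simps)
        hence "S H h2 = S H h1 * (a' * b)" using a'(2) by simp
        hence "rel_dvd (LR H) (S H h1) (S H h2)"
          using subring_mult[OF R a'(1) ab(3)] unfolding rel_dvd_def by blast
        hence "rel_dvd (LR H2) (S H h1) (S H h2)"
          using rel_dvd_laurent_frac_restrict[OF T(1) in_T[OF hP(1)] in_T[OF hP(2)]]
            rel_dvd_laurent_frac_restrict[OF T(2) in_T[OF hP(1)] in_T[OF hP(2)]] by blast
        moreover have "rel_coprime (LR H2) (S H h1) (S H h2)"
          unfolding S_eq[OF hP(1)] S_eq[OF hP(2)] using good_coprime[OF H2(2) _ _ ne] hP PH by blast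
        ultimately have "rel_unit (LR H2) (S H h1)"
          using rel_dvd_refl[OF R] unfolding rel_coprime_iff by blast
        hence "rel_unit (LR H) (S H h1)"
          using rel_unit_laurent_frac_restrict[OF T(1) in_T[OF hP(1)]]
            rel_unit_laurent_frac_restrict[OF T(2) in_T[OF hP(1)]] by blast
        thus False using nu rel_unit_multD(1)[OF R] ab d unfolding ab(2) by blast
      qed
    qed
    thus ?thesis using irred[OF hP(1)] rel_prime_in[OF prime[OF hP(1)]] by blast
  qed
  show ?thesis unfolding good_iff using main by blast
qed

end

theorem theorem1p18:
  fixes v :: "nat \<Rightarrow> 'l::{ab_group_add,linorder}"
    and N :: nat
    and Phi Psi :: "(nat \<Rightarrow>\<^sub>0 int) \<Rightarrow>\<^sub>0 'r::{factorial_semiring,idom}"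
    and Ht :: "'l set"
  assumes N_pos: "0 < N"
    and distinct: "inj_on v {..<N}"
    and generate: "\<forall>x. \<exists>a::nat \<Rightarrow> int. x = (\<Sum>i<N. zsc (a i) (v i))"
    and pos_indep: "\<forall>a::nat \<Rightarrow> nat. (\<Sum>i<N. nsc (a i) (v i)) = 0 \<longrightarrow> (\<forall>i<N. a i = 0)"
    and Phi_vars: "Phi \<in> laurent_in {..<N}"
    and Phi_irred: "rel_irred (laurent_in {..<N}) Phi"
    and Phi_not_monomial: "\<not> (\<exists>m c. Phi = Poly_Mapping.single m c)"
    and Phi_depends: "\<forall>i<N. \<exists>m\<in>Poly_Mapping.keys Phi. Poly_Mapping.lookup m i \<noteq> 0"
    and vN_min: "cle v N (v (N - 1)) 0 \<and> (\<forall>i<N. cle v N (v (N - 1)) (v i))"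
    and Psi_vars: "Psi \<in> laurent_in {..<N}"
    and Psi_irred: "rel_irred (laurent_in {..<N}) Psi"
    and solve1: "gen_eval Phi ((\<lambda>i. Yv (i + 1))(N - 1 := gen_eval Psi ((\<lambda>i. Yv (i + 1))(N - 1 := Yv 0)))) = Yv 0"
    and solve2: "gen_eval Psi ((\<lambda>i. Yv (i + 1))(N - 1 := gen_eval Phi (\<lambda>i. Yv (i + 1)))) = Yv N"
    and Ht_reg: "light_cone_regular v N Ht"
    and Ht_LP: "laurent_property v N Phi Ht"
    and Ht_irr: "irreducibility v N Phi Ht"
    and Ht_cop: "coprimeness v N Phi Ht"
  shows "\<forall>H. light_cone_regular v N H \<longrightarrow>
           laurent_property v N Phi H \<and> irreducibility v N Phi H \<and> coprimeness v N Phi H"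
proof -
  interpret solvable_equation v N Phi Psi
    by unfold_locales (fact N_pos distinct generate pos_indep Phi_vars Phi_irred Phi_not_monomial
      vN_min Psi_vars Psi_irred solve1 solve2)+
  have "good Ht" using Ht_LP Ht_irr Ht_cop by (simp add: good_def)
  thus ?thesis using good_everywhere[OF Ht_reg] unfolding good_def by blast
qed

end
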